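(* Let $G$ be a finite non-cyclic group generated by two elements with $G\notin\Phi$, where $\Phi$ is the class of groups $H$ such that $H=\langle x,y\rangle$ for some $x,y$ with $o(x)=4$ and such that $o(a)\le 4$ and $o(b)\le 4$ for all $a,b\in H$ with $\langle a,b\rangle=H$. Then $G$ admits a $2$-POSR of valency $3$ except (exactly) when $G$ is isomorphic to $\mathbb{Z}_2^2$ or $D_6$. That is, $G$ admits a $2$-POSR of valency $3$ if and only if $G\not\cong\mathbb{Z}_2^2$ and $G\not\cong D_6$.
   Context: A digraph $\Gamma$ consists of a non-empty vertex set $V(\Gamma)$ and an arc set $A(\Gamma)\subseteq V(\Gamma)\times V(\Gamma)$. $\mathrm{Aut}(\Gamma)$ is the group of permutations $\sigma$ of $V(\Gamma)$ with $(u,v)\in A(\Gamma)\iff(u^\sigma,v^\sigma)\in A(\Gamma)$. $\Gamma$ is regular of valency $k$ if every vertex has out-degree $k$ and in-degree $k$. Let $G$ be a finite group and $m\ge 2$. Given subsets $T_{i,j}\subseteq G$ for $i,j\in\mathbb{Z}_m$, the $m$-Cayley digraph $\mathrm{Cay}(G,T_{i,j}:i,j\in\mathbb{Z}_m)$ has vertex set $G\times\mathbb{Z}_m$ (write $g_i$ for $(g,i)$) and arc set $\bigcup_{i,j}\{(g_i,(tg)_j): g\in G,\ t\in T_{i,j}\}$. It is an $m$-partite Cayley digraph if $T_{i,i}=\emptyset$ for all $i\in\mathbb{Z}_m$, and it is oriented if $T_{i,j}\cap T_{j,i}^{-1}=\emptyset$ for all $i,j\in\mathbb{Z}_m$. $G$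 admits an $m$-partite oriented semiregular representation ($m$-POSR) of valency $3$ if there exists an oriented $m$-partite Cayley digraph $\Gamma$ of $G$ that is regular of valency $3$ and satisfies $\mathrm{Aut}(\Gamma)\cong G$. $o(g)$ denotes the order of $g$, and $D_n$ denotes the dihedral group of order $n$ (so $D_6$ has order $6$). *)

theory Defs
  imports
    "HOL-Algebra.Elementary_Groups"
    "HOL-Algebra.Multiplicative_Group"
    "HOL-Algebra.Bij"
    "Graph_Theory.Pair_Digraph"
begin

text \<open>
  A digraph whose arcs are pairs of vertices is a \<^typ>\<open>'v pair_pre_digraph\<close>.
\<close>

definition regular_of_valency :: "'v pair_pre_digraph \<Rightarrow> nat \<Rightarrow> bool" where
  "regular_of_valency \<Gamma> k \<longleftrightarrow>
     (\<forall>v \<in> pverts \<Gamma>. out_degree (with_proj \<Gamma>) v = k \<and> in_degree (with_proj \<Gamma>) v = k)"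

text \<open>
  Elements of \<^const>\<open>BijGroup\<close> are undefined outside the vertex set, so each automorphism is
  counted once.  The product in \<^const>\<open>BijGroup\<close> composes from right to left; exponential
  notation for the action composes the other way round, which gives the opposite and hence
  an isomorphic group.
\<close>

definition Aut_group :: "'v pair_pre_digraph \<Rightarrow> ('v \<Rightarrow> 'v) monoid" where
  "Aut_group \<Gamma> = (BijGroup (pverts \<Gamma>))
     \<lparr>carrier := {\<sigma> \<in> Bij (pverts \<Gamma>). \<forall>u \<in> pverts \<Gamma>. \<forall>v \<in> pverts \<Gamma>.
        (u, v) \<in> parcs \<Gamma> \<longleftrightarrow> (\<sigma> u, \<sigma> v) \<in> parcs \<Gamma>}\<rparr>"

text \<open>
  The index set $\mathbb{Z}_m$ only serves to label the parts, so it is rendered as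
  \<open>{..<m}\<close>; values of \<open>T\<close> at other indices are irrelevant.
\<close>

definition m_cayley_sets ::
    "('a, 'b) monoid_scheme \<Rightarrow> nat \<Rightarrow> (nat \<Rightarrow> nat \<Rightarrow> 'a set) \<Rightarrow> bool" where
  "m_cayley_sets G m T \<longleftrightarrow> (\<forall>i<m. \<forall>j<m. T i j \<subseteq> carrier G)"

definition m_cayley_digraph ::
    "('a, 'b) monoid_scheme \<Rightarrow> nat \<Rightarrow> (nat \<Rightarrow> nat \<Rightarrow> 'a set) \<Rightarrow> ('a \<times> nat) pair_pre_digraph"
  where
  "m_cayley_digraph G m T =
     \<lparr>pverts = carrier G \<times> {..<m},
      parcs = (\<Union>i<m. \<Union>j<m. {((g, i), (t \<otimes>\<^bsub>G\<^esub> g, j)) | g t. g \<in> carrier G \<and> t \<in> T i j})\<rparr>"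

definition m_partite :: "nat \<Rightarrow> (nat \<Rightarrow> nat \<Rightarrow> 'a set) \<Rightarrow> bool" where
  "m_partite m T \<longleftrightarrow> (\<forall>i<m. T i i = {})"

definition m_oriented ::
    "('a, 'b) monoid_scheme \<Rightarrow> nat \<Rightarrow> (nat \<Rightarrow> nat \<Rightarrow> 'a set) \<Rightarrow> bool" where
  "m_oriented G m T \<longleftrightarrow> (\<forall>i<m. \<forall>j<m. T i j \<inter> set_inv\<^bsub>G\<^esub> (T j i) = {})"

definition admits_POSR :: "('a, 'b) monoid_scheme \<Rightarrow> nat \<Rightarrow> nat \<Rightarrow> bool" where
  "admits_POSR G m k \<longleftrightarrow>
     (\<exists>T. m_cayley_sets G m T \<and> m_partite m T \<and> m_oriented G m T \<and>
        regular_of_valency (m_cayley_digraph G m T) k \<and>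
        Aut_group (m_cayley_digraph G m T) \<cong> G)"

definition generating_pair :: "('a, 'b) monoid_scheme \<Rightarrow> 'a \<Rightarrow> 'a \<Rightarrow> bool" where
  "generating_pair G x y \<longleftrightarrow>
     x \<in> carrier G \<and> y \<in> carrier G \<and> generate G {x, y} = carrier G"

text \<open>
  The class $\Phi$.  Since \<^const>\<open>group.ord\<close> is 0 on elements of infinite order, order at
  most 4 is written as membership in \<open>{1..4}\<close>.
\<close>

definition in_Phi :: "('a, 'b) monoid_scheme \<Rightarrow> bool" where
  "in_Phi H \<longleftrightarrow> group H \<and>
     (\<exists>x y. generating_pair H x y \<and> group.ord H x = 4) \<and>
     (\<forall>a b. generating_pair H a b \<longrightarrow> group.ord H a \<in> {1..4} \<and> group.ord H b \<in> {1..4})"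

text \<open>
  The dihedral group of order \<open>n\<close> (for even \<open>n > 0\<close>): the pair \<open>(a, s)\<close> stands for
  $r^a$ if \<open>s\<close> is false and for $r^a f$ otherwise, where $r$ is a rotation of order \<open>n div 2\<close>
  and $f$ a reflection, so that $f r^b = r^{-b} f$.
\<close>

definition dihedral_group :: "nat \<Rightarrow> (int \<times> bool) monoid" where
  "dihedral_group n =
     \<lparr>carrier = {0..<int (n div 2)} \<times> UNIV,
      monoid.mult = (\<lambda>(a, s) (b, t). ((if s then a - b else a + b) mod int (n div 2), s \<noteq> t)),
      one = (0, False)\<rparr>"

lemma order_dihedral_group: "even n \<Longrightarrow> order (dihedral_group n) = n"
  by (auto simp: order_def dihedral_group_def card_cartesian_product)

lemma group_dihedral_group:
  assumes "even n" "n > 0"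
  shows "group (dihedral_group n)"
proof -
  have k: "int (n div 2) > 0"
    using assms by auto
  show ?thesis
  proof (rule groupI)
    fix x assume "x \<in> carrier (dihedral_group n)"
    then obtain a s where x: "x = (a, s)" "0 \<le> a" "a < int (n div 2)"
      by (auto simp: dihedral_group_def)
    show "\<exists>y \<in> carrier (dihedral_group n). y \<otimes>\<^bsub>dihedral_group n\<^esub> x = \<one>\<^bsub>dihedral_group n\<^esub>"
      by (rule bexI[of _ "(if s then a else (- a) mod int (n div 2), s)"])
         (use x k in \<open>auto simp: dihedral_group_def mod_simps\<close>)
  qed (use k in \<open>auto simp: dihedral_group_def mod_simps algebra_simps\<close>)
qed

end

theory Submission
  imports Defs "HOL-Computational_Algebra.Primes"
begin

text \<open>
  A 2-partite Cayley digraph of \<open>G\<close> that is oriented and regular of valency 3 amounts to two disjoint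
  3-subsets \<open>R\<close> and \<open>L\<close> of \<open>G\<close>: the arcs are $g_0 \to (rg)_1$ with \<open>r \<in> R\<close> and
  $(lg)_1 \to g_0$ with \<open>l \<in> L\<close>.  The right translations of \<open>G\<close> are automorphisms, and
  the task is to choose \<open>R\<close> and \<open>L\<close> such that there are no others.

  The tool for this is colour refinement.  Each arc has a label in \<open>R \<union> L\<close>, and right translations
  keep it.  A colouring of the labels is invariant if every automorphism keeps the colour of every arc.
  The number of closed walks of length 4 through an arc, sorted by the directions and colours of their
  steps, depends only on the label, so it refines an invariant colouring
  (\<open>invariant_colour_refine\<close>).  Once the colours separate enough labels, an automorphism commutes with
  left multiplication by a generating pair and hence is a right translation
  (\<open>rigid_if_left_labels_isolated\<close>, \<open>rigid_if_swap_excluded\<close>).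

  Let \<open>x, y\<close> generate the non-cyclic group \<open>G\<close>.  If \<open>x\<close> has order at least 6, then
  \<open>R = {x\<^sup>2, x\<^sup>3, x\<^sup>4}\<close> and \<open>L = {1, x, y}\<close> work: the 4-cycles show which arcs are
  labelled \<open>y\<close>, and the others have a rigid pattern inside each coset of \<open>\<langle>x\<rangle>\<close>.  If
  \<open>x\<close> has order 5, five labels in \<open>\<langle>x\<rangle>\<close> would leave a reflection of each coset, so only
  four labels are powers of \<open>x\<close>: one takes \<open>R = {x, x\<^sup>2, y}\<close> and \<open>L = {x\<^sup>3, x\<^sup>4, z}\<close>, where \<open>z\<close>
  is the conjugate $x^{-1}yx$ if \<open>y\<close> does not normalise \<open>\<langle>x\<rangle>\<close>, and \<open>y\<^sup>2\<close> if it does and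
  has order at least 4 modulo \<open>\<langle>x\<rangle>\<close>; what is left is the dihedral group of order 10.  If all
  elements of generating pairs have order at most 4, then, as \<open>G\<close> is outside \<open>\<Phi>\<close>, all these orders
  are 2 or 3, and \<open>G\<close> is one of $\mathbb{Z}_2^2$, $D_6$, $\mathbb{Z}_3^2$, $A_4$ and the Heisenberg
  group of order 27 (\<open>small_orders_classification\<close>).  In the dihedral group of order 10 and in the last
  three of these groups, explicit sets separate the labels by their numbers of closed walks.

  The two exceptions are excluded by counting.  Disjoint 3-sets need six elements, which excludes
  $\mathbb{Z}_2^2$.  In $D_6$ the 36 maps \<open>R \<mapsto> aRb\<close> act on only 20 three-element subsets, so some
  \<open>(a, b) \<noteq> (1, 1)\<close> fixes \<open>R\<close>, and it gives an automorphism that is not a translation.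
\<close>

section \<open>Two-part Cayley digraphs\<close>

text \<open>
  An element of \<open>L\<close> labels an arc that ends in part 0, so the set of the definition is its
  inverse.  In this form orientedness is disjointness of \<open>R\<close> and \<open>L\<close>.
\<close>

definition two_part_sets :: "('a, 'b) monoid_scheme \<Rightarrow> 'a set \<Rightarrow> 'a set \<Rightarrow> nat \<Rightarrow> nat \<Rightarrow> 'a set" where
  "two_part_sets G R L i j =
     (if i = 0 \<and> j = 1 then R else if i = 1 \<and> j = 0 then set_inv\<^bsub>G\<^esub> L else {})"

abbreviation two_part_digraph ::
    "('a, 'b) monoid_scheme \<Rightarrow> 'a set \<Rightarrow> 'a set \<Rightarrow> ('a \<times> nat) pair_pre_digraph" where
  "two_part_digraph G R L \<equiv> m_cayley_digraph G 2 (two_part_sets G R L)"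

text \<open>
  The element \<open>s\<close> such that the ends of the edge are $g_0$ and $(sg)_1$, whatever the direction of the
  arc.
\<close>

definition label :: "('a, 'b) monoid_scheme \<Rightarrow> 'a \<times> nat \<Rightarrow> 'a \<times> nat \<Rightarrow> 'a" where
  "label G u v = (if snd u = 0 then fst v \<otimes>\<^bsub>G\<^esub> inv\<^bsub>G\<^esub> (fst u) else fst u \<otimes>\<^bsub>G\<^esub> inv\<^bsub>G\<^esub> (fst v))"

lemma m_cayley_digraph_cong:
  assumes "\<And>i j. i < m \<Longrightarrow> j < m \<Longrightarrow> T i j = T' i j"
  shows "m_cayley_digraph G m T = m_cayley_digraph G m T'"
  using assms by (simp add: m_cayley_digraph_def)

lemma less_two_iff: "(i::nat) < 2 \<longleftrightarrow> i = 0 \<or> i = 1"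
  by auto

locale two_part = group G for G (structure) +
  fixes R L :: "'a set"
  assumes R_subset: "R \<subseteq> carrier G" and L_subset: "L \<subseteq> carrier G"
begin

abbreviation "\<Gamma> \<equiv> two_part_digraph G R L"

lemma verts: "pverts \<Gamma> = carrier G \<times> {0, 1}"
  by (auto simp: m_cayley_digraph_def)

lemma set_inv_iff: "t \<in> carrier G \<Longrightarrow> A \<subseteq> carrier G \<Longrightarrow> t \<in> set_inv A \<longleftrightarrow> inv t \<in> A"
  by (auto simp: SET_INV_def subset_iff intro: bexI[of _ "inv t"])

lemma arcs_iff:
  "(u, v) \<in> parcs \<Gamma> \<longleftrightarrow> fst u \<in> carrier G \<and> fst v \<in> carrier G \<and>
     (snd u = 0 \<and> snd v = 1 \<and> label G u v \<in> R \<or> snd u = 1 \<and> snd v = 0 \<and> label G u v \<in> L)"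
  (is "?arc \<longleftrightarrow> ?cond")
proof
  assume ?arc
  then obtain g t i j where *: "i < 2" "j < 2" "u = (g, i)" "v = (t \<otimes> g, j)" "g \<in> carrier G"
      "t \<in> two_part_sets G R L i j"
    by (auto simp: m_cayley_digraph_def)
  have t: "t \<in> carrier G"
    using * R_subset L_subset by (auto simp: two_part_sets_def SET_INV_def split: if_splits)
  have "g \<otimes> inv (t \<otimes> g) = inv t" 
    using t *(5) by (simp add: inv_mult_group inv_solve_right m_assoc[symmetric])
  then show ?cond
    using * t set_inv_iff[OF t L_subset]
    by (auto simp: two_part_sets_def label_def m_assoc split: if_splits)
next
  assume ?cond
  obtain g i where u: "u = (g, i)" by (cases u)
  obtain h j where v: "v = (h, j)" by (cases v)
  have gh: "g \<in> carrier G" "h \<in> carrier G"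
    using \<open>?cond\<close> u v by auto
  have "h \<otimes> inv g \<in> two_part_sets G R L i j \<and> i < 2 \<and> j < 2"
    using \<open>?cond\<close> u v gh set_inv_iff[OF _ L_subset, of "h \<otimes> inv g"]
    by (auto simp: two_part_sets_def label_def inv_mult_group)
  moreover have "v = ((h \<otimes> inv g) \<otimes> g, j)"
    using gh v by (simp add: m_assoc)
  ultimately show ?arc
    unfolding m_cayley_digraph_def using u gh by auto
qed

lemma right_arc_iff: "g \<in> carrier G \<Longrightarrow> ((g, 0), v) \<in> parcs \<Gamma> \<longleftrightarrow> (\<exists>r\<in>R. v = (r \<otimes> g, 1))"
  unfolding arcs_iff using R_subset by (auto simp: label_def m_assoc subset_iff prod_eq_iff intro!: bexI)

lemma left_arc_iff: "g \<in> carrier G \<Longrightarrow> (u, (g, 0)) \<in> parcs \<Gamma> \<longleftrightarrow> (\<exists>l\<in>L. u = (l \<otimes> g, 1))"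
  unfolding arcs_iff using L_subset by (auto simp: label_def m_assoc subset_iff prod_eq_iff intro!: bexI)

lemma mult_inv_inv_mult: "r \<in> carrier G \<Longrightarrow> g \<in> carrier G \<Longrightarrow> g \<otimes> inv (inv r \<otimes> g) = r"
  by (simp add: inv_mult_group m_assoc[symmetric])

lemma inv_mult_inv_mult: "h \<in> carrier G \<Longrightarrow> g \<in> carrier G \<Longrightarrow> h = inv (g \<otimes> inv h) \<otimes> g"
  by (simp add: inv_mult_group m_assoc)

lemma right_arc_iff':
  assumes g: "g \<in> carrier G"
  shows "(u, (g, 1)) \<in> parcs \<Gamma> \<longleftrightarrow> (\<exists>r\<in>R. u = (inv r \<otimes> g, 0))"
proof
  assume "(u, (g, 1)) \<in> parcs \<Gamma>"
  then have "fst u \<in> carrier G" "snd u = 0" "g \<otimes> inv (fst u) \<in> R"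
    by (auto simp: arcs_iff label_def)
  then show "\<exists>r\<in>R. u = (inv r \<otimes> g, 0)"
    using inv_mult_inv_mult[OF _ g, of "fst u"] by (metis prod.collapse)
qed (use g R_subset mult_inv_inv_mult in \<open>auto simp: arcs_iff label_def subset_iff\<close>)

lemma left_arc_iff':
  assumes g: "g \<in> carrier G"
  shows "((g, 1), v) \<in> parcs \<Gamma> \<longleftrightarrow> (\<exists>l\<in>L. v = (inv l \<otimes> g, 0))"
proof
  assume "((g, 1), v) \<in> parcs \<Gamma>"
  then have "fst v \<in> carrier G" "snd v = 0" "g \<otimes> inv (fst v) \<in> L"
    by (auto simp: arcs_iff label_def)
  then show "\<exists>l\<in>L. v = (inv l \<otimes> g, 0)"
    using inv_mult_inv_mult[OF _ g, of "fst v"] by (metis prod.collapse)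
qed (use g L_subset mult_inv_inv_mult in \<open>auto simp: arcs_iff label_def subset_iff\<close>)

lemma degrees:
  assumes g: "g \<in> carrier G"
  shows "out_degree (with_proj \<Gamma>) (g, 0) = card R" "in_degree (with_proj \<Gamma>) (g, 0) = card L"
    "out_degree (with_proj \<Gamma>) (g, 1) = card L" "in_degree (with_proj \<Gamma>) (g, 1) = card R"
proof -
  have inj: "inj_on (\<lambda>s. s \<otimes> g) A" "inj_on (\<lambda>s. inv s \<otimes> g) A" if "A \<subseteq> carrier G" for A
    using g that by (auto simp: inj_on_def subset_iff)
  have "out_arcs (with_proj \<Gamma>) (g, 0) = (\<lambda>r. ((g, 0), (r \<otimes> g, 1))) ` R"
    using right_arc_iff[OF g] by (auto simp: out_arcs_def)
  moreover have "inj_on (\<lambda>r. ((g, 0::nat), (r \<otimes> g, 1::nat))) R"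
    using inj(1)[OF R_subset] by (auto simp: inj_on_def)
  ultimately show "out_degree (with_proj \<Gamma>) (g, 0) = card R"
    by (simp add: out_degree_def card_image)
  have "in_arcs (with_proj \<Gamma>) (g, 0) = (\<lambda>l. ((l \<otimes> g, 1), (g, 0))) ` L"
    using left_arc_iff[OF g] by (auto simp: in_arcs_def)
  moreover have "inj_on (\<lambda>l. ((l \<otimes> g, 1::nat), (g, 0::nat))) L"
    using inj(1)[OF L_subset] by (auto simp: inj_on_def)
  ultimately show "in_degree (with_proj \<Gamma>) (g, 0) = card L"
    by (simp add: in_degree_def card_image)
  have "out_arcs (with_proj \<Gamma>) (g, 1) = (\<lambda>l. ((g, 1), (inv l \<otimes> g, 0))) ` L"
    using left_arc_iff'[OF g] by (auto simp: out_arcs_def)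
  moreover have "inj_on (\<lambda>l. ((g, 1::nat), (inv l \<otimes> g, 0::nat))) L"
    using inj(2)[OF L_subset] by (auto simp: inj_on_def)
  ultimately show "out_degree (with_proj \<Gamma>) (g, 1) = card L"
    by (simp add: out_degree_def card_image)
  have "in_arcs (with_proj \<Gamma>) (g, 1) = (\<lambda>r. ((inv r \<otimes> g, 0), (g, 1))) ` R"
    using right_arc_iff'[OF g] by (auto simp: in_arcs_def)
  moreover have "inj_on (\<lambda>r. ((inv r \<otimes> g, 0::nat), (g, 1::nat))) R"
    using inj(2)[OF R_subset] by (auto simp: inj_on_def)
  ultimately show "in_degree (with_proj \<Gamma>) (g, 1) = card R"
    by (simp add: in_degree_def card_image)
qed

lemma set_inv_set_inv: "A \<subseteq> carrier G \<Longrightarrow> set_inv (set_inv A) = A"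
  by (auto simp: SET_INV_def subset_iff)

lemma set_inv_subset: "A \<subseteq> carrier G \<Longrightarrow> set_inv A \<subseteq> carrier G"
  by (auto simp: SET_INV_def)

end

locale two_part_cayley = two_part +
  assumes finite_carrier: "finite (carrier G)"
    and card_R: "card R = 3" and card_L: "card L = 3"
    and disjoint: "R \<inter> L = {}"
begin

lemma regular: "regular_of_valency \<Gamma> 3"
  using degrees card_R card_L by (auto simp: regular_of_valency_def verts)

lemma sets_ok:
  "m_cayley_sets G 2 (two_part_sets G R L)" "m_partite 2 (two_part_sets G R L)"
  "m_oriented G 2 (two_part_sets G R L)"
proof -
  have d: "set_inv L \<inter> set_inv R = {}"
  proof -
    have False if "t \<in> set_inv L" "t \<in> set_inv R" for t
    proof -
      have "t \<in> carrier G"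
        using that set_inv_subset[OF L_subset] by blast
      then have "inv t \<in> R \<inter> L"
        using that set_inv_iff R_subset L_subset by blast
      then show False
        using disjoint by blast
    qed
    then show ?thesis by blast
  qed
  show "m_cayley_sets G 2 (two_part_sets G R L)" "m_partite 2 (two_part_sets G R L)"
    using set_inv_subset[OF L_subset] R_subset
    by (auto simp: m_cayley_sets_def m_partite_def two_part_sets_def)
  have "two_part_sets G R L i j \<inter> set_inv (two_part_sets G R L j i) = {}" if "i < 2" "j < 2" for i j
    using d disjoint set_inv_set_inv[OF L_subset] by (simp add: two_part_sets_def SET_INV_def)
  then show "m_oriented G 2 (two_part_sets G R L)"
    unfolding m_oriented_def by blast
qed

end

text \<open>
  The degrees at the vertex $1_0$ are the sizes of the two sets that define the digraph.
\<close>

lemma (in group) admits_POSR_iff: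
  assumes "finite (carrier G)"
  shows "admits_POSR G 2 3 \<longleftrightarrow>
    (\<exists>R L. two_part_cayley G R L \<and> Aut_group (two_part_digraph G R L) \<cong> G)"
proof
  assume "\<exists>R L. two_part_cayley G R L \<and> Aut_group (two_part_digraph G R L) \<cong> G"
  then obtain R L where "two_part_cayley G R L" "Aut_group (two_part_digraph G R L) \<cong> G"
    by blast
  then show "admits_POSR G 2 3"
    unfolding admits_POSR_def
    by (intro exI[of _ "two_part_sets G R L"] conjI two_part_cayley.sets_ok two_part_cayley.regular)
next
  assume "admits_POSR G 2 3"
  then obtain T where T: "m_cayley_sets G 2 T" "m_partite 2 T" "m_oriented G 2 T"
      and reg: "regular_of_valency (m_cayley_digraph G 2 T) 3"
      and aut: "Aut_group (m_cayley_digraph G 2 T) \<cong> G"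
    unfolding admits_POSR_def by blast
  have sub: "T 0 1 \<subseteq> carrier G" "T 1 0 \<subseteq> carrier G"
    using T(1) by (auto simp: m_cayley_sets_def)
  interpret two_part G "T 0 1" "set_inv (T 1 0)"
    using sub by unfold_locales (auto simp: SET_INV_def)
  have "T i j = two_part_sets G (T 0 1) (set_inv (T 1 0)) i j" if "i < 2" "j < 2" for i j
    using that T(2) set_inv_set_inv[OF sub(2)]
    by (auto simp: two_part_sets_def m_partite_def less_two_iff)
  then have eq: "m_cayley_digraph G 2 T = \<Gamma>"
    by (rule m_cayley_digraph_cong)
  have "card (T 0 1) = 3" "card (set_inv (T 1 0)) = 3"
    using reg degrees(1,2)[OF one_closed] verts unfolding eq regular_of_valency_def
    by (metis SigmaI insertI1 one_closed)+
  moreover have "T 0 1 \<inter> set_inv (T 1 0) = {}"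
    using T(3) by (simp add: m_oriented_def)
  ultimately have "two_part_cayley G (T 0 1) (set_inv (T 1 0))"
    using assms by unfold_locales auto
  then show "\<exists>R L. two_part_cayley G R L \<and> Aut_group (two_part_digraph G R L) \<cong> G"
    using aut eq by auto
qed

section \<open>Automorphisms\<close>

lemma carrier_Aut_iff:
  "\<psi> \<in> carrier (Aut_group \<Gamma>) \<longleftrightarrow> \<psi> \<in> Bij (pverts \<Gamma>) \<and>
     (\<forall>u \<in> pverts \<Gamma>. \<forall>v \<in> pverts \<Gamma>. (u, v) \<in> parcs \<Gamma> \<longleftrightarrow> (\<psi> u, \<psi> v) \<in> parcs \<Gamma>)"
  by (auto simp: Aut_group_def)

lemma mult_Aut:
  assumes "\<phi> \<in> carrier (Aut_group \<Gamma>)" "\<psi> \<in> carrier (Aut_group \<Gamma>)"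
  shows "\<phi> \<otimes>\<^bsub>Aut_group \<Gamma>\<^esub> \<psi> = compose (pverts \<Gamma>) \<phi> \<psi>"
  using assms by (auto simp: Aut_group_def BijGroup_def)

context two_part
begin

text \<open>
  The inverse turns right multiplication into a homomorphism for composition from right to left.
\<close>

definition translation :: "'a \<Rightarrow> 'a \<times> nat \<Rightarrow> 'a \<times> nat" where
  "translation a = (\<lambda>v \<in> pverts \<Gamma>. (fst v \<otimes> inv a, snd v))"

lemma translation_apply [simp]:
  "g \<in> carrier G \<Longrightarrow> i \<in> {0, 1} \<Longrightarrow> translation a (g, i) = (g \<otimes> inv a, i)"
  by (simp add: translation_def verts)

lemma translation_Aut:
  assumes a: "a \<in> carrier G"
  shows "translation a \<in> carrier (Aut_group \<Gamma>)"
proof -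
  have "bij_betw (translation a) (pverts \<Gamma>) (pverts \<Gamma>)"
  proof (rule bij_betw_byWitness[where f' = "translation (inv a)"])
    show "\<forall>v\<in>pverts \<Gamma>. translation (inv a) (translation a v) = v"
      "\<forall>v\<in>pverts \<Gamma>. translation a (translation (inv a) v) = v"
      "translation a ` pverts \<Gamma> \<subseteq> pverts \<Gamma>" "translation (inv a) ` pverts \<Gamma> \<subseteq> pverts \<Gamma>"
      using a by (auto simp: verts m_assoc)
  qed
  moreover have "translation a \<in> extensional (pverts \<Gamma>)"
    by (simp add: translation_def)
  moreover have "(u, v) \<in> parcs \<Gamma> \<longleftrightarrow> (translation a u, translation a v) \<in> parcs \<Gamma>"
    if "u \<in> pverts \<Gamma>" "v \<in> pverts \<Gamma>" for u v
  proof -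
    have "g \<otimes> inv a \<otimes> inv (h \<otimes> inv a) = g \<otimes> inv h" if "g \<in> carrier G" "h \<in> carrier G" for g h
      using a that by (simp add: inv_mult_group m_assoc inv_solve_left' r_inv_ex)
    then have "label G (translation a u) (translation a v) = label G u v"
      using that by (auto simp: verts label_def)
    moreover have "fst (translation a w) \<in> carrier G" "snd (translation a w) = snd w"
      if "w \<in> pverts \<Gamma>" for w
      using that a by (auto simp: verts)
    moreover have "fst u \<in> carrier G" "fst v \<in> carrier G"
      using that by (auto simp: verts)
    ultimately show ?thesis
      using that by (simp add: arcs_iff)
  qed
  ultimately show ?thesis
    by (simp add: carrier_Aut_iff Bij_def)
qed

lemma translation_hom: "translation \<in> hom G (Aut_group \<Gamma>)"
proof (rule homI)
  fix a b assume ab: "a \<in> carrier G" "b \<in> carrier G"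
  show "translation (a \<otimes> b) = translation a \<otimes>\<^bsub>Aut_group \<Gamma>\<^esub> translation b"
    unfolding mult_Aut[OF translation_Aut[OF ab(1)] translation_Aut[OF ab(2)]]
    using ab by (auto simp: translation_def compose_def verts inv_mult_group m_assoc restrict_def fun_eq_iff)
qed (rule translation_Aut)

lemma inj_translation: "inj_on translation (carrier G)"
proof (rule inj_onI)
  fix a b assume ab: "a \<in> carrier G" "b \<in> carrier G" and eq: "translation a = translation b"
  have "translation a (\<one>, 0) = translation b (\<one>, 0)"
    by (simp add: eq)
  then have "inv a = inv b"
    using ab by simp
  then show "a = b"
    using ab by (metis inv_inv)
qed

text \<open>
  The translations form a copy of \<open>G\<close> in the automorphism group, so it is enough that they are all of it.
\<close>

lemma Aut_iso_if_translations:
  assumes "\<And>\<psi>. \<psi> \<in> carrier (Aut_group \<Gamma>) \<Longrightarrow>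
    \<exists>a \<in> carrier G. \<forall>g \<in> carrier G. \<forall>i \<in> {0, 1}. \<psi> (g, i) = (g \<otimes> a, i)"
  shows "Aut_group \<Gamma> \<cong> G"
proof -
  have "\<psi> \<in> translation ` carrier G" if \<psi>: "\<psi> \<in> carrier (Aut_group \<Gamma>)" for \<psi>
  proof -
    obtain a where a: "a \<in> carrier G" "\<forall>g \<in> carrier G. \<forall>i \<in> {0, 1}. \<psi> (g, i) = (g \<otimes> a, i)"
      using assms[OF \<psi>] by blast
    have "\<psi> \<in> extensional (pverts \<Gamma>)"
      using \<psi> by (simp add: carrier_Aut_iff Bij_def)
    then have "\<psi> = translation (inv a)"
      using a by (intro extensionalityI[of _ "pverts \<Gamma>"]) (auto simp: verts translation_def)
    then show ?thesis
      using a by blast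
  qed
  then have "translation \<in> iso G (Aut_group \<Gamma>)"
    using translation_hom inj_translation translation_Aut by (auto simp: iso_def bij_betw_def)
  then show ?thesis
    using iso_sym is_isoI by blast
qed

end

context group
begin

text \<open>
  The elements whose left multiplication commutes with \<open>\<sigma>\<close> form a subgroup.
\<close>

lemma commuting_with_generators_right_mult:
  assumes gen: "generate G {x, y} = carrier G" and xy: "x \<in> carrier G" "y \<in> carrier G"
    and cl: "\<And>g. g \<in> carrier G \<Longrightarrow> \<sigma> g \<in> carrier G"
    and x: "\<And>g. g \<in> carrier G \<Longrightarrow> \<sigma> (x \<otimes> g) = x \<otimes> \<sigma> g"
    and y: "\<And>g. g \<in> carrier G \<Longrightarrow> \<sigma> (y \<otimes> g) = y \<otimes> \<sigma> g"
    and k: "k \<in> carrier G"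
  shows "\<sigma> k = k \<otimes> \<sigma> \<one>"
proof -
  have inverse: "\<sigma> (inv s \<otimes> g) = inv s \<otimes> \<sigma> g"
    if s: "s \<in> carrier G" "\<And>g. g \<in> carrier G \<Longrightarrow> \<sigma> (s \<otimes> g) = s \<otimes> \<sigma> g" and g: "g \<in> carrier G" for s g
  proof -
    have h: "inv s \<otimes> g \<in> carrier G" "s \<otimes> (inv s \<otimes> g) = g"
      using s(1) g by (simp_all add: m_assoc[symmetric])
    have "inv s \<otimes> \<sigma> g = inv s \<otimes> (s \<otimes> \<sigma> (inv s \<otimes> g))"
      using s(2)[OF h(1)] unfolding h(2) by (rule arg_cong)
    also have "\<dots> = \<sigma> (inv s \<otimes> g)"
      using s(1) cl[OF h(1)] by (simp add: m_assoc[symmetric])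
    finally show ?thesis
      by (rule sym)
  qed
  have "k \<in> generate G {x, y}"
    using gen k by simp
  then have "\<forall>g \<in> carrier G. \<sigma> (k \<otimes> g) = k \<otimes> \<sigma> g"
  proof induction
    case one
    then show ?case using cl by simp
  next
    case (incl h)
    then show ?case using x y by blast
  next
    case (inv h)
    then show ?case using inverse x y xy by blast
  next
    case (eng h1 h2)
    have "h1 \<in> carrier G" "h2 \<in> carrier G"
      using eng gen by auto
    then show ?case
      using eng cl by (simp add: m_assoc)
  qed
  then have "\<sigma> (k \<otimes> \<one>) = k \<otimes> \<sigma> \<one>"
    by blast
  then show ?thesis
    using k by simp
qed

end

section \<open>Refining colours of arcs\<close>

text \<open>
  For a closed walk \<open>u, v, w, z, u\<close> that starts with a given arc \<open>(u, v)\<close>, the type lists the three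
  other steps, each with its direction (\<open>True\<close> if the arc is followed forwards) and its colour.  The last
  component tells whether the four vertices are distinct.
\<close>

type_synonym walk_type = "(bool \<times> nat) \<times> (bool \<times> nat) \<times> (bool \<times> nat) \<times> bool"

context two_part_cayley
begin

definition invariant_colour :: "('a \<Rightarrow> nat) \<Rightarrow> bool" where
  "invariant_colour c \<longleftrightarrow> (\<forall>\<psi> \<in> carrier (Aut_group \<Gamma>). \<forall>u v. (u, v) \<in> parcs \<Gamma> \<longrightarrow>
     c (label G (\<psi> u) (\<psi> v)) = c (label G u v))"

text \<open>
  The walk $(eg)_1, (p^{-1}eg)_0, (rg)_1, g_0$ has edges labelled \<open>p\<close>, \<open>q\<close>, \<open>r\<close> exactly if
  $qp^{-1}e = r$.
\<close>

definition label_triples :: "'a \<Rightarrow> ('a \<times> 'a \<times> 'a) set" where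
  "label_triples e = {(p, q, r). p \<in> R \<union> L \<and> q \<in> R \<union> L \<and> r \<in> R \<union> L \<and> q = r \<otimes> inv e \<otimes> p}"

text \<open>
  For \<open>e \<in> L\<close> the arc runs from part 1 to part 0, so the rest of the closed walk visits the edges
  labelled \<open>p\<close>, \<open>q\<close>, \<open>r\<close> in the opposite order; this exchanges \<open>p\<close> and \<open>r\<close>.
\<close>

definition label_walks :: "('a \<Rightarrow> nat) \<Rightarrow> walk_type \<Rightarrow> 'a \<Rightarrow> ('a \<times> 'a \<times> 'a) set" where
  "label_walks c t e = {(p, q, r). (if e \<in> R then (p, q, r) \<in> label_triples e else (r, q, p) \<in> label_triples e) \<and>
     t = ((p \<in> R \<longleftrightarrow> e \<in> L, c p), (q \<in> R \<longleftrightarrow> e \<in> R, c q), (r \<in> R \<longleftrightarrow> e \<in> L, c r), p \<noteq> e \<and> r \<noteq> e)}"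

definition step_type :: "('a \<Rightarrow> nat) \<Rightarrow> 'a \<times> nat \<Rightarrow> 'a \<times> nat \<Rightarrow> bool \<times> nat" where
  "step_type c u v = ((u, v) \<in> parcs \<Gamma>, c (label G u v))"

definition adjacent :: "'a \<times> nat \<Rightarrow> 'a \<times> nat \<Rightarrow> bool" where
  "adjacent u v \<longleftrightarrow> (u, v) \<in> parcs \<Gamma> \<or> (v, u) \<in> parcs \<Gamma>"

definition walks_at :: "('a \<Rightarrow> nat) \<Rightarrow> walk_type \<Rightarrow> 'a \<times> nat \<Rightarrow> 'a \<times> nat \<Rightarrow> (('a \<times> nat) \<times> ('a \<times> nat)) set" where
  "walks_at c t u v = {(w, z). adjacent v w \<and> adjacent w z \<and> adjacent z u \<and>
     t = (step_type c v w, step_type c w z, step_type c z u, w \<noteq> u \<and> z \<noteq> v)}"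

lemma adjacent_right: "g \<in> carrier G \<Longrightarrow> adjacent (g, 0) v \<longleftrightarrow> (\<exists>s\<in>R \<union> L. v = (s \<otimes> g, 1))"
  by (auto simp: adjacent_def right_arc_iff left_arc_iff)

lemma adjacent_left: "g \<in> carrier G \<Longrightarrow> adjacent (g, 1) v \<longleftrightarrow> (\<exists>s\<in>R \<union> L. v = (inv s \<otimes> g, 0))"
  by (simp only: adjacent_def right_arc_iff' left_arc_iff') blast

lemma adjacent_sym: "adjacent u v \<longleftrightarrow> adjacent v u"
  by (auto simp: adjacent_def)

lemma label_right:
  assumes "s \<in> carrier G" "g \<in> carrier G"
  shows "label G (g, 0) (s \<otimes> g, 1) = s" "label G (s \<otimes> g, 1) (g, 0) = s"
  using assms by (simp_all add: label_def m_assoc)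

lemma label_left:
  assumes "s \<in> carrier G" "g \<in> carrier G"
  shows "label G (g, 1) (inv s \<otimes> g, 0) = s" "label G (inv s \<otimes> g, 0) (g, 1) = s"
  using assms by (simp_all add: label_def mult_inv_inv_mult)

lemma labels_closed: "s \<in> R \<union> L \<Longrightarrow> s \<in> carrier G"
  using R_subset L_subset by blast

lemma step_type_right:
  assumes "s \<in> R \<union> L" "g \<in> carrier G"
  shows "step_type c (g, 0) (s \<otimes> g, 1) = (s \<in> R, c s)" "step_type c (s \<otimes> g, 1) (g, 0) = (s \<in> L, c s)"
  using assms(2) labels_closed[OF assms(1)] by (simp_all add: step_type_def arcs_iff label_right del: One_nat_def)

lemma step_type_left:
  assumes "s \<in> R \<union> L" "g \<in> carrier G"
  shows "step_type c (g, 1) (inv s \<otimes> g, 0) = (s \<in> L, c s)" "step_type c (inv s \<otimes> g, 0) (g, 1) = (s \<in> R, c s)"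
  using assms(2) labels_closed[OF assms(1)] by (simp_all add: step_type_def arcs_iff label_left del: One_nat_def)

definition walk_vertices :: "'a \<Rightarrow> 'a \<Rightarrow> 'a \<times> 'a \<times> 'a \<Rightarrow> ('a \<times> nat) \<times> ('a \<times> nat)" where
  "walk_vertices e g = (\<lambda>(p, q, r). ((inv p \<otimes> (e \<otimes> g), 0), (r \<otimes> g, 1)))"

end

context two_part_cayley begin
text \<open>
  Walks of length 3 between the ends of an edge correspond to triples of labels, independently of the base
  point \<open>g\<close>.
\<close>

lemma walk_parametrisation:
  assumes e: "e \<in> R \<union> L" and g: "g \<in> carrier G"
  shows "bij_betw (walk_vertices e g) (label_triples e)
      {(a, b). adjacent (e \<otimes> g, 1) a \<and> adjacent a b \<and> adjacent b (g, 0)}" (is "bij_betw ?f ?W ?C")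
    and "\<And>p q r a b. (p, q, r) \<in> label_triples e \<Longrightarrow> walk_vertices e g (p, q, r) = (a, b) \<Longrightarrow>
      step_type c (e \<otimes> g, 1) a = (p \<in> L, c p) \<and> step_type c a (e \<otimes> g, 1) = (p \<in> R, c p) \<and>
      step_type c a b = (q \<in> R, c q) \<and> step_type c b a = (q \<in> L, c q) \<and>
      step_type c b (g, 0) = (r \<in> L, c r) \<and> step_type c (g, 0) b = (r \<in> R, c r) \<and>
      (a = (g, 0) \<longleftrightarrow> p = e) \<and> (b = (e \<otimes> g, 1) \<longleftrightarrow> r = e)"
proof -
  have eG: "e \<in> carrier G" using e labels_closed by auto
  have eg: "e \<otimes> g \<in> carrier G" using eG g by simp
  have close: "r \<otimes> g = q \<otimes> (inv p \<otimes> (e \<otimes> g))"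
    if S: "p \<in> R \<union> L" "q \<in> R \<union> L" "r \<in> R \<union> L" and q: "q = r \<otimes> inv e \<otimes> p" for p q r
  proof -
    have "p \<otimes> (inv p \<otimes> (e \<otimes> g)) = e \<otimes> g" "inv e \<otimes> (e \<otimes> g) = g"
      using S[THEN labels_closed] eG g by (simp_all add: m_assoc[symmetric])
    then show ?thesis
      using S[THEN labels_closed] eG g unfolding q by (simp add: m_assoc)
  qed
  have same: "inv p \<otimes> (e \<otimes> g) = g \<longleftrightarrow> p = e" if "p \<in> R \<union> L" for p
  proof
    have p: "p \<in> carrier G" using labels_closed[OF that] .
    assume "inv p \<otimes> (e \<otimes> g) = g"
    then have "p \<otimes> g = p \<otimes> (inv p \<otimes> (e \<otimes> g))"
      by simp
    also have "\<dots> = e \<otimes> g"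
      using p eg by (simp add: m_assoc[symmetric])
    finally show "p = e"
      using p eG g by simp
  qed (use eG g in \<open>simp add: m_assoc[symmetric]\<close>)
  show types: "\<And>p q r a b. (p, q, r) \<in> ?W \<Longrightarrow> ?f (p, q, r) = (a, b) \<Longrightarrow>
      step_type c (e \<otimes> g, 1) a = (p \<in> L, c p) \<and> step_type c a (e \<otimes> g, 1) = (p \<in> R, c p) \<and>
      step_type c a b = (q \<in> R, c q) \<and> step_type c b a = (q \<in> L, c q) \<and>
      step_type c b (g, 0) = (r \<in> L, c r) \<and> step_type c (g, 0) b = (r \<in> R, c r) \<and>
      (a = (g, 0) \<longleftrightarrow> p = e) \<and> (b = (e \<otimes> g, 1) \<longleftrightarrow> r = e)"
  proof -
    fix p q r a b assume "(p, q, r) \<in> ?W" and f: "?f (p, q, r) = (a, b)"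
    then have S: "p \<in> R \<union> L" "q \<in> R \<union> L" "r \<in> R \<union> L" and q: "q = r \<otimes> inv e \<otimes> p"
      by (auto simp: label_triples_def)
    have a: "a = (inv p \<otimes> (e \<otimes> g), 0)" and b: "b = (r \<otimes> g, 1)"
      using f by (auto simp: walk_vertices_def label_triples_def)
    have aG: "inv p \<otimes> (e \<otimes> g) \<in> carrier G"
      using S[THEN labels_closed] eg by simp
    have "q \<otimes> (inv p \<otimes> (e \<otimes> g)) = e \<otimes> g \<longleftrightarrow> r = e"
      unfolding close[OF S q, symmetric] using labels_closed[OF S(3)] eG g by simp
    then show "step_type c (e \<otimes> g, 1) a = (p \<in> L, c p) \<and> step_type c a (e \<otimes> g, 1) = (p \<in> R, c p) \<and>
      step_type c a b = (q \<in> R, c q) \<and> step_type c b a = (q \<in> L, c q) \<and>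
      step_type c b (g, 0) = (r \<in> L, c r) \<and> step_type c (g, 0) b = (r \<in> R, c r) \<and>
      (a = (g, 0) \<longleftrightarrow> p = e) \<and> (b = (e \<otimes> g, 1) \<longleftrightarrow> r = e)"
      using step_type_left[OF S(1) eg] step_type_right[OF S(2) aG] step_type_right[OF S(3) g]
        close[OF S q] same[OF S(1)] labels_closed[OF S(3)] eG g by (simp add: a b del: One_nat_def)
  qed
  show "bij_betw ?f ?W ?C"
  proof (rule bij_betw_imageI)
    show "inj_on ?f ?W"
    proof (rule inj_onI)
      fix x x' assume W: "x \<in> ?W" "x' \<in> ?W" and eq: "?f x = ?f x'"
      obtain p r p' r' where x: "x = (p, r \<otimes> inv e \<otimes> p, r)" "x' = (p', r' \<otimes> inv e \<otimes> p', r')"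
        and S: "p \<in> R \<union> L" "r \<in> R \<union> L" "p' \<in> R \<union> L" "r' \<in> R \<union> L"
        using W by (auto simp: label_triples_def)
      from x eq have *: "inv p \<otimes> (e \<otimes> g) = inv p' \<otimes> (e \<otimes> g)" "r \<otimes> g = r' \<otimes> g"
        by (auto simp: walk_vertices_def label_triples_def)
      have "r = r'" using *(2) S[THEN labels_closed] g by simp
      moreover have "inv p = inv p'" using *(1) S[THEN labels_closed] eg by simp
      then have "p = p'" using S[THEN labels_closed] by (metis inv_inv)
      ultimately show "x = x'"
        using x by simp
    qed
    show "?f ` ?W = ?C"
    proof (intro equalityI subsetI)
      fix ab assume "ab \<in> ?f ` ?W"
      then obtain p q r where S: "p \<in> R \<union> L" "q \<in> R \<union> L" "r \<in> R \<union> L" and q: "q = r \<otimes> inv e \<otimes> p"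
        and ab: "ab = ((inv p \<otimes> (e \<otimes> g), 0), (r \<otimes> g, 1))"
        by (auto simp: walk_vertices_def label_triples_def)
      have aG: "inv p \<otimes> (e \<otimes> g) \<in> carrier G"
        using S[THEN labels_closed] eg by simp
      have "adjacent (e \<otimes> g, 1) (inv p \<otimes> (e \<otimes> g), 0)"
        using S(1) adjacent_left[OF eg] by blast
      moreover have "adjacent (inv p \<otimes> (e \<otimes> g), 0) (r \<otimes> g, 1)"
        using S(2) adjacent_right[OF aG] close[OF S q] by blast
      moreover have "adjacent (r \<otimes> g, 1) (g, 0)"
        using S(3) adjacent_right[OF g] adjacent_sym by blast
      ultimately show "ab \<in> ?C"
        by (simp add: ab)
    next
      fix ab assume "ab \<in> ?C"
      then obtain a b where ab: "ab = (a, b)" and adj: "adjacent (e \<otimes> g, 1) a" "adjacent a b" "adjacent b (g, 0)"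
        by auto
      obtain p where p: "p \<in> R \<union> L" "a = (inv p \<otimes> (e \<otimes> g), 0)"
        using adj(1) adjacent_left[OF eg] by auto
      have aG: "inv p \<otimes> (e \<otimes> g) \<in> carrier G"
        using labels_closed[OF p(1)] eg by simp
      obtain q where q: "q \<in> R \<union> L" "b = (q \<otimes> (inv p \<otimes> (e \<otimes> g)), 1)"
        using adj(2) adjacent_right[OF aG] p by auto
      obtain r where r: "r \<in> R \<union> L" "b = (r \<otimes> g, 1)"
        using adj(3) adjacent_right[OF g] adjacent_sym by blast
      note G = p(1)[THEN labels_closed] q(1)[THEN labels_closed] r(1)[THEN labels_closed]
      have "q \<otimes> inv p \<otimes> e \<otimes> g = r \<otimes> g"
        using q r G eG g by (simp add: m_assoc)
      then have "r = q \<otimes> inv p \<otimes> e"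
        using G eG g by simp
      then have "r \<otimes> inv e \<otimes> p = q"
        using G eG by (simp add: m_assoc)
      then have "(p, q, r) \<in> ?W"
        using p q r by (auto simp: label_triples_def)
      moreover have "ab = ?f (p, q, r)"
        using ab p r by (simp add: walk_vertices_def label_triples_def)
      ultimately show "ab \<in> ?f ` ?W"
        by blast
    qed
  qed
qed

lemma card_Collect_bij_betw:
  assumes bij: "bij_betw f A B" and iff: "\<And>x. x \<in> A \<Longrightarrow> P x \<longleftrightarrow> Q (f x)"
  shows "card {x \<in> A. P x} = card {y \<in> B. Q y}"
proof -
  have "B = f ` A"
    using bij by (simp add: bij_betw_def)
  then have "f ` {x \<in> A. P x} = {y \<in> B. Q y}"
    using iff by blast
  moreover have "inj_on f {x \<in> A. P x}"
    using bij inj_on_subset[of f A "{x \<in> A. P x}"] unfolding bij_betw_def by blast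
  ultimately show ?thesis
    using card_image by metis
qed

text \<open>
  The numbers of closed walks through an arc can therefore be computed inside the group.
\<close>

lemma card_walks_at:
  assumes arc: "(u, v) \<in> parcs \<Gamma>"
  shows "card (walks_at c t u v) = card (label_walks c t (label G u v))"
proof -
  define e where "e = label G u v"
  have L_iff: "s \<in> L \<longleftrightarrow> s \<notin> R" if "s \<in> R \<union> L" for s
    using that disjoint by blast
  show ?thesis
  proof (cases "e \<in> R")
    case True
    then have "snd u = 0" "snd v = 1" "fst u \<in> carrier G" "fst v \<in> carrier G"
      using arc disjoint unfolding e_def arcs_iff by blast+
    then obtain g where g: "g \<in> carrier G" and uv: "u = (g, 0)" "v = (e \<otimes> g, 1)"
      using e_def by (cases u, cases v) (simp add: label_def m_assoc)
    have e: "e \<in> R \<union> L" using True by blast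
    have lw: "label_walks c t e = {x \<in> label_triples e. case x of (p, q, r) \<Rightarrow>
        t = ((p \<in> L, c p), (q \<in> R, c q), (r \<in> L, c r), p \<noteq> e \<and> r \<noteq> e)}"
    proof (rule Set.set_eqI)
      fix x show "x \<in> label_walks c t e \<longleftrightarrow> x \<in> {x \<in> label_triples e. case x of (p, q, r) \<Rightarrow>
        t = ((p \<in> L, c p), (q \<in> R, c q), (r \<in> L, c r), p \<noteq> e \<and> r \<noteq> e)}"
      proof (cases "x \<in> label_triples e")
        case in_triples: True
        obtain p q r where x: "x = (p, q, r)" by (cases x) auto
        have "p \<in> R \<union> L" "r \<in> R \<union> L"
          using in_triples by (simp_all add: x label_triples_def)
        then have "p \<in> L \<longleftrightarrow> p \<notin> R" "r \<in> L \<longleftrightarrow> r \<notin> R" "e \<in> L \<longleftrightarrow> e \<notin> R"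
          using e L_iff by blast+
        then show ?thesis
          using in_triples True by (simp add: x label_walks_def)
      next
        case False
        then show ?thesis
          using True by (auto simp: label_walks_def)
      qed
    qed
    have wk: "walks_at c t u v = {y \<in> {(a, b). adjacent (e \<otimes> g, 1) a \<and> adjacent a b \<and> adjacent b (g, 0)}.
        case y of (a, b) \<Rightarrow> t = (step_type c v a, step_type c a b, step_type c b u, a \<noteq> u \<and> b \<noteq> v)}"
      by (auto simp: walks_at_def uv)
    have cond: "(case x of (p, q, r) \<Rightarrow>
        t = ((p \<in> L, c p), (q \<in> R, c q), (r \<in> L, c r), p \<noteq> e \<and> r \<noteq> e)) \<longleftrightarrow>
        (case walk_vertices e g x of (a, b) \<Rightarrow>
          t = (step_type c v a, step_type c a b, step_type c b u, a \<noteq> u \<and> b \<noteq> v))"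
      if "x \<in> label_triples e" for x
    proof -
      obtain p q r a b where x: "x = (p, q, r)" and ab: "walk_vertices e g (p, q, r) = (a, b)"
        by (cases x, cases "walk_vertices e g x") auto
      show ?thesis
        using walk_parametrisation(2)[OF e g that[unfolded x] ab, of c] by (simp add: x ab uv)
    qed
    show ?thesis
      unfolding e_def[symmetric] lw wk
      by (rule card_Collect_bij_betw[OF walk_parametrisation(1)[OF e g], symmetric], rule cond)
  next
    case False
    then have "snd u = 1" "snd v = 0" "fst u \<in> carrier G" "fst v \<in> carrier G" and eL: "e \<in> L"
      using arc unfolding e_def arcs_iff by blast+
    then obtain g where g: "g \<in> carrier G" and uv: "u = (e \<otimes> g, 1)" "v = (g, 0)"
      using e_def by (cases u, cases v) (simp add: label_def m_assoc)
    have e: "e \<in> R \<union> L" using eL by blast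
    define flip where "flip = (\<lambda>(p, q, r). (r, q, p) :: 'a \<times> 'a \<times> 'a)"
    have "bij_betw flip (label_walks c t e) {x \<in> label_triples e. case x of (r, q, p) \<Rightarrow>
        t = ((p \<in> R, c p), (q \<in> L, c q), (r \<in> R, c r), p \<noteq> e \<and> r \<noteq> e)}"
    proof (rule bij_betw_imageI)
      show "inj_on flip (label_walks c t e)"
        by (auto simp: flip_def inj_on_def)
      have walk_iff: "(p, q, r) \<in> label_walks c t e \<longleftrightarrow> (r, q, p) \<in> label_triples e \<and>
          t = ((p \<in> R, c p), (q \<in> L, c q), (r \<in> R, c r), p \<noteq> e \<and> r \<noteq> e)" for p q r
      proof (cases "(r, q, p) \<in> label_triples e")
        case True
        then have "q \<in> R \<union> L"
          unfolding label_triples_def by blast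
        then have "q \<in> L \<longleftrightarrow> q \<notin> R"
          by (rule L_iff)
        then show ?thesis
          using True False eL by (simp add: label_walks_def)
      next
        case no_triple: False
        then show ?thesis
          using False by (simp add: label_walks_def)
      qed
      show "flip ` label_walks c t e = {x \<in> label_triples e. case x of (r, q, p) \<Rightarrow>
        t = ((p \<in> R, c p), (q \<in> L, c q), (r \<in> R, c r), p \<noteq> e \<and> r \<noteq> e)}" (is "?l = ?r")
      proof (intro equalityI subsetI)
        fix x assume "x \<in> ?l"
        then obtain p q r where "x = (r, q, p)" "(p, q, r) \<in> label_walks c t e"
          by (auto simp: flip_def)
        then show "x \<in> ?r"
          using walk_iff[of p q r] by blast
      next
        fix x assume "x \<in> ?r"
        moreover obtain p q r where x: "x = (r, q, p)"
          by (cases x) auto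
        ultimately have "(p, q, r) \<in> label_walks c t e"
          using walk_iff[of p q r] by blast
        moreover have "x = flip (p, q, r)"
          by (simp add: x flip_def)
        ultimately show "x \<in> ?l"
          by blast
      qed
    qed
    then have lw: "card (label_walks c t e) = card {x \<in> label_triples e. case x of (r, q, p) \<Rightarrow>
        t = ((p \<in> R, c p), (q \<in> L, c q), (r \<in> R, c r), p \<noteq> e \<and> r \<noteq> e)}"
      by (rule bij_betw_same_card)
    have "walks_at c t u v = prod.swap ` {y \<in> {(a, b). adjacent (e \<otimes> g, 1) a \<and> adjacent a b \<and> adjacent b (g, 0)}.
        case y of (a, b) \<Rightarrow> t = (step_type c v b, step_type c b a, step_type c a u, b \<noteq> u \<and> a \<noteq> v)}"
      using adjacent_sym by (auto simp: walks_at_def uv image_iff prod.swap_def)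
    then have wk: "card (walks_at c t u v) = card {y \<in> {(a, b). adjacent (e \<otimes> g, 1) a \<and> adjacent a b \<and> adjacent b (g, 0)}.
        case y of (a, b) \<Rightarrow> t = (step_type c v b, step_type c b a, step_type c a u, b \<noteq> u \<and> a \<noteq> v)}"
      by (simp add: card_image)
    have cond: "(case x of (r, q, p) \<Rightarrow>
        t = ((p \<in> R, c p), (q \<in> L, c q), (r \<in> R, c r), p \<noteq> e \<and> r \<noteq> e)) \<longleftrightarrow>
        (case walk_vertices e g x of (a, b) \<Rightarrow>
          t = (step_type c v b, step_type c b a, step_type c a u, b \<noteq> u \<and> a \<noteq> v))"
      if "x \<in> label_triples e" for x
    proof -
      obtain p q r a b where x: "x = (p, q, r)" and ab: "walk_vertices e g (p, q, r) = (a, b)"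
        by (cases x, cases "walk_vertices e g x") auto
      show ?thesis
        using walk_parametrisation(2)[OF e g that[unfolded x] ab, of c] by (auto simp: x ab uv)
    qed
    show ?thesis
      unfolding e_def[symmetric] lw wk
      by (rule card_Collect_bij_betw[OF walk_parametrisation(1)[OF e g], symmetric], rule cond)
  qed
qed

end

context two_part_cayley begin

lemma arc_verts: "(u, v) \<in> parcs \<Gamma> \<Longrightarrow> u \<in> pverts \<Gamma> \<and> v \<in> pverts \<Gamma>"
  by (auto simp: arcs_iff verts mem_Times_iff)

lemma Aut_arc_iff:
  "\<psi> \<in> carrier (Aut_group \<Gamma>) \<Longrightarrow> u \<in> pverts \<Gamma> \<Longrightarrow> v \<in> pverts \<Gamma> \<Longrightarrow>
     (\<psi> u, \<psi> v) \<in> parcs \<Gamma> \<longleftrightarrow> (u, v) \<in> parcs \<Gamma>"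
  by (auto simp: carrier_Aut_iff)

lemma Aut_bij: "\<psi> \<in> carrier (Aut_group \<Gamma>) \<Longrightarrow> bij_betw \<psi> (pverts \<Gamma>) (pverts \<Gamma>)"
  by (simp add: carrier_Aut_iff Bij_def)

lemma Aut_vert: "\<psi> \<in> carrier (Aut_group \<Gamma>) \<Longrightarrow> u \<in> pverts \<Gamma> \<Longrightarrow> \<psi> u \<in> pverts \<Gamma>"
  using Aut_bij bij_betwE by blast

lemma label_in: "(u, v) \<in> parcs \<Gamma> \<Longrightarrow> label G u v \<in> R \<union> L"
  by (auto simp: arcs_iff)

lemma label_sym_arc: "(u, v) \<in> parcs \<Gamma> \<Longrightarrow> label G v u = label G u v"
  by (auto simp: arcs_iff label_def)

lemma invariant_label:
  assumes "invariant_colour c" "\<psi> \<in> carrier (Aut_group \<Gamma>)" "(u, v) \<in> parcs \<Gamma>"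
  shows "c (label G (\<psi> u) (\<psi> v)) = c (label G u v)"
  using assms unfolding invariant_colour_def by blast

lemma step_type_Aut:
  assumes c: "invariant_colour c" and \<psi>: "\<psi> \<in> carrier (Aut_group \<Gamma>)"
    and uv: "u \<in> pverts \<Gamma>" "v \<in> pverts \<Gamma>" and adj: "adjacent u v"
  shows "step_type c (\<psi> u) (\<psi> v) = step_type c u v"
proof (cases "(u, v) \<in> parcs \<Gamma>")
  case True
  then show ?thesis
    using invariant_label[OF c \<psi> True] Aut_arc_iff[OF \<psi> uv] by (simp add: step_type_def)
next
  case False
  then have vu: "(v, u) \<in> parcs \<Gamma>"
    using adj by (simp add: adjacent_def)
  then have "c (label G (\<psi> u) (\<psi> v)) = c (label G u v)"
    using invariant_label[OF c \<psi> vu] Aut_arc_iff[OF \<psi> uv(2,1)]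
    by (simp add: label_sym_arc[OF vu] label_sym_arc[of "\<psi> v" "\<psi> u"])
  then show ?thesis
    using Aut_arc_iff[OF \<psi> uv] by (simp add: step_type_def)
qed

lemma adjacent_verts: "adjacent u v \<Longrightarrow> u \<in> pverts \<Gamma> \<and> v \<in> pverts \<Gamma>"
  unfolding adjacent_def using arc_verts by blast

lemma adjacent_Aut:
  assumes "\<psi> \<in> carrier (Aut_group \<Gamma>)" "u \<in> pverts \<Gamma>" "v \<in> pverts \<Gamma>"
  shows "adjacent (\<psi> u) (\<psi> v) \<longleftrightarrow> adjacent u v"
  using assms by (simp add: adjacent_def Aut_arc_iff)

lemma card_walks_at_Aut:
  assumes c: "invariant_colour c" and \<psi>: "\<psi> \<in> carrier (Aut_group \<Gamma>)" and arc: "(u, v) \<in> parcs \<Gamma>"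
  shows "card (walks_at c t (\<psi> u) (\<psi> v)) = card (walks_at c t u v)"
proof -
  have uv: "u \<in> pverts \<Gamma>" "v \<in> pverts \<Gamma>"
    using arc_verts[OF arc] by auto
  have inj: "\<psi> w = \<psi> z \<longleftrightarrow> w = z" if "w \<in> pverts \<Gamma>" "z \<in> pverts \<Gamma>" for w z
    using Aut_bij[OF \<psi>] that by (auto simp: bij_betw_def inj_on_def)
  let ?V = "pverts \<Gamma> \<times> pverts \<Gamma>"
  let ?P = "\<lambda>u v (w, z). adjacent v w \<and> adjacent w z \<and> adjacent z u \<and>
     t = (step_type c v w, step_type c w z, step_type c z u, w \<noteq> u \<and> z \<noteq> v)"
  have eq: "walks_at c t u v = {x \<in> ?V. ?P u v x}" for u v
    using adjacent_verts by (auto simp: walks_at_def)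
  have "bij_betw (map_prod \<psi> \<psi>) ?V ?V"
    using Aut_bij[OF \<psi>] Aut_bij[OF \<psi>] by (rule bij_betw_map_prod)
  moreover have "?P u v x \<longleftrightarrow> ?P (\<psi> u) (\<psi> v) (map_prod \<psi> \<psi> x)" if "x \<in> ?V" for x
  proof -
    obtain w z where x: "x = (w, z)" and wz: "w \<in> pverts \<Gamma>" "z \<in> pverts \<Gamma>"
      using \<open>x \<in> ?V\<close> by (cases x) simp
    note adj = adjacent_Aut[OF \<psi> uv(2) wz(1)] adjacent_Aut[OF \<psi> wz] adjacent_Aut[OF \<psi> wz(2) uv(1)]
    show ?thesis
    proof (cases "adjacent v w \<and> adjacent w z \<and> adjacent z u")
      case True
      then show ?thesis
        using adj inj[OF wz(1) uv(1)] inj[OF wz(2) uv(2)] step_type_Aut[OF c \<psi> uv(2) wz(1)]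
          step_type_Aut[OF c \<psi> wz] step_type_Aut[OF c \<psi> wz(2) uv(1)] by (simp add: x)
    next
      case False
      then show ?thesis
        using adj by (simp add: x) blast
    qed
  qed
  ultimately show ?thesis
    unfolding eq by (rule card_Collect_bij_betw[symmetric])
qed

text \<open>
  One round of colour refinement: automorphisms permute the closed walks and keep their types.
\<close>

lemma invariant_colour_refine:
  assumes c: "invariant_colour c"
    and c': "\<And>e e'. e \<in> R \<union> L \<Longrightarrow> e' \<in> R \<union> L \<Longrightarrow> c e = c e' \<Longrightarrow>
      (\<And>t. card (label_walks c t e) = card (label_walks c t e')) \<Longrightarrow> c' e = c' e'"
  shows "invariant_colour c'"
  unfolding invariant_colour_def
proof (intro ballI allI impI)
  fix \<psi> u v assume \<psi>: "\<psi> \<in> carrier (Aut_group \<Gamma>)" and arc: "(u, v) \<in> parcs \<Gamma>"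
  have arc': "(\<psi> u, \<psi> v) \<in> parcs \<Gamma>"
    using Aut_arc_iff[OF \<psi>] arc arc_verts by blast
  show "c' (label G (\<psi> u) (\<psi> v)) = c' (label G u v)"
    by (rule c') (use arc arc' label_in card_walks_at card_walks_at_Aut[OF c \<psi> arc]
        invariant_label[OF c \<psi> arc] in auto)
qed

lemma invariant_colour_const: "invariant_colour (\<lambda>_. k)"
  by (simp add: invariant_colour_def)

lemma finite_label_walks: "finite (label_walks c t e)"
proof (rule finite_subset)
  show "label_walks c t e \<subseteq> (R \<union> L) \<times> (R \<union> L) \<times> (R \<union> L)"
    by (auto simp: label_walks_def label_triples_def split: if_splits)
  show "finite ((R \<union> L) \<times> (R \<union> L) \<times> (R \<union> L))"
    using R_subset L_subset finite_carrier by (auto intro: finite_subset)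
qed

lemma invariant_colour_refine_by_existence:
  assumes c: "invariant_colour c"
    and c': "\<And>e e'. e \<in> R \<union> L \<Longrightarrow> e' \<in> R \<union> L \<Longrightarrow> c e = c e' \<Longrightarrow>
      (\<And>t. label_walks c t e = {} \<longleftrightarrow> label_walks c t e' = {}) \<Longrightarrow> c' e = c' e'"
  shows "invariant_colour c'"
proof (rule invariant_colour_refine[OF c])
  fix e e' assume *: "e \<in> R \<union> L" "e' \<in> R \<union> L" "c e = c e'"
    and "\<And>t. card (label_walks c t e) = card (label_walks c t e')"
  then have "label_walks c t e = {} \<longleftrightarrow> label_walks c t e' = {}" for t
    using finite_label_walks card_0_eq by metis
  then show "c' e = c' e'"
    using c'[OF *] by blast
qed

text \<open>
  Arcs whose label lies in \<open>L\<close> start in part 1, so automorphisms preserve the two parts.  Moreover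
  each vertex is the end of only one arc with a given label.  Hence the action on part 0 commutes with left
  multiplication by \<open>x\<close> and \<open>y\<close>.
\<close>

theorem rigid_if_left_labels_isolated:
  assumes c: "invariant_colour c" and L: "L = {\<one>, x, y}" and gen: "generate G {x, y} = carrier G"
    and iso: "\<And>l s. l \<in> L \<Longrightarrow> s \<in> R \<union> L \<Longrightarrow> c s = c l \<Longrightarrow> s = l"
  shows "Aut_group \<Gamma> \<cong> G"
proof (rule Aut_iso_if_translations)
  fix \<psi> assume \<psi>: "\<psi> \<in> carrier (Aut_group \<Gamma>)"
  have xy: "x \<in> carrier G" "y \<in> carrier G"
    using L L_subset by auto
  have image: "\<exists>h \<in> carrier G. \<psi> (l \<otimes> g, 1) = (l \<otimes> h, 1) \<and> \<psi> (g, 0) = (h, 0)"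
    if l: "l \<in> L" and g: "g \<in> carrier G" for l g
  proof -
    have lG: "l \<in> carrier G" using l L_subset by blast
    have arc: "((l \<otimes> g, 1), (g, 0)) \<in> parcs \<Gamma>"
      using left_arc_iff[OF g] l by blast
    have lab: "label G (l \<otimes> g, 1) (g, 0) = l"
      using label_right lG g by simp
    have arc': "(\<psi> (l \<otimes> g, 1), \<psi> (g, 0)) \<in> parcs \<Gamma>"
      using Aut_arc_iff[OF \<psi>] arc arc_verts by blast
    have "label G (\<psi> (l \<otimes> g, 1)) (\<psi> (g, 0)) = l"
      using iso[OF l label_in[OF arc']] invariant_label[OF c \<psi> arc] lab by simp
    then obtain h where h: "h \<in> carrier G" "\<psi> (g, 0) = (h, 0)" and "snd (\<psi> (l \<otimes> g, 1)) = 1"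
        "fst (\<psi> (l \<otimes> g, 1)) \<otimes> inv h = l" "fst (\<psi> (l \<otimes> g, 1)) \<in> carrier G"
      using arc' l disjoint by (cases "\<psi> (g, 0)") (auto simp: arcs_iff label_def)
    then have "\<psi> (l \<otimes> g, 1) = (l \<otimes> h, 1)"
      using lG by (cases "\<psi> (l \<otimes> g, 1)") (auto simp: m_assoc)
    then show ?thesis
      using h by blast
  qed
  define \<sigma> where "\<sigma> g = fst (\<psi> (g, 0))" for g
  have \<sigma>: "\<sigma> g \<in> carrier G" "\<psi> (g, 0) = (\<sigma> g, 0)" "\<psi> (g, 1) = (\<sigma> g, 1)" if g: "g \<in> carrier G" for g
    using image[of \<one> g] g L by (auto simp: \<sigma>_def)
  have \<sigma>_label: "\<sigma> (l \<otimes> g) = l \<otimes> \<sigma> g" if l: "l \<in> L" and g: "g \<in> carrier G" for l g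
    using image[OF l g] \<sigma>[OF g] \<sigma>[of "l \<otimes> g"] l g L_subset by auto
  have translation: "\<sigma> g = g \<otimes> \<sigma> \<one>" if "g \<in> carrier G" for g
  proof (rule commuting_with_generators_right_mult[OF gen xy])
    show "\<sigma> (x \<otimes> g) = x \<otimes> \<sigma> g" "\<sigma> (y \<otimes> g) = y \<otimes> \<sigma> g" if "g \<in> carrier G" for g
      using \<sigma>_label that L by simp_all
  qed (use \<sigma>(1) that in simp_all)
  have "\<psi> (g, i) = (g \<otimes> \<sigma> \<one>, i)" if g: "g \<in> carrier G" and i: "i \<in> {0, 1}" for g i
    using i \<sigma>(2,3)[OF g] unfolding translation[OF g] by blast
  then show "\<exists>a \<in> carrier G. \<forall>g \<in> carrier G. \<forall>i \<in> {0, 1}. \<psi> (g, i) = (g \<otimes> a, i)"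
    using \<sigma>(1)[OF one_closed] by blast
qed

end

section \<open>A generator of order at least six\<close>

context two_part_cayley begin

lemma label_walks_iff:
  "(p, q, r) \<in> label_walks c t e \<longleftrightarrow> p \<in> R \<union> L \<and> q \<in> R \<union> L \<and> r \<in> R \<union> L \<and>
     q = (if e \<in> R then r \<otimes> inv e \<otimes> p else p \<otimes> inv e \<otimes> r) \<and>
     t = ((p \<in> R \<longleftrightarrow> e \<in> L, c p), (q \<in> R \<longleftrightarrow> e \<in> R, c q), (r \<in> R \<longleftrightarrow> e \<in> L, c r), p \<noteq> e \<and> r \<noteq> e)"
  unfolding label_walks_def label_triples_def by (cases "e \<in> R") (simp_all, blast+)

lemma label_walks_nonempty_iff:
  "label_walks c ((b\<^sub>2, k\<^sub>2), (b\<^sub>3, k\<^sub>3), (b\<^sub>4, k\<^sub>4), d) e \<noteq> {} \<longleftrightarrow>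
    (\<exists>p \<in> R \<union> L. \<exists>r \<in> R \<union> L. \<exists>q \<in> R \<union> L. q = (if e \<in> R then r \<otimes> inv e \<otimes> p else p \<otimes> inv e \<otimes> r) \<and>
      (p \<in> R \<longleftrightarrow> e \<in> L) = b\<^sub>2 \<and> c p = k\<^sub>2 \<and> (q \<in> R \<longleftrightarrow> e \<in> R) = b\<^sub>3 \<and> c q = k\<^sub>3 \<and>
      (r \<in> R \<longleftrightarrow> e \<in> L) = b\<^sub>4 \<and> c r = k\<^sub>4 \<and> (p \<noteq> e \<and> r \<noteq> e) = d)"
  (is "?l \<longleftrightarrow> ?r")
proof
  assume ?l
  then obtain p q r where "(p, q, r) \<in> label_walks c ((b\<^sub>2, k\<^sub>2), (b\<^sub>3, k\<^sub>3), (b\<^sub>4, k\<^sub>4), d) e"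
    by auto
  then show ?r
    unfolding label_walks_iff prod.inject by blast
next
  assume ?r
  then obtain p q r where "(p, q, r) \<in> label_walks c ((b\<^sub>2, k\<^sub>2), (b\<^sub>3, k\<^sub>3), (b\<^sub>4, k\<^sub>4), d) e"
    unfolding label_walks_iff prod.inject by blast
  then show ?l
    by blast
qed

lemma label_walks_nonemptyI:
  assumes "p \<in> R \<union> L" "r \<in> R \<union> L" "q \<in> R \<union> L" "q = (if e \<in> R then r \<otimes> inv e \<otimes> p else p \<otimes> inv e \<otimes> r)"
    "t = ((p \<in> R \<longleftrightarrow> e \<in> L, c p), (q \<in> R \<longleftrightarrow> e \<in> R, c q), (r \<in> R \<longleftrightarrow> e \<in> L, c r), p \<noteq> e \<and> r \<noteq> e)"
  shows "label_walks c t e \<noteq> {}"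
proof -
  have "(p, q, r) \<in> label_walks c t e"
    unfolding label_walks_iff using assms by blast
  then show ?thesis
    by blast
qed

end

context group begin

abbreviation powers :: "'a \<Rightarrow> 'a set" where
  "powers x \<equiv> range (\<lambda>k::int. x [^] k)"

lemma inv_mult_cancel: "a \<in> carrier G \<Longrightarrow> b \<in> carrier G \<Longrightarrow> inv a \<otimes> (a \<otimes> b) = b"
  by (simp add: m_assoc[symmetric])

lemma mult_inv_cancel: "a \<in> carrier G \<Longrightarrow> b \<in> carrier G \<Longrightarrow> a \<otimes> (inv a \<otimes> b) = b"
  by (simp add: m_assoc[symmetric])

lemma conj_int_pow:
  assumes "e \<in> carrier G" "a \<in> carrier G"
  shows "(inv e \<otimes> a \<otimes> e) [^] (s::int) = inv e \<otimes> a [^] s \<otimes> e"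
proof -
  have "(\<lambda>a. inv e \<otimes> a \<otimes> e) \<in> hom G G"
  proof (rule homI)
    fix a b assume ab: "a \<in> carrier G" "b \<in> carrier G"
    have "e \<otimes> (inv e \<otimes> (b \<otimes> e)) = b \<otimes> e"
      using assms(1) ab by (simp add: m_assoc[symmetric])
    then show "inv e \<otimes> (a \<otimes> b) \<otimes> e = inv e \<otimes> a \<otimes> e \<otimes> (inv e \<otimes> b \<otimes> e)"
      using assms(1) ab by (simp add: m_assoc)
  qed (use assms in auto)
  from hom_int_pow[OF this assms(2) is_group is_group] show ?thesis
    by simp
qed

lemma pow_int_eq_iff_of_small:
  assumes "x \<in> carrier G" "\<bar>i - j\<bar> < int (ord x)"
  shows "x [^] (i::int) = x [^] (j::int) \<longleftrightarrow> i = j"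
  using assms int_pow_eq[OF assms(1), of i j] zdvd_imp_le[of "int (ord x)" "\<bar>i - j\<bar>"] 
  by (auto simp: dvd_diff_commute)

lemma pow_int_combine:
  assumes "x \<in> carrier G"
  shows "x [^] (i::int) \<otimes> inv (x [^] (k::int)) \<otimes> x [^] (j::int) = x [^] (i - k + j)"
  using assms by (simp add: int_pow_diff[symmetric] int_pow_mult[symmetric])

lemma inv_mem_powers:
  assumes xy: "x \<in> carrier G" "y \<in> carrier G"
    and eq: "x [^] (i::int) \<otimes> inv y \<otimes> x [^] (j::int) = x [^] (k::int)"
  shows "y \<in> powers x"
proof -
  have "y = x [^] j \<otimes> inv (x [^] k) \<otimes> x [^] i"
    unfolding eq[symmetric] using xy by (simp add: inv_mult_group m_assoc[symmetric])
      (simp add: m_assoc)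
  then show ?thesis
    unfolding pow_int_combine[OF xy(1)] by blast
qed

text \<open>
  Each vertex has five neighbours in its own coset of \<open>\<langle>x\<rangle>\<close> and one neighbour outside, along an edge
  labelled \<open>y\<close>.  A 4-cycle through such an edge contains exactly one more edge labelled
  \<open>y\<close>, which lies opposite to it and is directed from part 1 to part 0 as well.  Every other arc lies
  in a 4-cycle whose opposite arc is directed the other way between the parts, and this recognises the label
  \<open>y\<close>.  As arcs labelled \<open>y\<close> start in part 1, they distinguish the parts.  Finally a 4-cycle
  with edges \<open>1, x, x\<^sup>2, x\<close> separates \<open>1\<close> from \<open>x\<close>: with the roles of \<open>1\<close> and
  \<open>x\<close> exchanged it would need $x^{-1}$ as a label in \<open>R\<close>, and the order of \<open>x\<close> is at least 6.
\<close>

lemma admits_POSR_if_order_ge_6: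
  assumes fin: "finite (carrier G)" and xy: "x \<in> carrier G" "y \<in> carrier G"
    and gen: "generate G {x, y} = carrier G" and y: "y \<notin> powers x"
    and ord: "ord x \<ge> 6"
  shows "admits_POSR G 2 3"
proof -
  define X where "X k = x [^] k" for k :: int
  define R where "R = {X 2, X 3, X 4}"
  define L where "L = {X 0, X 1, y}"
  have XG [simp]: "X k \<in> carrier G" for k
    using xy by (simp add: X_def)
  have X_eq: "X i = X j \<longleftrightarrow> i = j" if "\<bar>i - j\<bar> < 6" for i j
    using pow_int_eq_iff_of_small[OF xy(1), of i j] that ord by (simp add: X_def)
  have X_combine: "X i \<otimes> inv X k \<otimes> X j = X (i - k + j)" for i j k
    using pow_int_combine[OF xy(1)] by (simp add: X_def)
  have X_y [simp]: "X i \<noteq> y" "y \<noteq> X i" for i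
    using y by (auto simp: X_def)
  have y_off: "X i \<otimes> inv y \<otimes> X j \<noteq> X k" for i j k
    using inv_mem_powers[OF xy] y by (auto simp: X_def)
  interpret two_part_cayley G R L
    by unfold_locales (use xy fin in \<open>auto simp: R_def L_def X_eq\<close>)
  have S: "R \<union> L = {X 2, X 3, X 4, X 0, X 1, y}"
    by (auto simp: R_def L_def)
  have X_eq': "X i = X j \<longleftrightarrow> i = j" if "0 \<le> i" "i \<le> 4" "0 \<le> j" "j \<le> 4" for i j
    using that by (intro X_eq) linarith
  have XR: "X k \<in> R \<longleftrightarrow> 2 \<le> k" "X k \<in> L \<longleftrightarrow> k \<le> 1" "X k \<in> R \<union> L"
    if k: "0 \<le> k" "k \<le> 4" for k
  proof -
    have "k = 0 \<or> k = 1 \<or> k = 2 \<or> k = 3 \<or> k = 4"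
      using k by linarith
    then show "X k \<in> R \<longleftrightarrow> 2 \<le> k" "X k \<in> L \<longleftrightarrow> k \<le> 1" "X k \<in> R \<union> L"
      by (elim disjE; simp add: R_def L_def X_eq')+
  qed
  have yR: "y \<notin> R" "y \<in> L"
    by (auto simp: R_def L_def)
  define c\<^sub>1 where "c\<^sub>1 s = (if s = y then 1 else 0 :: nat)" for s
  define c\<^sub>2 where "c\<^sub>2 s = (if s = y then 1 else if s = X 0 then 2 else if s = X 1 then 3 else 0 :: nat)" for s
  have c\<^sub>1: "invariant_colour c\<^sub>1"
  proof (rule invariant_colour_refine_by_existence[OF invariant_colour_const[of 0]])
    fix e e' assume e: "e \<in> R \<union> L" "e' \<in> R \<union> L"
      and same: "\<And>t. label_walks (\<lambda>_. 0) t e = {} \<longleftrightarrow> label_walks (\<lambda>_. 0) t e' = {}"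
    have power_iff: "(\<exists>b d. label_walks (\<lambda>_. 0) ((b, 0), (False, 0), (d, 0), True) s \<noteq> {}) \<longleftrightarrow> s \<noteq> y"
      if s: "s \<in> R \<union> L" for s
    proof -
      have wit: "\<exists>b d. label_walks (\<lambda>_. 0) ((b, 0), (False, 0), (d, 0), True) (X k) \<noteq> {}"
        if ijkm: "0 \<le> i" "i \<le> 4" "0 \<le> j" "j \<le> 4" "0 \<le> k" "k \<le> 4" "0 \<le> m" "m \<le> 4"
          and sum: "i + j = k + m" and ne: "i \<noteq> k" "j \<noteq> k" and opposite: "2 \<le> m \<longleftrightarrow> \<not> 2 \<le> k" for i j k m
      proof -
        \<comment> \<open>the closed walk with labels \<open>X i\<close>, \<open>X m\<close>, \<open>X j\<close> through an arc labelled \<open>X k\<close>\<close>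
        have m: "j - k + i = m" "i - k + j = m"
          using sum by linarith+
        have "X m = (if X k \<in> R then X j \<otimes> inv X k \<otimes> X i else X i \<otimes> inv X k \<otimes> X j)"
          unfolding X_combine m by simp
        moreover have "X i \<in> R \<union> L" "X j \<in> R \<union> L" "X m \<in> R \<union> L"
          using ijkm XR(3) by blast+
        moreover have "X i \<noteq> X k" "X j \<noteq> X k"
          using ijkm ne X_eq' by blast+
        moreover have "X m \<in> R \<longleftrightarrow> X k \<notin> R"
          using ijkm opposite XR(1) by blast
        ultimately show ?thesis
          unfolding label_walks_nonempty_iff by blast
      qed
      have "\<not> (\<exists>b d. label_walks (\<lambda>_. 0) ((b, 0), (False, 0), (d, 0), True) y \<noteq> {})"
      proof
        assume "\<exists>b d. label_walks (\<lambda>_. 0) ((b, 0), (False, 0), (d, 0), True) y \<noteq> {}"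
        then obtain p q r where "p \<in> R \<union> L" "r \<in> R \<union> L" "p \<noteq> y" "r \<noteq> y" "q \<in> R"
            "q = p \<otimes> inv y \<otimes> r"
          unfolding label_walks_nonempty_iff using yR by auto
        moreover have "\<exists>k. s = X k" if "s \<in> R \<union> L" "s \<noteq> y" for s
          using that unfolding S by blast
        ultimately show False
          using y_off yR by (metis UnI1)
      qed
      moreover have "\<exists>b d. label_walks (\<lambda>_. 0) ((b, 0), (False, 0), (d, 0), True) s \<noteq> {}" if "s \<noteq> y"
      proof -
        have "s \<in> {X 0, X 1, X 2, X 3, X 4}"
          using s \<open>s \<noteq> y\<close> S by blast
        then show ?thesis
          using wit[of 1 1 0 2] wit[of 0 3 1 2] wit[of 1 1 2 0] wit[of 1 2 3 0] wit[of 1 3 4 0] by auto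
      qed
      ultimately show ?thesis
        by blast
    qed
    have "e \<noteq> y \<longleftrightarrow> e' \<noteq> y"
      unfolding power_iff[OF e(1), symmetric] power_iff[OF e(2), symmetric] same ..
    then show "c\<^sub>1 e = c\<^sub>1 e'"
      by (simp add: c\<^sub>1_def)
  qed
  have c\<^sub>2: "invariant_colour c\<^sub>2"
  proof (rule invariant_colour_refine_by_existence[OF c\<^sub>1])
    fix e e' assume e: "e \<in> R \<union> L" "e' \<in> R \<union> L" and c: "c\<^sub>1 e = c\<^sub>1 e'"
      and same: "\<And>t. label_walks c\<^sub>1 t e = {} \<longleftrightarrow> label_walks c\<^sub>1 t e' = {}"
    \<comment> \<open>a third step along an arc labelled \<open>y\<close> starts in part 1, where \<open>u\<close> lies as well; conversely \<open>u, v, u, z, u\<close> is such a walk\<close>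
    have left: "(\<exists>b k d l m. label_walks c\<^sub>1 ((b, k), (True, 1), (d, l), m) s \<noteq> {}) \<longleftrightarrow> s \<in> L"
      if s: "s \<in> R \<union> L" for s
    proof
      assume "\<exists>b k d l m. label_walks c\<^sub>1 ((b, k), (True, 1), (d, l), m) s \<noteq> {}"
      then obtain q where "q \<in> R \<longleftrightarrow> s \<in> R" "c\<^sub>1 q = 1"
        unfolding label_walks_nonempty_iff by auto
      then have "s \<notin> R"
        using yR by (auto simp: c\<^sub>1_def split: if_splits)
      then show "s \<in> L"
        using s by blast
    next
      assume "s \<in> L"
      then have "s \<notin> R" "s \<in> carrier G"
        using disjoint L_subset by blast+
      then have "y = (if s \<in> R then y \<otimes> inv s \<otimes> s else s \<otimes> inv s \<otimes> y)"
        using xy by simp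
      moreover have "y \<in> R \<union> L" "c\<^sub>1 y = 1" "(y \<in> R \<longleftrightarrow> s \<in> R) = True"
        using yR \<open>s \<notin> R\<close> by (auto simp: c\<^sub>1_def)
      ultimately show "\<exists>b k d l m. label_walks c\<^sub>1 ((b, k), (True, 1), (d, l), m) s \<noteq> {}"
        unfolding label_walks_nonempty_iff using s by blast
    qed
    have X0: "label_walks c\<^sub>1 ((False, 0), (False, 0), (False, 0), True) (X 0) \<noteq> {}"
      unfolding label_walks_nonempty_iff
      by (rule bexI[of _ "X 1"], rule bexI[of _ "X 1"], rule bexI[of _ "X 2"])
        (simp_all add: XR X_eq' c\<^sub>1_def X_combine)
    have X1: "label_walks c\<^sub>1 ((False, 0), (False, 0), (False, 0), True) (X 1) = {}"
    proof (rule ccontr)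
      assume "label_walks c\<^sub>1 ((False, 0), (False, 0), (False, 0), True) (X 1) \<noteq> {}"
      then obtain p q r where "p \<in> R \<union> L" "r \<in> R \<union> L" "p \<notin> R" "r \<notin> R" "q \<in> R" "c\<^sub>1 p = 0" "c\<^sub>1 r = 0"
          "p \<noteq> X 1" "r \<noteq> X 1" "q = p \<otimes> inv X 1 \<otimes> r"
        unfolding label_walks_nonempty_iff by (auto simp: XR)
      then have "p = X 0" "r = X 0" "q = p \<otimes> inv X 1 \<otimes> r" "q \<in> R"
        by (auto simp: L_def c\<^sub>1_def split: if_splits)
      then have "X (-1) \<in> R"
        by (simp add: X_combine)
      then show False
        by (auto simp: R_def X_eq)
    qed
    show "c\<^sub>2 e = c\<^sub>2 e'"
    proof (cases "e = y")
      case True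
      then show ?thesis
        using c by (auto simp: c\<^sub>1_def split: if_splits)
    next
      case False
      then have e'y: "e' \<noteq> y"
        using c by (auto simp: c\<^sub>1_def split: if_splits)
      have "e \<in> L \<longleftrightarrow> e' \<in> L"
        using left[OF e(1)] left[OF e(2)] same by blast
      moreover have "e' \<notin> R" "e \<notin> R" if "e \<in> L" "e' \<in> L"
        using that disjoint by blast+
      moreover have "c\<^sub>2 s = 0" if "s \<in> R" for s
        using that by (auto simp: c\<^sub>2_def R_def X_eq)
      moreover have "e = e'" if "e \<in> {X 0, X 1}" "e' \<in> {X 0, X 1}"
        using that X0 X1 same[of "((False, 0), (False, 0), (False, 0), True)"]
        by (elim insertE emptyE) simp_all
      moreover have "s \<in> {X 0, X 1}" if "s \<in> L" "s \<noteq> y" for s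
        using that by (auto simp: L_def)
      ultimately show ?thesis
        using e False e'y by (metis UnE)
    qed
  qed
  have "L = {\<one>, x, y}"
    using xy by (simp add: L_def X_def)
  then have "Aut_group \<Gamma> \<cong> G"
    by (rule rigid_if_left_labels_isolated[OF c\<^sub>2 _ gen])
       (auto simp: L_def R_def c\<^sub>2_def X_eq split: if_splits)
  then show ?thesis
    using admits_POSR_iff[OF fin] two_part_cayley_axioms by blast
qed

end

section \<open>A generator of order five\<close>

context group begin

lemma constant_if_invariant_under_generators:
  assumes gen: "generate G {x, y} = carrier G" and xy: "x \<in> carrier G" "y \<in> carrier G"
    and x: "\<And>g. g \<in> carrier G \<Longrightarrow> f (x \<otimes> g) = f g"
    and y: "\<And>g. g \<in> carrier G \<Longrightarrow> f (y \<otimes> g) = f g"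
    and k: "k \<in> carrier G"
  shows "f k = f \<one>"
proof -
  have inverse: "f (inv s \<otimes> g) = f g"
    if s: "s \<in> carrier G" "\<And>g. g \<in> carrier G \<Longrightarrow> f (s \<otimes> g) = f g" and g: "g \<in> carrier G" for s g
  proof -
    have "s \<otimes> (inv s \<otimes> g) = g"
      using s(1) g by (simp add: m_assoc[symmetric])
    then show ?thesis
      using s(2)[of "inv s \<otimes> g"] s(1) g by simp
  qed
  have "k \<in> generate G {x, y}"
    using gen k by simp
  then have "\<forall>g \<in> carrier G. f (k \<otimes> g) = f g"
  proof induction
    case one
    then show ?case by simp
  next
    case (incl h)
    then show ?case using x y by blast
  next
    case (inv h)
    then show ?case using inverse x y xy by blast
  next
    case (eng h1 h2)
    have "h1 \<in> carrier G" "h2 \<in> carrier G"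
      using eng gen by auto
    then show ?case
      using eng by (simp add: m_assoc)
  qed
  then have "f (k \<otimes> \<one>) = f \<one>"
    by blast
  then show ?thesis
    using k by simp
qed

end

context two_part_cayley begin

text \<open>
  If \<open>r\<close> and \<open>l\<close> are the only labels of some colour, each vertex has one outgoing arc of that colour;
  this is its end.
\<close>

definition coloured_step :: "'a \<Rightarrow> 'a \<Rightarrow> 'a \<times> nat \<Rightarrow> 'a \<times> nat" where
  "coloured_step r l v = (if snd v = 0 then (r \<otimes> fst v, 1) else (inv l \<otimes> fst v, 0))"

lemma Aut_commutes_with_coloured_step:
  assumes c: "invariant_colour c" and \<psi>: "\<psi> \<in> carrier (Aut_group \<Gamma>)"
    and r: "r \<in> R" "c r = k" and l: "l \<in> L" "c l = k"
    and unique: "\<And>s. s \<in> R \<union> L \<Longrightarrow> c s = k \<Longrightarrow> s = r \<or> s = l"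
    and v: "v \<in> pverts \<Gamma>"
  shows "\<psi> (coloured_step r l v) = coloured_step r l (\<psi> v)"
proof -
  have G: "r \<in> carrier G" "l \<in> carrier G"
    using r l R_subset L_subset by auto
  have neq: "r \<notin> L" "l \<notin> R"
    using r l disjoint by auto
  have step: "w = coloured_step r l u" if arc: "(u, w) \<in> parcs \<Gamma>" and k: "c (label G u w) = k" for u w
  proof -
    obtain g i where u: "u = (g, i)" by (cases u)
    have g: "g \<in> carrier G" and "i = 0 \<or> i = 1"
      using arc by (auto simp: arcs_iff u)
    moreover have "label G u w = r \<or> label G u w = l"
      using unique[OF label_in[OF arc] k] .
    moreover have "w = (s \<otimes> g, 1)" if i: "i = 0" and lab: "label G u w = s" for s
    proof -
      obtain s' where s': "s' \<in> R" "w = (s' \<otimes> g, 1)"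
        using arc right_arc_iff[OF g, of w] i unfolding u by blast
      then have "label G u w = s'"
        using label_right(1)[of s' g] R_subset g i by (auto simp: u)
      then show ?thesis using s' lab by simp
    qed
    moreover have "w = (inv s \<otimes> g, 0)" if i: "i = 1" and lab: "label G u w = s" for s
    proof -
      obtain s' where s': "s' \<in> L" "w = (inv s' \<otimes> g, 0)"
        using arc left_arc_iff'[OF g, of w] i unfolding u by blast
      then have "label G u w = s'"
        using label_left(1)[of s' g] L_subset g i by (auto simp: u)
      then show ?thesis using s' lab by simp
    qed
    moreover have "label G u w \<in> R" if "i = 0"
      using arc that by (auto simp: arcs_iff u)
    moreover have "label G u w \<in> L" if "i = 1"
      using arc that by (auto simp: arcs_iff u)
    ultimately show ?thesis
      using G neq by (auto simp: coloured_step_def u)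
  qed
  obtain g where g: "g \<in> carrier G" and "v = (g, 0) \<or> v = (g, 1)"
    using v by (auto simp: verts)
  then have "(v, coloured_step r l v) \<in> parcs \<Gamma> \<and> c (label G v (coloured_step r l v)) = k"
    using right_arc_iff[OF g] left_arc_iff'[OF g] label_right(1)[OF G(1) g] label_left(1)[OF G(2) g] r l
    by (auto simp: coloured_step_def)
  moreover from this have "coloured_step r l v \<in> pverts \<Gamma>"
    using arc_verts by blast
  ultimately show ?thesis
    using step Aut_arc_iff[OF \<psi> v] invariant_label[OF c \<psi>] by metis
qed

text \<open>
  The arcs of colour 1 advance by \<open>x\<close>, whichever part they start in; five of them lead from $g_0$ to $g_1$.  So an automorphism acts on both parts by the same map
  \<open>\<sigma>\<close>, up to an exchange of the parts that is the same everywhere, and \<open>\<sigma>\<close> commutes with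
  \<open>x\<close>.  If the parts are exchanged, \<open>\<sigma>\<close> turns left multiplication by \<open>y\<close> into that by
  $z^{-1}$ and conversely.
\<close>

theorem rigid_if_swap_excluded:
  assumes c: "invariant_colour c"
    and x: "x \<in> carrier G" "x [^] (5::nat) = \<one>"
    and R: "R = {x, x [^] (2::nat), y}" and L: "L = {x [^] (3::nat), x [^] (4::nat), z}"
    and gen: "generate G {x, y} = carrier G"
    and colours: "c x = 1" "c (x [^] (2::nat)) = 0" "c y = 2"
      "c (x [^] (3::nat)) = 0" "c (x [^] (4::nat)) = 1" "c z = 2"
    and no_swap: "\<And>\<sigma>. (\<And>g. g \<in> carrier G \<Longrightarrow> \<sigma> g \<in> carrier G) \<Longrightarrow>
      (\<And>g. g \<in> carrier G \<Longrightarrow> \<sigma> (x \<otimes> g) = x \<otimes> \<sigma> g) \<Longrightarrow>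
      (\<And>g. g \<in> carrier G \<Longrightarrow> \<sigma> (y \<otimes> g) = inv z \<otimes> \<sigma> g) \<Longrightarrow>
      (\<And>g. g \<in> carrier G \<Longrightarrow> \<sigma> (inv z \<otimes> g) = y \<otimes> \<sigma> g) \<Longrightarrow> False"
  shows "Aut_group \<Gamma> \<cong> G"
proof (rule Aut_iso_if_translations)
  fix \<psi> assume \<psi>: "\<psi> \<in> carrier (Aut_group \<Gamma>)"
  have yz: "y \<in> carrier G" "z \<in> carrier G"
    using R R_subset L L_subset by auto
  have x4: "inv (x [^] (4::nat)) = x"
  proof (rule inv_equality)
    show "x \<otimes> x [^] (4::nat) = \<one>"
      using x nat_pow_Suc2[OF x(1), of 4] by (simp add: eval_nat_numeral)
  qed (use x in auto)
  define N where "N = coloured_step x (x [^] (4::nat))"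
  define M where "M = coloured_step y z"
  have N_eq: "N v = (x \<otimes> fst v, 1 - snd v)" if "v \<in> pverts \<Gamma>" for v
    using that by (auto simp: N_def coloured_step_def x4 verts)
  have N: "\<psi> (N v) = N (\<psi> v)" if "v \<in> pverts \<Gamma>" for v
    unfolding N_def
    by (rule Aut_commutes_with_coloured_step[OF c \<psi> _ colours(1) _ colours(5) _ that])
      (use R L colours in auto)
  have M: "\<psi> (M v) = M (\<psi> v)" if "v \<in> pverts \<Gamma>" for v
    unfolding M_def
    by (rule Aut_commutes_with_coloured_step[OF c \<psi> _ colours(3) _ colours(6) _ that])
      (use R L colours in auto)
  have N_vert: "N v \<in> pverts \<Gamma>" if "v \<in> pverts \<Gamma>" for v
    using that x N_eq[OF that] by (auto simp: verts)
  have N5: "N (N (N (N (N v)))) = (fst v, 1 - snd v)" if "v \<in> pverts \<Gamma>" for v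
  proof -
    have "x \<otimes> (x \<otimes> (x \<otimes> (x \<otimes> (x \<otimes> g)))) = g" if "g \<in> carrier G" for g
    proof -
      have "x [^] (5::nat) = x \<otimes> x \<otimes> x \<otimes> x \<otimes> x"
        using x(1) by (simp add: eval_nat_numeral)
      then have "x \<otimes> x \<otimes> x \<otimes> x \<otimes> x \<otimes> g = g"
        using x that by simp
      then show ?thesis
        using x that by (simp add: m_assoc)
    qed
    then show ?thesis
      using that x by (auto simp: N_eq verts)
  qed
  \<comment> \<open>an odd number of steps \<open>N\<close> with total \<open>x\<^sup>5 = 1\<close> changes only the part\<close>
  have swap: "\<psi> (fst v, 1 - snd v) = (fst (\<psi> v), 1 - snd (\<psi> v))" if v: "v \<in> pverts \<Gamma>" for v
    using N5[OF v] N5[OF Aut_vert[OF \<psi> v]] N N_vert v by metis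
  define \<sigma> where "\<sigma> g = fst (\<psi> (g, 0))" for g
  define j where "j g = snd (\<psi> (g, 0))" for g
  have V: "(g, 0) \<in> pverts \<Gamma>" "(g, 1) \<in> pverts \<Gamma>" if "g \<in> carrier G" for g
    using that by (auto simp: verts)
  have \<sigma>: "\<sigma> g \<in> carrier G" "j g \<in> {0, 1}" if "g \<in> carrier G" for g
    using Aut_vert[OF \<psi> V(1)[OF that]] by (auto simp: \<sigma>_def j_def verts)
  have \<psi>0: "\<psi> (g, 0) = (\<sigma> g, j g)" for g
    by (simp add: \<sigma>_def j_def)
  have \<psi>1: "\<psi> (g, 1) = (\<sigma> g, 1 - j g)" if "g \<in> carrier G" for g
    using swap[OF V(1)[OF that]] by (simp add: \<sigma>_def j_def)
  have \<sigma>x: "\<sigma> (x \<otimes> g) = x \<otimes> \<sigma> g" and jx: "j (x \<otimes> g) = j g" if g: "g \<in> carrier G" for g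
    using N[OF V(1)[OF g]] \<psi>1[of "x \<otimes> g"] \<sigma>(2)[of "x \<otimes> g"] \<sigma>(2)[OF g] x g \<psi>0[of g]
      N_eq[OF V(1)[OF g]] N_eq[OF Aut_vert[OF \<psi> V(1)[OF g]]]
    by auto
  have \<sigma>y: "\<sigma> (y \<otimes> g) = (if j g = 0 then y else inv z) \<otimes> \<sigma> g" and jy: "j (y \<otimes> g) = j g"
    if g: "g \<in> carrier G" for g
    using M[OF V(1)[OF g]] \<psi>1[of "y \<otimes> g"] \<sigma>(2)[of "y \<otimes> g"] \<sigma>(2)[OF g] yz g \<psi>0[of g]
    by (auto simp: M_def coloured_step_def)
  have j: "j g = j \<one>" if "g \<in> carrier G" for g
    by (rule constant_if_invariant_under_generators[OF gen x(1) yz(1) jx jy that])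
  have "j \<one> = 0"
  proof (rule ccontr)
    assume "j \<one> \<noteq> 0"
    then have j1: "j g = 1" if "g \<in> carrier G" for g
      using j[OF that] \<sigma>(2)[OF that] by auto
    have \<sigma>z: "\<sigma> (inv z \<otimes> g) = y \<otimes> \<sigma> g" if g: "g \<in> carrier G" for g
      using M[OF V(2)[OF g]] \<psi>1[OF g] \<psi>0[of "inv z \<otimes> g"] j1[OF g] by (auto simp: M_def coloured_step_def)
    show False
    proof (rule no_swap)
      show "\<sigma> (y \<otimes> g) = inv z \<otimes> \<sigma> g" if "g \<in> carrier G" for g
        using \<sigma>y[OF that] j1[OF that] by simp
    qed (fact \<sigma>(1) \<sigma>x \<sigma>z)+
  qed
  then have j0: "j g = 0" if "g \<in> carrier G" for g
    using j[OF that] by simp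
  have translation: "\<sigma> g = g \<otimes> \<sigma> \<one>" if "g \<in> carrier G" for g
  proof (rule commuting_with_generators_right_mult[OF gen x(1) yz(1) _ _ _ that])
    show "\<sigma> (y \<otimes> g) = y \<otimes> \<sigma> g" if "g \<in> carrier G" for g
      using \<sigma>y[OF that] j0[OF that] by simp
  qed (fact \<sigma>(1) \<sigma>x)+
  have "\<psi> (g, i) = (g \<otimes> \<sigma> \<one>, i)" if g: "g \<in> carrier G" and i: "i \<in> {0, 1}" for g i
    using i \<psi>0[of g] \<psi>1[OF g] unfolding translation[OF g] j0[OF g] by auto
  then show "\<exists>a \<in> carrier G. \<forall>g \<in> carrier G. \<forall>i \<in> {0, 1}. \<psi> (g, i) = (g \<otimes> a, i)"
    using \<sigma>(1)[OF one_closed] by blast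
qed

end

context group begin

text \<open>
  Let \<open>B\<close> be the one of the sets \<open>R\<close> and \<open>L\<close> that does not contain \<open>e\<close>, and \<open>A\<close> the other
  one without \<open>e\<close>.  An arc labelled \<open>e\<close> with ends \<open>u, v\<close> is then the edge of a 4-cycle with one edge from
  \<open>A\<close> and two from \<open>B\<close>, the edge from \<open>A\<close> being adjacent at \<open>u\<close>, and of another one where it is
  adjacent at \<open>v\<close>.
\<close>

definition two_sided_match :: "'a set \<Rightarrow> 'a \<Rightarrow> 'a set \<Rightarrow> bool" where
  "two_sided_match A e B \<longleftrightarrow> (\<exists>a \<in> A. \<exists>b \<in> B. \<exists>b' \<in> B. b' = a \<otimes> inv e \<otimes> b) \<and>
     (\<exists>a \<in> A. \<exists>b \<in> B. \<exists>b' \<in> B. b' = b \<otimes> inv e \<otimes> a)"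

text \<open>
  The arcs labelled by powers of \<open>x\<close> advance by \<open>x\<close> or \<open>x\<^sup>2\<close>, whichever part they start
  in.  They lie in 4-cycles of two mirror types at once, while for \<open>y\<close>
  and \<open>z\<close> this would be a two-sided match.  Among these arcs, only a step by
  \<open>x\<close> closes a directed path of three such steps, namely of three steps by \<open>x\<^sup>2\<close>.
\<close>

lemma admits_POSR_order_5:
  fixes x y z
  defines "X \<equiv> \<lambda>k::int. x [^] k"
  assumes fin: "finite (carrier G)"
    and xyz: "x \<in> carrier G" "y \<in> carrier G" "z \<in> carrier G"
    and gen: "generate G {x, y} = carrier G" and ord: "ord x = 5"
    and y: "y \<notin> range X" and z: "z \<notin> range X" and "y \<noteq> z"
    and hy: "\<not> two_sided_match {X 1, X 2} y {X 3, X 4, z}"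
    and hz: "\<not> two_sided_match {X 3, X 4} z {X 1, X 2, y}"
    and no_swap: "\<And>\<sigma>. (\<And>g. g \<in> carrier G \<Longrightarrow> \<sigma> g \<in> carrier G) \<Longrightarrow>
      (\<And>g. g \<in> carrier G \<Longrightarrow> \<sigma> (x \<otimes> g) = x \<otimes> \<sigma> g) \<Longrightarrow>
      (\<And>g. g \<in> carrier G \<Longrightarrow> \<sigma> (y \<otimes> g) = inv z \<otimes> \<sigma> g) \<Longrightarrow>
      (\<And>g. g \<in> carrier G \<Longrightarrow> \<sigma> (inv z \<otimes> g) = y \<otimes> \<sigma> g) \<Longrightarrow> False"
  shows "admits_POSR G 2 3"
proof -
  define R where "R = {X 1, X 2, y}"
  define L where "L = {X 3, X 4, z}"
  have X_eq: "X i = X j \<longleftrightarrow> 5 dvd i - j" for i j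
    using int_pow_eq[OF xyz(1), of i j] ord by (simp add: X_def dvd_diff_commute)
  have X_combine: "X i \<otimes> inv X k \<otimes> X j = X (i - k + j)" for i j k
    using pow_int_combine[OF xyz(1)] by (simp add: X_def)
  have X_yz [simp]: "X i \<noteq> y" "y \<noteq> X i" "X i \<noteq> z" "z \<noteq> X i" for i
    using y z by auto
  interpret two_part_cayley G R L
    by unfold_locales (use xyz fin \<open>y \<noteq> z\<close> in \<open>auto simp: R_def L_def X_eq\<close>, auto simp: X_def)
  have S: "R \<union> L = {X 1, X 2, X 3, X 4, y, z}"
    by (auto simp: R_def L_def)
  have inR [simp]: "X 1 \<in> R" "X 2 \<in> R" "X 3 \<notin> R" "X 4 \<notin> R" "X 1 \<notin> L" "X 2 \<notin> L" "X 3 \<in> L" "X 4 \<in> L"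
    "y \<in> R" "z \<notin> R" "y \<notin> L" "z \<in> L"
    using \<open>y \<noteq> z\<close> by (auto simp: R_def L_def X_eq)
  have ne [simp]: "X i \<noteq> X j" if "\<not> 5 dvd i - j" for i j
    using that X_eq by blast
  define c\<^sub>1 where "c\<^sub>1 s = (if s = y \<or> s = z then 1 else 0 :: nat)" for s
  define c\<^sub>2 where "c\<^sub>2 s = (if s = y \<or> s = z then 2 else if s = X 1 \<or> s = X 4 then 1 else 0 :: nat)" for s
  let ?t\<^sub>1 = "((False, 0), (False, 0), (True, 0), True) :: walk_type"
  let ?t\<^sub>2 = "((True, 0), (False, 0), (False, 0), True) :: walk_type"
  let ?t\<^sub>3 = "((False, 0), (False, 0), (False, 0), True) :: walk_type"
  have c\<^sub>1: "invariant_colour c\<^sub>1"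
  proof (rule invariant_colour_refine_by_existence[OF invariant_colour_const[of 0]])
    fix e e' assume e: "e \<in> R \<union> L" "e' \<in> R \<union> L"
      and same: "\<And>t. label_walks (\<lambda>_. 0) t e = {} \<longleftrightarrow> label_walks (\<lambda>_. 0) t e' = {}"
    have wit: "label_walks (\<lambda>_. 0) ?t\<^sub>1 (X k) \<noteq> {} \<and> label_walks (\<lambda>_. 0) ?t\<^sub>2 (X k) \<noteq> {}"
      if "i \<in> {1, 2, 3, 4}" "k \<in> {1, 2, 3, 4}" "j \<in> {1, 2, 3, 4}" "m \<in> {1, 2, 3, 4}"
        "i - k + j = m" "X i \<noteq> X k" "X j \<noteq> X k" "X i \<in> R \<longleftrightarrow> X k \<in> R" "X j \<in> R \<longleftrightarrow> X k \<in> L" "X m \<in> R \<longleftrightarrow> X k \<in> L" for i j k m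
    proof -
      have m: "j - k + i = m" "i - k + j = m"
        using that(5) by linarith+
      have "X m = X i \<otimes> inv X k \<otimes> X j" "X m = X j \<otimes> inv X k \<otimes> X i"
        unfolding X_combine m by simp_all
      then have q: "X m = (if X k \<in> R then X j \<otimes> inv X k \<otimes> X i else X i \<otimes> inv X k \<otimes> X j)"
        "X m = (if X k \<in> R then X i \<otimes> inv X k \<otimes> X j else X j \<otimes> inv X k \<otimes> X i)"
        by simp_all
      have mem: "X i \<in> R \<union> L" "X j \<in> R \<union> L" "X m \<in> R \<union> L"
        using that(1-4) S by blast+
      have sides: "X k \<in> R \<longleftrightarrow> X k \<notin> L"
        using that(2) by (elim insertE emptyE) simp_all
      show ?thesis
        using that(6-10) sides
        by (intro conjI label_walks_nonemptyI[OF mem q(1)] label_walks_nonemptyI[OF mem(2,1,3) q(2)]) simp_all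
    qed
    have y1: "\<not> (label_walks (\<lambda>_. 0) ?t\<^sub>1 y \<noteq> {} \<and> label_walks (\<lambda>_. 0) ?t\<^sub>2 y \<noteq> {})"
    proof
      assume "label_walks (\<lambda>_. 0) ?t\<^sub>1 y \<noteq> {} \<and> label_walks (\<lambda>_. 0) ?t\<^sub>2 y \<noteq> {}"
      then obtain p q r p' q' r' where
        1: "p \<in> R" "p \<noteq> y" "r \<notin> R" "r \<in> R \<union> L" "q \<notin> R" "q \<in> R \<union> L" "q = r \<otimes> inv y \<otimes> p" and
        2: "p' \<notin> R" "p' \<in> R \<union> L" "r' \<in> R" "r' \<noteq> y" "q' \<notin> R" "q' \<in> R \<union> L" "q' = r' \<otimes> inv y \<otimes> p'"
        unfolding label_walks_nonempty_iff by auto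
      then have "p \<in> {X 1, X 2}" "r' \<in> {X 1, X 2}" "r \<in> L" "q \<in> L" "p' \<in> L" "q' \<in> L"
        by (auto simp: R_def)
      then show False
        using hy 1(7) 2(7) unfolding two_sided_match_def L_def[symmetric] by blast
    qed
    have z1: "\<not> (label_walks (\<lambda>_. 0) ?t\<^sub>1 z \<noteq> {} \<and> label_walks (\<lambda>_. 0) ?t\<^sub>2 z \<noteq> {})"
    proof
      assume "label_walks (\<lambda>_. 0) ?t\<^sub>1 z \<noteq> {} \<and> label_walks (\<lambda>_. 0) ?t\<^sub>2 z \<noteq> {}"
      then obtain p q r p' q' r' where
        1: "p \<notin> R" "p \<in> R \<union> L" "p \<noteq> z" "r \<in> R" "q \<in> R" "q = p \<otimes> inv z \<otimes> r" and
        2: "p' \<in> R" "r' \<notin> R" "r' \<in> R \<union> L" "r' \<noteq> z" "q' \<in> R" "q' = p' \<otimes> inv z \<otimes> r'"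
        unfolding label_walks_nonempty_iff by auto
      then have "p \<in> {X 3, X 4}" "r' \<in> {X 3, X 4}"
        by (auto simp: L_def)
      then show False
        using hz 1(4-6) 2(1,5,6) unfolding two_sided_match_def R_def[symmetric] by blast
    qed
    have power_iff: "label_walks (\<lambda>_. 0) ?t\<^sub>1 s \<noteq> {} \<and> label_walks (\<lambda>_. 0) ?t\<^sub>2 s \<noteq> {} \<longleftrightarrow> s \<noteq> y \<and> s \<noteq> z"
      if s: "s \<in> R \<union> L" for s
    proof (cases "s = y \<or> s = z")
      case True
      then show ?thesis
        using y1 z1 by blast
    next
      case False
      then have "s \<in> {X 1, X 2, X 3, X 4}"
        using s S by blast
      then have "label_walks (\<lambda>_. 0) ?t\<^sub>1 s \<noteq> {} \<and> label_walks (\<lambda>_. 0) ?t\<^sub>2 s \<noteq> {}"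
        using wit[of 2 1 3 4] wit[of 1 2 4 3] wit[of 4 3 1 2] wit[of 3 4 2 1]
        by (elim insertE emptyE) simp_all
      then show ?thesis
        using False by blast
    qed
    have "e \<noteq> y \<and> e \<noteq> z \<longleftrightarrow> e' \<noteq> y \<and> e' \<noteq> z"
      unfolding power_iff[OF e(1), symmetric] power_iff[OF e(2), symmetric] same ..
    then show "c\<^sub>1 e = c\<^sub>1 e'"
      by (auto simp: c\<^sub>1_def)
  qed
  have c\<^sub>2: "invariant_colour c\<^sub>2"
  proof (rule invariant_colour_refine_by_existence[OF c\<^sub>1])
    fix e e' assume e: "e \<in> R \<union> L" "e' \<in> R \<union> L" and c: "c\<^sub>1 e = c\<^sub>1 e'"
      and same: "\<And>t. label_walks c\<^sub>1 t e = {} \<longleftrightarrow> label_walks c\<^sub>1 t e' = {}"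
    have c0: "c\<^sub>1 s = 0 \<longleftrightarrow> s \<noteq> y \<and> s \<noteq> z" for s
      by (simp add: c\<^sub>1_def)
    have c0X: "c\<^sub>1 (X k) = 0" for k
      by (simp add: c\<^sub>1_def)
    have "label_walks c\<^sub>1 ?t\<^sub>3 (X 1) \<noteq> {}"
      unfolding label_walks_nonempty_iff
      by (rule bexI[of _ "X 2"], rule bexI[of _ "X 2"], rule bexI[of _ "X 3"])
        (simp_all add: X_combine c0X)
    moreover have "label_walks c\<^sub>1 ?t\<^sub>3 (X 4) \<noteq> {}"
      unfolding label_walks_nonempty_iff
      by (rule bexI[of _ "X 3"], rule bexI[of _ "X 3"], rule bexI[of _ "X 2"])
        (simp_all add: X_combine c0X)
    moreover have "label_walks c\<^sub>1 ?t\<^sub>3 (X 2) = {}"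
    proof (rule ccontr)
      assume "label_walks c\<^sub>1 ?t\<^sub>3 (X 2) \<noteq> {}"
      then obtain p q r where "p \<in> R" "r \<in> R" "q \<notin> R" "q \<in> R \<union> L" "c\<^sub>1 p = 0" "c\<^sub>1 r = 0" "c\<^sub>1 q = 0"
          "p \<noteq> X 2" "r \<noteq> X 2" "q = r \<otimes> inv X 2 \<otimes> p"
        unfolding label_walks_nonempty_iff by auto
      then have "p = X 1" "r = X 1" "q \<in> {X 3, X 4}" "q = r \<otimes> inv X 2 \<otimes> p"
        unfolding c0 by (auto simp: R_def L_def)
      then show False
        by (auto simp: X_combine)
    qed
    moreover have "label_walks c\<^sub>1 ?t\<^sub>3 (X 3) = {}"
    proof (rule ccontr)
      assume "label_walks c\<^sub>1 ?t\<^sub>3 (X 3) \<noteq> {}"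
      then obtain p q r where "p \<notin> R" "r \<notin> R" "q \<in> R" "p \<in> R \<union> L" "r \<in> R \<union> L" "c\<^sub>1 p = 0" "c\<^sub>1 r = 0" "c\<^sub>1 q = 0"
          "p \<noteq> X 3" "r \<noteq> X 3" "q = p \<otimes> inv X 3 \<otimes> r"
        unfolding label_walks_nonempty_iff by auto
      then have "p = X 4" "r = X 4" "q \<in> {X 1, X 2}" "q = p \<otimes> inv X 3 \<otimes> r"
        unfolding c0 by (auto simp: R_def L_def)
      then show False
        by (auto simp: X_combine)
    qed
    ultimately have odd_iff: "label_walks c\<^sub>1 ?t\<^sub>3 s \<noteq> {} \<longleftrightarrow> s = X 1 \<or> s = X 4"
      if "s \<in> {X 1, X 2, X 3, X 4}" for s
      using that by (elim insertE emptyE) simp_all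
    show "c\<^sub>2 e = c\<^sub>2 e'"
    proof (cases "e = y \<or> e = z")
      case True
      then have "e' = y \<or> e' = z"
        using c by (auto simp: c\<^sub>1_def split: if_splits)
      then show ?thesis
        using True by (simp add: c\<^sub>2_def)
    next
      case False
      then have e'yz: "\<not> (e' = y \<or> e' = z)"
        using c by (auto simp: c\<^sub>1_def split: if_splits)
      have "e \<in> {X 1, X 2, X 3, X 4}" "e' \<in> {X 1, X 2, X 3, X 4}"
        using e S False e'yz by blast+
      then have "e = X 1 \<or> e = X 4 \<longleftrightarrow> e' = X 1 \<or> e' = X 4"
        using odd_iff[of e] odd_iff[of e'] same[of ?t\<^sub>3] by blast
      then show ?thesis
        using False e'yz by (simp add: c\<^sub>2_def)
    qed
  qed
  have pow: "x = X 1" "x [^] (2::nat) = X 2" "x [^] (3::nat) = X 3" "x [^] (4::nat) = X 4"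
    using xyz int_pow_int[of G x 2] int_pow_int[of G x 3] int_pow_int[of G x 4] by (simp_all add: X_def)
  have "Aut_group \<Gamma> \<cong> G"
  proof (rule rigid_if_swap_excluded[OF c\<^sub>2 xyz(1) _ _ _ gen])
    show "x [^] (5::nat) = \<one>"
      using pow_ord_eq_1[OF xyz(1)] ord by simp
    show "R = {x, x [^] (2::nat), y}" "L = {x [^] (3::nat), x [^] (4::nat), z}"
      unfolding pow(2-4) R_def L_def using pow(1) by simp_all
    show "c\<^sub>2 x = 1" "c\<^sub>2 (x [^] (2::nat)) = 0" "c\<^sub>2 y = 2" "c\<^sub>2 (x [^] (3::nat)) = 0" "c\<^sub>2 (x [^] (4::nat)) = 1" "c\<^sub>2 z = 2"
      unfolding pow(2-4) using pow(1) by (auto simp: c\<^sub>2_def)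
  qed (fact no_swap)
  then show ?thesis
    using admits_POSR_iff[OF fin] two_part_cayley_axioms by blast
qed

end

context group begin

lemma power_inverse_mod_5:
  assumes x: "x \<in> carrier G" "ord x = 5" and t: "\<not> 5 dvd (t::int)"
  shows "\<exists>s::int. (x [^] t) [^] s = x"
proof -
  have "t mod 5 = 1 \<or> t mod 5 = 2 \<or> t mod 5 = 3 \<or> t mod 5 = 4"
    using t by presburger
  then have "5 dvd t * 1 - 1 \<or> 5 dvd t * 3 - 1 \<or> 5 dvd t * 2 - 1 \<or> 5 dvd t * 4 - 1"
    by presburger
  then obtain s where s: "5 dvd t * s - 1"
    by blast
  have "x [^] (t * s) = x [^] (1::int)"
    using int_pow_eq[OF x(1), of "t * s" 1] s x(2) by (simp add: dvd_diff_commute)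
  then show ?thesis
    using x by (auto simp: int_pow_pow)
qed

lemma conj_power_mem_order_5:
  assumes x: "x \<in> carrier G" and ord: "ord x = 5" and e: "e \<in> carrier G"
    and t: "\<not> 5 dvd t" and mem: "inv e \<otimes> x [^] (t::int) \<otimes> e \<in> powers x"
  shows "inv e \<otimes> x \<otimes> e \<in> powers x"
proof -
  obtain s :: int where s: "(x [^] t) [^] s = x"
    using power_inverse_mod_5[OF x ord t] by blast
  obtain k where k: "inv e \<otimes> x [^] t \<otimes> e = x [^] (k::int)"
    using mem by blast
  have "inv e \<otimes> x \<otimes> e = (x [^] k) [^] s"
    using conj_int_pow[OF e, of "x [^] t" s] x k s by simp
  also have "\<dots> = x [^] (k * s)"
    using x by (simp add: int_pow_pow)
  finally show ?thesis
    by blast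
qed

text \<open>
  As \<open>e\<close> does not normalise \<open>\<langle>x\<rangle>\<close>, the 25 products \<open>X i \<otimes> inv e \<otimes> X j\<close> are
  distinct, so at most one of them is the conjugate of \<open>e\<close>.  A match cannot have the
  conjugate as a factor, so two matches would give the conjugate two such forms, with different exponents.
\<close>

lemma no_two_sided_match_conj:
  fixes x e and a b m a\<^sub>2 b\<^sub>2 :: int
  defines "X \<equiv> \<lambda>k::int. x [^] k"
  assumes xe: "x \<in> carrier G" "e \<in> carrier G" and ord: "ord x = 5"
    and nn: "inv e \<otimes> x \<otimes> e \<notin> range X" and m: "\<not> 5 dvd m"
    and diff: "\<not> 5 dvd a - b" "\<not> 5 dvd a - b\<^sub>2" "\<not> 5 dvd a\<^sub>2 - b" "\<not> 5 dvd a\<^sub>2 - b\<^sub>2"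
  shows "\<not> two_sided_match {X a, X a\<^sub>2} e {X b, X b\<^sub>2, X m \<otimes> e \<otimes> X (- m)}"
proof
  define f where "f = X m \<otimes> e \<otimes> X (- m)"
  have XG: "X k \<in> carrier G" for k using xe by (simp add: X_def)
  have X0: "X 0 = \<one>" by (simp add: X_def)
  have X_add: "X i \<otimes> X j = X (i + j)" for i j
    using xe by (simp add: X_def int_pow_mult)
  have X_inv: "inv X i = X (- i)" for i
    using xe by (simp add: X_def int_pow_neg)
  have off: "inv e \<otimes> X t \<otimes> e \<noteq> X k" if "\<not> 5 dvd t" for t k
    using conj_power_mem_order_5[OF xe(1) ord xe(2) that] nn by (auto simp: X_def)
  have e_off: "e \<noteq> X k" for k
  proof
    assume "e = X k"
    then have "inv e \<otimes> x \<otimes> e = X (- k) \<otimes> X 1 \<otimes> X k"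
      using xe by (simp add: X_inv) (simp add: X_def)
    then show False
      using nn by (simp add: X_add)
  qed
  have left: "X i \<otimes> inv e \<otimes> X j \<noteq> X k" for i j k
    using inv_mem_powers[OF xe] e_off by (auto simp: X_def)
  have f_off1: "X i \<otimes> inv e \<otimes> f \<noteq> X k" for i k
  proof
    assume eq: "X i \<otimes> inv e \<otimes> f = X k"
    have "inv e \<otimes> X m \<otimes> e = X (- i) \<otimes> (X i \<otimes> inv e \<otimes> f) \<otimes> X m"
    proof -
      have "X (- i) \<otimes> (X i \<otimes> (inv e \<otimes> (X m \<otimes> (e \<otimes> (X (- m) \<otimes> X m))))) = inv e \<otimes> (X m \<otimes> e)"
        using XG xe by (simp add: X_add X0) (simp add: m_assoc[symmetric] X_add X0 XG xe)
      then show ?thesis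
        using XG xe by (simp add: f_def m_assoc)
    qed
    also have "\<dots> = X (- i + k + m)"
      unfolding eq by (simp add: X_add)
    finally show False
      using off[OF m] by blast
  qed
  have f_off2: "f \<otimes> inv e \<otimes> X i \<noteq> X k" for i k
  proof
    assume eq: "f \<otimes> inv e \<otimes> X i = X k"
    have "e \<otimes> X (- m) \<otimes> inv e = X (- m) \<otimes> (f \<otimes> inv e \<otimes> X i) \<otimes> X (- i)"
    proof -
      have "X (- m) \<otimes> (X m \<otimes> (e \<otimes> (X (- m) \<otimes> (inv e \<otimes> (X i \<otimes> X (- i)))))) = e \<otimes> (X (- m) \<otimes> inv e)"
        using XG xe by (simp add: X_add X0) (simp add: m_assoc[symmetric] X_add X0 XG xe)
      then show ?thesis
        using XG xe by (simp add: f_def m_assoc)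
    qed
    also have "\<dots> = X (- m + k - i)"
      unfolding eq by (simp add: X_add)
    finally have conj_e: "e \<otimes> X (- m) \<otimes> inv e = X (- m + k - i)" .
    have "inv e \<otimes> (e \<otimes> (X (- m) \<otimes> (inv e \<otimes> e))) = X (- m)"
      using XG xe by simp (simp add: m_assoc[symmetric] XG xe)
    then have "inv e \<otimes> (e \<otimes> X (- m) \<otimes> inv e) \<otimes> e = X (- m)"
      using XG xe by (simp add: m_assoc)
    then have conj_back: "inv e \<otimes> X (- m + k - i) \<otimes> e = X (- m)"
      by (simp add: conj_e)
    moreover have "\<not> 5 dvd - m + k - i"
    proof
      assume "5 dvd - m + k - i"
      then have "X (- m + k - i) = \<one>"
        using int_pow_eq_id[OF xe(1)] ord by (simp add: X_def)
      then have "X (- m) = \<one>"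
        using conj_back xe by simp
      then show False
        using int_pow_eq_id[OF xe(1), of "- m"] ord m by (simp add: X_def)
    qed
    ultimately show False
      using off by blast
  qed
  assume "two_sided_match {X a, X a\<^sub>2} e {X b, X b\<^sub>2, X m \<otimes> e \<otimes> X (- m)}"
  then obtain i j i' j' g g' h h' where
    1: "i \<in> {a, a\<^sub>2}" "g \<in> {X b, X b\<^sub>2, f}" "h \<in> {X b, X b\<^sub>2, f}" "h = X i \<otimes> inv e \<otimes> g" and
    2: "i' \<in> {a, a\<^sub>2}" "g' \<in> {X b, X b\<^sub>2, f}" "h' \<in> {X b, X b\<^sub>2, f}" "h' = g' \<otimes> inv e \<otimes> X i'"
    unfolding two_sided_match_def f_def[symmetric] by blast
  have "X i \<otimes> inv e \<otimes> f \<noteq> f"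
  proof
    assume "X i \<otimes> inv e \<otimes> f = f"
    then have "X i \<otimes> inv e = \<one>"
      using XG xe by (simp add: f_def)
    then have "X i = e"
      using XG xe inv_equality[of "X i" "inv e"] by simp
    then show False using e_off by blast
  qed
  then obtain j where j: "j \<in> {b, b\<^sub>2}" "f = X i \<otimes> inv e \<otimes> X j"
    using 1 left[of i] f_off1[of i] by auto
  have "f \<otimes> inv e \<otimes> X i' \<noteq> f"
  proof
    assume eq: "f \<otimes> inv e \<otimes> X i' = f"
    have fG: "f \<in> carrier G" using XG xe by (simp add: f_def)
    have "f \<otimes> (inv e \<otimes> X i') = f"
      using eq fG XG xe by (simp add: m_assoc)
    then have "inv e \<otimes> X i' = \<one>"
      using fG XG xe by simp
    then have "inv X i' = inv e"
      using XG xe inv_equality[of "inv e" "X i'"] by simp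
    then have "inv (inv X i') = inv (inv e)"
      by simp
    then have "X i' = e"
      using XG xe by simp
    then show False using e_off by blast
  qed
  then obtain j' where j': "j' \<in> {b, b\<^sub>2}" "f = X j' \<otimes> inv e \<otimes> X i'"
    using 2 left[of _ i'] f_off2[of i'] by auto
  have "X i \<otimes> inv e \<otimes> X j = X j' \<otimes> inv e \<otimes> X i'"
    using j j' by simp
  then have "X (- j') \<otimes> (X i \<otimes> inv e \<otimes> X j) \<otimes> X (- i') = X (- j') \<otimes> (X j' \<otimes> inv e \<otimes> X i') \<otimes> X (- i')"
    by simp
  moreover have "X (- j') \<otimes> (X i \<otimes> inv e \<otimes> X j) \<otimes> X (- i') = X (i - j') \<otimes> (inv e \<otimes> X (j - i'))"
  proof -
    have "X (- j') \<otimes> (X i \<otimes> inv e \<otimes> X j) \<otimes> X (- i') = (X (- j') \<otimes> X i) \<otimes> (inv e \<otimes> (X j \<otimes> X (- i')))"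
      using XG xe by (simp add: m_assoc)
    then show ?thesis by (simp add: X_add)
  qed
  moreover have "X (- j') \<otimes> (X j' \<otimes> inv e \<otimes> X i') \<otimes> X (- i') = inv e"
  proof -
    have "X (- j') \<otimes> (X j' \<otimes> inv e \<otimes> X i') \<otimes> X (- i') = (X (- j') \<otimes> X j') \<otimes> (inv e \<otimes> (X i' \<otimes> X (- i')))"
      using XG xe by (simp add: m_assoc)
    then show ?thesis using xe by (simp add: X_add X0)
  qed
  ultimately have fixed: "X (i - j') \<otimes> (inv e \<otimes> X (j - i')) = inv e"
    by simp
  have "inv e \<otimes> X (j - i') \<otimes> e = X (j' - i)"
  proof -
    have "inv e \<otimes> X (j - i') \<otimes> e = X (j' - i) \<otimes> (X (i - j') \<otimes> (inv e \<otimes> X (j - i'))) \<otimes> e"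
    proof -
      have "X (j' - i) \<otimes> (X (i - j') \<otimes> (inv e \<otimes> X (j - i'))) \<otimes> e = (X (j' - i) \<otimes> X (i - j')) \<otimes> (inv e \<otimes> X (j - i') \<otimes> e)"
        using XG xe by (simp add: m_assoc)
      then show ?thesis using XG xe by (simp add: X_add X0)
    qed
    also have "\<dots> = X (j' - i)"
      unfolding fixed using XG xe by (simp add: m_assoc)
    finally show ?thesis .
  qed
  moreover have "\<not> 5 dvd j - i'"
    using j(1) 2(1) diff by (auto simp: dvd_diff_commute)
  ultimately show False
    using off by blast
qed

end

context group begin

text \<open>
  The exchange of the parts would send \<open>y\<close> to $z^{-1}$ and $z^{-1}$ to \<open>y\<close> while fixing \<open>x\<close>.
  With $z = x^{-1}yx$ this makes \<open>y\<close> commute with \<open>x\<^sup>2\<close>, hence with \<open>x\<close>.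
\<close>

lemma admits_POSR_order_5_not_normalised:
  assumes fin: "finite (carrier G)" and xy: "x \<in> carrier G" "y \<in> carrier G"
    and gen: "generate G {x, y} = carrier G" and ord: "ord x = 5"
    and nn: "inv y \<otimes> x \<otimes> y \<notin> powers x"
  shows "admits_POSR G 2 3"
proof -
  define X where "X k = x [^] k" for k :: int
  have XG [simp]: "X k \<in> carrier G" for k using xy by (simp add: X_def)
  have X1: "x = X 1" "inv x = X (- 1)" and X0: "X 0 = \<one>"
    using xy by (simp_all add: X_def int_pow_neg)
  have X_add: "X i \<otimes> X j = X (i + j)" for i j
    using xy by (simp add: X_def int_pow_mult)
  have X_inv: "inv X i = X (- i)" for i
    using xy by (simp add: X_def int_pow_neg)
  define z where "z = X (- 1) \<otimes> y \<otimes> X 1"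
  have zG: "z \<in> carrier G" using xy by (simp add: z_def)
  have y_eq: "y = X 1 \<otimes> z \<otimes> X (- 1)"
  proof -
    have "X 1 \<otimes> z \<otimes> X (- 1) = (X 1 \<otimes> X (- 1)) \<otimes> (y \<otimes> (X 1 \<otimes> X (- 1)))"
      using xy by (simp add: z_def m_assoc)
    then show ?thesis
      using xy by (simp add: X_add X0)
  qed
  have y_off: "y \<noteq> X k" for k
  proof
    assume "y = X k"
    then have "inv y \<otimes> x \<otimes> y = X (- k + 1 + k)"
      using X1(1) by (simp add: X_inv X_add)
    then show False
      using nn by (auto simp: X_def)
  qed
  have z_off: "z \<noteq> X k" for k
  proof
    assume "z = X k"
    then have "y = X (1 + k - 1)"
      using y_eq by (simp add: X_add)
    then show False using y_off by blast
  qed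
  have conj: "inv z \<otimes> x \<otimes> z = X (- 1) \<otimes> (inv y \<otimes> x \<otimes> y) \<otimes> X 1"
  proof -
    have "X 1 \<otimes> (X 1 \<otimes> (X (- 1) \<otimes> (y \<otimes> X 1))) = X 1 \<otimes> (y \<otimes> X 1)"
      using xy by (simp add: m_assoc[symmetric] X_add X0)
    then show ?thesis
      using xy X1(1) by (simp add: z_def inv_mult_group X_inv m_assoc)
  qed
  have nn_z: "inv z \<otimes> x \<otimes> z \<notin> range X"
  proof
    assume "inv z \<otimes> x \<otimes> z \<in> range X"
    then obtain k where k: "X (- 1) \<otimes> (inv y \<otimes> x \<otimes> y) \<otimes> X 1 = X k"
      unfolding conj by blast
    have "inv y \<otimes> x \<otimes> y = X 1 \<otimes> (X (- 1) \<otimes> (inv y \<otimes> x \<otimes> y) \<otimes> X 1) \<otimes> X (- 1)"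
    proof -
      have "X 1 \<otimes> (X (- 1) \<otimes> (inv y \<otimes> x \<otimes> y) \<otimes> X 1) \<otimes> X (- 1)
          = (X 1 \<otimes> X (- 1)) \<otimes> ((inv y \<otimes> x \<otimes> y) \<otimes> (X 1 \<otimes> X (- 1)))"
        using xy by (simp add: m_assoc)
      then show ?thesis using xy by (simp add: X_add X0)
    qed
    then have "inv y \<otimes> x \<otimes> y = X (1 + k - 1)"
      unfolding k by (simp add: X_add)
    then show False using nn by (auto simp: X_def)
  qed
  have "y \<noteq> z"
  proof
    assume "y = z"
    then have "X 1 \<otimes> y = X 1 \<otimes> (X (- 1) \<otimes> y \<otimes> X 1)"
      by (simp add: z_def)
    also have "\<dots> = y \<otimes> X 1"
      using xy by (simp add: m_assoc[symmetric] X_add X0)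
    finally have "X 1 \<otimes> y = y \<otimes> X 1" .
    then have "inv y \<otimes> X 1 \<otimes> y = X 1"
      using xy by (simp add: m_assoc) (simp add: m_assoc[symmetric])
    then have "inv y \<otimes> x \<otimes> y = X 1"
      using X1(1) by simp
    then show False
      using nn unfolding X_def by blast
  qed
  have nn2: "inv y \<otimes> X 2 \<otimes> y \<noteq> X k" for k
    using conj_power_mem_order_5[OF xy(1) ord xy(2), of 2] nn by (auto simp: X_def)
  have "\<not> two_sided_match {X 1, X 2} y {X 3, X 4, z}"
    using no_two_sided_match_conj[OF xy ord, of "- 1" 1 3 4 2] nn by (simp add: X_def z_def)
  moreover have "\<not> two_sided_match {X 3, X 4} z {X 1, X 2, y}"
    using no_two_sided_match_conj[OF xy(1) zG ord, of 1 3 1 2 4] nn_z y_eq by (simp add: X_def)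
  moreover have False
    if \<sigma>: "\<And>g. g \<in> carrier G \<Longrightarrow> \<sigma> g \<in> carrier G"
      and x: "\<And>g. g \<in> carrier G \<Longrightarrow> \<sigma> (x \<otimes> g) = x \<otimes> \<sigma> g"
      and y: "\<And>g. g \<in> carrier G \<Longrightarrow> \<sigma> (y \<otimes> g) = inv z \<otimes> \<sigma> g"
      and z: "\<And>g. g \<in> carrier G \<Longrightarrow> \<sigma> (inv z \<otimes> g) = y \<otimes> \<sigma> g" for \<sigma>
  proof -
    have inv_y: "\<sigma> (inv y \<otimes> g) = z \<otimes> \<sigma> g" if g: "g \<in> carrier G" for g
    proof -
      have "\<sigma> g = inv z \<otimes> \<sigma> (inv y \<otimes> g)"
        using y[of "inv y \<otimes> g"] g xy by (simp add: m_assoc[symmetric])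
      then show ?thesis
        using g zG xy \<sigma>[of "inv y \<otimes> g"] by (simp add: m_assoc[symmetric])
    qed
    have inv_x: "\<sigma> (X (- 1) \<otimes> g) = X (- 1) \<otimes> \<sigma> g" if g: "g \<in> carrier G" for g
    proof -
      have "\<sigma> g = x \<otimes> \<sigma> (X (- 1) \<otimes> g)"
        using x[of "X (- 1) \<otimes> g"] g xy X1(2)[symmetric] by (simp add: m_assoc[symmetric])
      then show ?thesis
        using g xy X1(2)[symmetric] \<sigma>[of "X (- 1) \<otimes> g"] by (simp add: m_assoc[symmetric])
    qed
    have "inv z = X (- 1) \<otimes> (inv y \<otimes> x)"
      using xy X1(1) by (simp add: z_def inv_mult_group X_inv m_assoc)
    moreover have "\<sigma> x = x \<otimes> \<sigma> \<one>"
      using x[OF one_closed] xy by simp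
    ultimately have "\<sigma> (inv z \<otimes> \<one>) = X (- 1) \<otimes> (z \<otimes> (x \<otimes> \<sigma> \<one>))"
      using xy by (simp add: m_assoc inv_x inv_y)
    then have "y \<otimes> \<sigma> \<one> = X (- 1) \<otimes> (z \<otimes> x) \<otimes> \<sigma> \<one>"
      using z[OF one_closed] xy zG \<sigma>[OF one_closed] by (simp add: m_assoc)
    then have "y = X (- 1) \<otimes> (z \<otimes> x)"
      using xy zG \<sigma>[OF one_closed] by simp
    also have "\<dots> = (X (- 1) \<otimes> X (- 1)) \<otimes> (y \<otimes> (X 1 \<otimes> X 1))"
      using xy X1(1) by (simp add: z_def m_assoc)
    finally have "X 2 \<otimes> y = X 2 \<otimes> (X (- 2) \<otimes> (y \<otimes> X 2))"
      by (simp add: X_add)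
    also have "\<dots> = y \<otimes> X 2"
      using xy by (simp add: m_assoc[symmetric] X_add X0)
    finally have "inv y \<otimes> X 2 \<otimes> y = X 2"
      using xy by (simp add: m_assoc) (simp add: m_assoc[symmetric])
    then show False using nn2 by blast
  qed
  ultimately show ?thesis
    using admits_POSR_order_5[OF fin xy zG gen ord] y_off z_off \<open>y \<noteq> z\<close> unfolding X_def by blast
qed

text \<open>
  Modulo \<open>\<langle>x\<rangle>\<close> the labels are \<open>1\<close>, \<open>y\<close> and \<open>y\<^sup>2\<close>, where \<open>y\<close> has order at
  least 4.  A match would express \<open>y\<close>, \<open>y\<^sup>2\<close> or \<open>y\<^sup>3\<close> by powers of \<open>x\<close>, and an
  exchange of the parts would give \<open>y\<^sup>3 = 1\<close>.
\<close>

lemma admits_POSR_order_5_normalised: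
  assumes fin: "finite (carrier G)" and xy: "x \<in> carrier G" "y \<in> carrier G"
    and gen: "generate G {x, y} = carrier G" and ord: "ord x = 5"
    and norm: "inv y \<otimes> x \<otimes> y \<in> powers x"
    and y1: "y \<notin> powers x"
    and y2: "y \<otimes> y \<notin> powers x"
    and y3: "y \<otimes> y \<otimes> y \<notin> powers x"
  shows "admits_POSR G 2 3"
proof -
  define X where "X k = x [^] k" for k :: int
  have XG [simp]: "X k \<in> carrier G" for k using xy by (simp add: X_def)
  have X1: "x = X 1" and X0: "X 0 = \<one>"
    using xy by (simp_all add: X_def)
  have X_add: "X i \<otimes> X j = X (i + j)" for i j
    using xy by (simp add: X_def int_pow_mult)
  have X_inv: "inv X i = X (- i)" for i
    using xy by (simp add: X_def int_pow_neg)
  obtain u where u: "inv y \<otimes> x \<otimes> y = X u"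
    using norm by (auto simp: X_def)
  have move: "X k \<otimes> y = y \<otimes> X (u * k)" for k
  proof -
    have "inv y \<otimes> X k \<otimes> y = (X u) [^] k"
      unfolding u[symmetric] using conj_int_pow[OF xy(2,1)] by (simp add: X_def)
    then have "inv y \<otimes> X k \<otimes> y = X (u * k)"
      using xy by (simp add: X_def int_pow_pow)
    then have "y \<otimes> (inv y \<otimes> X k \<otimes> y) = y \<otimes> X (u * k)"
      by simp
    then show ?thesis
      using xy by (simp add: m_assoc[symmetric])
  qed
  have off: "y \<noteq> X k" "y \<otimes> y \<noteq> X k" "y \<otimes> y \<otimes> y \<noteq> X k" for k
    using y1 y2 y3 by (auto simp: X_def)
  have A: "X i \<otimes> inv y \<otimes> X j \<noteq> X k" for i j k
    using inv_mem_powers[OF xy] y1 by (auto simp: X_def)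
  have yy: "y \<otimes> y \<in> carrier G" using xy by simp
  have A2: "X i \<otimes> inv (y \<otimes> y) \<otimes> X j \<noteq> X k" for i j k
    using inv_mem_powers[OF xy(1) yy] y2 by (auto simp: X_def)
  have B: "X i \<otimes> inv y \<otimes> X j \<noteq> y \<otimes> y" for i j
  proof
    assume eq: "X i \<otimes> inv y \<otimes> X j = y \<otimes> y"
    have "X i \<otimes> X j = X i \<otimes> (inv y \<otimes> (X j \<otimes> y)) \<otimes> X (j - u * j)"
    proof -
      have "X i \<otimes> (inv y \<otimes> (X j \<otimes> y)) \<otimes> X (j - u * j) = X i \<otimes> ((inv y \<otimes> (y \<otimes> X (u * j))) \<otimes> X (j - u * j))"
        using xy by (simp add: move m_assoc)
      also have "inv y \<otimes> (y \<otimes> X (u * j)) = X (u * j)"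
        using xy by (simp add: m_assoc[symmetric])
      finally show ?thesis by (simp add: X_add)
    qed
    also have "\<dots> = (X i \<otimes> inv y \<otimes> X j) \<otimes> (y \<otimes> X (j - u * j))"
      using xy by (simp add: m_assoc)
    also have "\<dots> = y \<otimes> y \<otimes> y \<otimes> X (j - u * j)"
      unfolding eq using xy by (simp add: m_assoc)
    finally have "X i \<otimes> X j \<otimes> X (u * j - j) = y \<otimes> y \<otimes> y \<otimes> X (j - u * j) \<otimes> X (u * j - j)"
      by simp
    also have "\<dots> = y \<otimes> y \<otimes> y"
      using xy by (simp add: m_assoc X_add X0)
    finally show False
      using off(3) by (simp add: X_add) metis
  qed
  have B2: "X i \<otimes> inv (y \<otimes> y) \<otimes> X j \<noteq> y" for i j
  proof
    assume eq: "X i \<otimes> inv (y \<otimes> y) \<otimes> X j = y"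
    have "X j \<otimes> (y \<otimes> y) = y \<otimes> y \<otimes> X (u * (u * j))"
    proof -
      have "X j \<otimes> (y \<otimes> y) = X j \<otimes> y \<otimes> y"
        using xy by (simp add: m_assoc)
      also have "\<dots> = y \<otimes> (X (u * j) \<otimes> y)"
        unfolding move[of j] using xy by (simp add: m_assoc)
      also have "\<dots> = y \<otimes> y \<otimes> X (u * (u * j))"
        unfolding move[of "u * j"] using xy by (simp add: m_assoc)
      finally show ?thesis .
    qed
    then have "X i \<otimes> inv (y \<otimes> y) \<otimes> X j \<otimes> (y \<otimes> y) = X i \<otimes> (inv (y \<otimes> y) \<otimes> (y \<otimes> y \<otimes> X (u * (u * j))))"
      using m_assoc[of _ _ "y \<otimes> y"] m_assoc[of _ "inv (y \<otimes> y)"] yy by simp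
    also have "\<dots> = X (i + u * (u * j))"
      unfolding inv_mult_cancel[OF yy XG] by (rule X_add)
    finally have "X i \<otimes> inv (y \<otimes> y) \<otimes> X j \<otimes> (y \<otimes> y) = X (i + u * (u * j))" .
    then have "y \<otimes> y \<otimes> y = X (i + u * (u * j))"
      unfolding eq using xy by (simp add: m_assoc)
    then show False using off(3) by blast
  qed
  have "\<not> two_sided_match {X 1, X 2} y {X 3, X 4, y \<otimes> y}"
  proof -
    have "b' \<noteq> X i \<otimes> inv y \<otimes> b" if "b \<in> {X 3, X 4, y \<otimes> y}" "b' \<in> {X 3, X 4, y \<otimes> y}" for b b' i
    proof -
      have "X i \<otimes> inv y \<otimes> (y \<otimes> y) = X i \<otimes> y"
        using xy by (simp add: m_assoc) (simp add: m_assoc[symmetric])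
      moreover have "X i \<otimes> y \<noteq> X k" for k
      proof
        assume "X i \<otimes> y = X k"
        then have "X (- i) \<otimes> (X i \<otimes> y) = X (- i + k)"
          by (simp add: X_add)
        then show False
          using xy off(1) by (simp add: m_assoc[symmetric] X_add X0)
      qed
      moreover have "X i \<otimes> y \<noteq> y \<otimes> y"
        using xy off(1)[of i] by auto
      ultimately show ?thesis
        using that A B by (elim insertE emptyE; metis)
    qed
    then show ?thesis
      unfolding two_sided_match_def by blast
  qed
  moreover have "\<not> two_sided_match {X 3, X 4} (y \<otimes> y) {X 1, X 2, y}"
  proof -
    have "b' \<noteq> X i \<otimes> inv (y \<otimes> y) \<otimes> b" if "b \<in> {X 1, X 2, y}" "b' \<in> {X 1, X 2, y}" for b b' i
    proof -
      have yeq: "X i \<otimes> inv (y \<otimes> y) \<otimes> y = X i \<otimes> inv y"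
        using xy by (simp add: m_assoc inv_mult_group)
      have "X i \<otimes> inv y \<noteq> X k" for k
        using A[of i 0 k] xy by (simp add: X0)
      moreover have "X i \<otimes> inv y \<noteq> y"
      proof
        assume "X i \<otimes> inv y = y"
        then have "X i \<otimes> inv y \<otimes> y = y \<otimes> y" by simp
        then have "y \<otimes> y = X i" using xy by (simp add: m_assoc)
        then show False using off(2) by blast
      qed
      ultimately show ?thesis
        using that A2 B2 yeq by (elim insertE emptyE; metis)
    qed
    then show ?thesis
      unfolding two_sided_match_def by blast
  qed
  moreover have "y \<noteq> y \<otimes> y"
    using xy off(1)[of 0] by (simp add: X0)
  moreover have False
    if \<sigma>: "\<And>g. g \<in> carrier G \<Longrightarrow> \<sigma> g \<in> carrier G"
      and y: "\<And>g. g \<in> carrier G \<Longrightarrow> \<sigma> (y \<otimes> g) = inv (y \<otimes> y) \<otimes> \<sigma> g"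
      and z: "\<And>g. g \<in> carrier G \<Longrightarrow> \<sigma> (inv (y \<otimes> y) \<otimes> g) = y \<otimes> \<sigma> g" for \<sigma>
  proof -
    have "y \<otimes> (y \<otimes> (inv (y \<otimes> y) \<otimes> \<one>)) = \<one>"
      using mult_inv_cancel[OF yy one_closed] m_assoc[OF xy(2,2) m_closed[OF inv_closed[OF yy] one_closed]] by simp
    then have "\<sigma> \<one> = inv (y \<otimes> y) \<otimes> (inv (y \<otimes> y) \<otimes> (y \<otimes> \<sigma> \<one>))"
      using y[of "y \<otimes> (inv (y \<otimes> y) \<otimes> \<one>)"] y[of "inv (y \<otimes> y) \<otimes> \<one>"] z[OF one_closed] xy yy by simp
    also have "\<dots> = inv (y \<otimes> y \<otimes> y) \<otimes> \<sigma> \<one>"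
      using xy \<sigma>[OF one_closed] by (simp add: inv_mult_group m_assoc inv_mult_cancel)
    finally have "inv (y \<otimes> y \<otimes> y) = \<one>"
      using xy \<sigma>[OF one_closed] by simp
    then have "inv (inv (y \<otimes> y \<otimes> y)) = \<one>" 
      by simp
    then have "y \<otimes> y \<otimes> y = X 0"
      using xy X0 inv_inv[of "y \<otimes> y \<otimes> y"] by simp
    then show False
      using off(3) by blast
  qed
  ultimately show ?thesis
    using admits_POSR_order_5[OF fin xy yy gen ord] y1 y2 unfolding X_def by blast
qed

end

section \<open>Counting closed walks in groups with explicit multiplication\<close>

text \<open>
  The number of directed paths of length 3 that an arc labelled \<open>e\<close> closes, that is, which lead from its
  start to its end; \<open>A\<close> is the one of the sets \<open>R\<close> and \<open>L\<close> that contains \<open>e\<close>, and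
  \<open>B\<close> is the other one.  The group is given by operations on indices so that the number can be evaluated.
\<close>

definition closing_count :: "('i \<Rightarrow> 'i \<Rightarrow> 'i) \<Rightarrow> ('i \<Rightarrow> 'i) \<Rightarrow> 'i list \<Rightarrow> 'i list \<Rightarrow> 'i \<Rightarrow> nat" where
  "closing_count mul iv A B e =
     length (filter (\<lambda>(p, r). mul (mul p (iv e)) r \<in> set B) (List.product (remove1 e A) (remove1 e A)))"

text \<open>
  The number of directed paths of length 3 that end with an arc labelled \<open>e\<close> and are closed by a further
  arc.
\<close>

definition final_count :: "('i \<Rightarrow> 'i \<Rightarrow> 'i) \<Rightarrow> ('i \<Rightarrow> 'i) \<Rightarrow> 'i list \<Rightarrow> 'i list \<Rightarrow> 'i \<Rightarrow> nat" where
  "final_count mul iv A B e =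
     length (filter (\<lambda>(p, r). mul (mul p (iv e)) r \<in> set A) (List.product (remove1 e A) B))"

context two_part_cayley begin

lemma card_label_walks_closing:
  "card (label_walks (\<lambda>_. 0) ((False, 0), (False, 0), (False, 0), True) e) =
    card {(p, r). p \<in> (if e \<in> R then R else L) - {e} \<and> r \<in> (if e \<in> R then R else L) - {e} \<and>
      p \<otimes> inv e \<otimes> r \<in> (if e \<in> R then L else R)}"
  if e: "e \<in> R \<union> L"
proof (cases "e \<in> R")
  case True
  have "bij_betw (\<lambda>(p, q, r). (r, p)) (label_walks (\<lambda>_. 0) ((False, 0), (False, 0), (False, 0), True) e)
    {(p, r). p \<in> R - {e} \<and> r \<in> R - {e} \<and> p \<otimes> inv e \<otimes> r \<in> L}"
    by (rule bij_betw_byWitness[where f' = "\<lambda>(r, p). (p, r \<otimes> inv e \<otimes> p, r)"])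
       (use True disjoint in \<open>auto simp: label_walks_iff\<close>)
  then show ?thesis
    using True by (simp add: bij_betw_same_card)
next
  case False
  have "bij_betw (\<lambda>(p, q, r). (p, r)) (label_walks (\<lambda>_. 0) ((False, 0), (False, 0), (False, 0), True) e)
    {(p, r). p \<in> L - {e} \<and> r \<in> L - {e} \<and> p \<otimes> inv e \<otimes> r \<in> R}"
    by (rule bij_betw_byWitness[where f' = "\<lambda>(p, r). (p, p \<otimes> inv e \<otimes> r, r)"])
       (use False e disjoint in \<open>auto simp: label_walks_iff\<close>)
  then show ?thesis
    using False by (simp add: bij_betw_same_card)
qed

lemma card_label_walks_final:
  assumes e: "e \<in> R \<union> L"
  shows "card (label_walks (\<lambda>_. 0) ((False, 0), (True, 0), (True, 0), True) e) =
    (if e \<in> R then card {(p, r). p \<in> R - {e} \<and> r \<in> L \<and> r \<otimes> inv e \<otimes> p \<in> R}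
     else card {(p, r). p \<in> L - {e} \<and> r \<in> R \<and> p \<otimes> inv e \<otimes> r \<in> L})"
proof (cases "e \<in> R")
  case True
  have "bij_betw (\<lambda>(p, q, r). (p, r)) (label_walks (\<lambda>_. 0) ((False, 0), (True, 0), (True, 0), True) e)
    {(p, r). p \<in> R - {e} \<and> r \<in> L \<and> r \<otimes> inv e \<otimes> p \<in> R}"
    by (rule bij_betw_byWitness[where f' = "\<lambda>(p, r). (p, r \<otimes> inv e \<otimes> p, r)"])
       (use True disjoint in \<open>auto simp: label_walks_iff\<close>)
  then show ?thesis
    using True by (simp add: bij_betw_same_card)
next
  case False
  have "bij_betw (\<lambda>(p, q, r). (p, r)) (label_walks (\<lambda>_. 0) ((False, 0), (True, 0), (True, 0), True) e)
    {(p, r). p \<in> L - {e} \<and> r \<in> R \<and> p \<otimes> inv e \<otimes> r \<in> L}"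
    by (rule bij_betw_byWitness[where f' = "\<lambda>(p, r). (p, p \<otimes> inv e \<otimes> r, r)"])
       (use False e disjoint in \<open>auto simp: label_walks_iff\<close>)
  then show ?thesis
    using False by (simp add: bij_betw_same_card)
qed

end

lemma card_Collect_image_pairs:
  assumes "inj_on f (set as \<union> set bs)" "distinct as" "distinct bs"
    and "\<And>p r. p \<in> set as \<Longrightarrow> r \<in> set bs \<Longrightarrow> Q p r \<longleftrightarrow> P (f p) (f r)"
  shows "card {(p, r). p \<in> f ` set as \<and> r \<in> f ` set bs \<and> P p r} =
    length (filter (\<lambda>(p, r). Q p r) (List.product as bs))"
proof -
  let ?F = "filter (\<lambda>(p, r). Q p r) (List.product as bs)"
  have "distinct ?F"
    using assms(2,3) by (simp add: distinct_product)
  then have "length ?F = card (set ?F)"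
    by (rule distinct_card[symmetric])
  also have "\<dots> = card (map_prod f f ` set ?F)"
  proof (rule card_image[symmetric])
    have "inj_on (map_prod f f) ((set as \<union> set bs) \<times> (set as \<union> set bs))"
      using assms(1) by (simp add: map_prod_inj_on)
    then show "inj_on (map_prod f f) (set ?F)"
      by (rule inj_on_subset) auto
  qed
  also have "map_prod f f ` set ?F = {(p, r). p \<in> f ` set as \<and> r \<in> f ` set bs \<and> P p r}"
  proof (intro equalityI subsetI)
    fix x assume "x \<in> map_prod f f ` set ?F"
    then obtain p r where "p \<in> set as" "r \<in> set bs" "Q p r" "x = (f p, f r)"
      by auto
    then show "x \<in> {(p, r). p \<in> f ` set as \<and> r \<in> f ` set bs \<and> P p r}"
      using assms(4)[of p r] by simp
  next
    fix x assume "x \<in> {(p, r). p \<in> f ` set as \<and> r \<in> f ` set bs \<and> P p r}"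
    then obtain p r where pr: "p \<in> set as" "r \<in> set bs" "P (f p) (f r)" "x = (f p, f r)"
      by auto
    then have "(p, r) \<in> set ?F"
      using assms(4)[of p r] by simp
    then show "x \<in> map_prod f f ` set ?F"
      using pr(4) by (metis image_eqI map_prod_simp)
  qed
  finally show ?thesis
    by simp
qed

text \<open>
  Both counts refine the constant colouring.  They are packed into one number: \<open>closing_count\<close> is at most
  4, as \<open>A\<close> has three elements.  The first label of \<open>A\<close> stands for the identity.
\<close>

lemma (in group) admits_POSR_by_counting:
  fixes f :: "'i \<Rightarrow> 'a"
  assumes fin: "finite (carrier G)"
    and I: "f ` I \<subseteq> carrier G" "inj_on f I"
    and mul: "\<And>p q. p \<in> I \<Longrightarrow> q \<in> I \<Longrightarrow> mul p q \<in> I \<and> f (mul p q) = f p \<otimes> f q"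
    and iv: "\<And>p. p \<in> I \<Longrightarrow> iv p \<in> I \<and> mul p (iv p) = i\<^sub>0"
    and one: "f i\<^sub>0 = \<one>" and gen: "generate G {f i\<^sub>1, f i\<^sub>2} = carrier G"
    and A: "A = [i\<^sub>0, i\<^sub>1, i\<^sub>2]" and B: "length B = 3" and AB: "distinct (A @ B)" "set (A @ B) \<subseteq> I"
    and w\<^sub>A: "\<And>e. w\<^sub>A e = closing_count mul iv A B e + 10 * final_count mul iv A B e"
    and w\<^sub>B: "\<And>e. w\<^sub>B e = closing_count mul iv B A e + 10 * final_count (\<lambda>p q. mul q p) iv B A e"
    and dist: "distinct (map w\<^sub>A A)" "set (map w\<^sub>A A) \<inter> set (map w\<^sub>B B) = {}"
  shows "admits_POSR G 2 3"
proof -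
  define R where "R = f ` set B"
  define L where "L = f ` set A"
  have sub: "set A \<subseteq> I" "set B \<subseteq> I" "set A \<inter> set B = {}" and dAB: "distinct A" "distinct B"
    using AB by auto
  have inj: "inj_on f (set A \<union> set B)"
    using inj_on_subset[OF I(2), of "set A \<union> set B"] sub by simp
  have RL: "R \<inter> L = {}"
    using inj_on_image_Int[OF I(2) sub(2,1)] sub(3) unfolding R_def L_def by (simp add: Int_commute)
  interpret two_part_cayley G R L
  proof
    show "R \<subseteq> carrier G" "L \<subseteq> carrier G"
      using I(1) sub by (auto simp: R_def L_def)
    have "card (set A) = 3" "card (set B) = 3"
      unfolding distinct_card[OF dAB(1)] distinct_card[OF dAB(2)] using A B by simp_all
    moreover have "inj_on f (set A)" "inj_on f (set B)"
      using inj by (auto intro: inj_on_subset)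
    ultimately show "card R = 3" "card L = 3"
      by (simp_all add: R_def L_def card_image)
    show "R \<inter> L = {}" by (rule RL)
  qed (rule fin)
  have f_inv: "f (iv p) = inv (f p)" if "p \<in> I" for p
  proof -
    have "f p \<otimes> f (iv p) = \<one>"
      using mul[of p "iv p"] iv[OF that] one that by simp
    then show ?thesis
      using that iv[OF that] I(1) by (metis image_subset_iff inv_equality inv_inv inv_closed inv_comm)
  qed
  have prod: "f (mul (mul p (iv e)) r) = f p \<otimes> inv (f e) \<otimes> f r"
    "f (mul r (mul (iv e) p)) = f r \<otimes> inv (f e) \<otimes> f p"
    "mul (mul p (iv e)) r \<in> I" "mul r (mul (iv e) p) \<in> I"
    if "p \<in> I" "e \<in> I" "r \<in> I" for p e r
    using that mul iv f_inv I(1) by (auto simp: m_assoc image_subset_iff)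
  have mem: "f q \<in> f ` S \<longleftrightarrow> q \<in> S" if "q \<in> I" "S \<subseteq> I" for q S
    using that I(2) by (auto dest: inj_onD)
  have diff: "f ` set C - {f e} = f ` set (remove1 e C)" if "distinct C" "set C \<subseteq> I" "e \<in> I" for C e
    using that I(2) by (auto dest: inj_onD)
  have count: "length (filter (\<lambda>(p, r). Q p r) (List.product C D)) =
      card {(p, r). p \<in> f ` set C \<and> r \<in> f ` set D \<and> P p r}"
    if "distinct C" "set C \<subseteq> I" "distinct D" "set D \<subseteq> I"
      and "\<And>p r. p \<in> set C \<Longrightarrow> r \<in> set D \<Longrightarrow> Q p r \<longleftrightarrow> P (f p) (f r)" for C D P Q
    by (rule card_Collect_image_pairs[symmetric])
      (use that inj_on_subset[OF I(2), of "set C \<union> set D"] in auto)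
  have rem: "distinct (remove1 e C)" "set (remove1 e C) \<subseteq> I" if "distinct C" "set C \<subseteq> I" for C e
    using that set_remove1_subset[of e C] by auto
  define c where "c s = card (label_walks (\<lambda>_. 0) ((False, 0), (False, 0), (False, 0), True) s) +
    10 * card (label_walks (\<lambda>_. 0) ((False, 0), (True, 0), (True, 0), True) s)" for s
  have c: "invariant_colour c"
    by (rule invariant_colour_refine[OF invariant_colour_const[of 0]]) (simp add: c_def)
  have c_A: "c (f e) = w\<^sub>A e" if e: "e \<in> set A" for e
  proof -
    have eI: "e \<in> I" and eL: "f e \<in> L" using e sub by (auto simp: L_def)
    then have eR: "f e \<notin> R" using RL by blast
    have "closing_count mul iv A B e = card {(p, r). p \<in> L - {f e} \<and> r \<in> L - {f e} \<and> p \<otimes> inv f e \<otimes> r \<in> R}"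
      unfolding closing_count_def R_def L_def diff[OF dAB(1) sub(1) eI]
    proof (rule count)
      fix p r assume "p \<in> set (remove1 e A)" "r \<in> set (remove1 e A)"
      then have "p \<in> I" "r \<in> I"
        using rem[OF dAB(1) sub(1)] sub by blast+
      then show "mul (mul p (iv e)) r \<in> set B \<longleftrightarrow> f p \<otimes> inv f e \<otimes> f r \<in> f ` set B"
        using prod[of p e r] mem[of "mul (mul p (iv e)) r" "set B"] sub eI by simp
    qed (use rem[OF dAB(1) sub(1)] sub dAB in blast)+
    moreover have "final_count mul iv A B e = card {(p, r). p \<in> L - {f e} \<and> r \<in> R \<and> p \<otimes> inv f e \<otimes> r \<in> L}"
      unfolding final_count_def R_def L_def diff[OF dAB(1) sub(1) eI]
    proof (rule count)
      fix p r assume "p \<in> set (remove1 e A)" "r \<in> set (B)"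
      then have "p \<in> I" "r \<in> I"
        using rem[OF dAB(1) sub(1)] sub by blast+
      then show "mul (mul p (iv e)) r \<in> set A \<longleftrightarrow> f p \<otimes> inv f e \<otimes> f r \<in> f ` set A"
        using prod[of p e r] mem[of "mul (mul p (iv e)) r" "set A"] sub eI by simp
    qed (use rem[OF dAB(1) sub(1)] sub dAB in blast)+
    ultimately show ?thesis
      using eL eR by (simp add: c_def w\<^sub>A card_label_walks_closing card_label_walks_final)
  qed
  have c_B: "c (f e) = w\<^sub>B e" if e: "e \<in> set B" for e
  proof -
    have eI: "e \<in> I" and eR: "f e \<in> R" using e sub by (auto simp: R_def)
    have "closing_count mul iv B A e = card {(p, r). p \<in> R - {f e} \<and> r \<in> R - {f e} \<and> p \<otimes> inv f e \<otimes> r \<in> L}"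
      unfolding closing_count_def R_def L_def diff[OF dAB(2) sub(2) eI]
    proof (rule count)
      fix p r assume "p \<in> set (remove1 e B)" "r \<in> set (remove1 e B)"
      then have "p \<in> I" "r \<in> I"
        using rem[OF dAB(2) sub(2)] sub by blast+
      then show "mul (mul p (iv e)) r \<in> set A \<longleftrightarrow> f p \<otimes> inv f e \<otimes> f r \<in> f ` set A"
        using prod[of p e r] mem[of "mul (mul p (iv e)) r" "set A"] sub eI by simp
    qed (use rem[OF dAB(2) sub(2)] sub dAB in blast)+
    moreover have "final_count (\<lambda>p q. mul q p) iv B A e = card {(p, r). p \<in> R - {f e} \<and> r \<in> L \<and> r \<otimes> inv f e \<otimes> p \<in> R}"
      unfolding final_count_def R_def L_def diff[OF dAB(2) sub(2) eI]
    proof (rule count)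
      fix p r assume "p \<in> set (remove1 e B)" "r \<in> set (A)"
      then have "p \<in> I" "r \<in> I"
        using rem[OF dAB(2) sub(2)] sub by blast+
      then show "mul r (mul (iv e) p) \<in> set B \<longleftrightarrow> f r \<otimes> inv f e \<otimes> f p \<in> f ` set B"
        using prod[of p e r] mem[of "mul r (mul (iv e) p)" "set B"] sub eI by simp
    qed (use rem[OF dAB(2) sub(2)] sub dAB in blast)+
    ultimately show ?thesis
      using eR by (simp add: c_def w\<^sub>B card_label_walks_closing card_label_walks_final)
  qed
  have "Aut_group \<Gamma> \<cong> G"
  proof (rule rigid_if_left_labels_isolated[OF c _ gen])
    show "L = {\<one>, f i\<^sub>1, f i\<^sub>2}"
      by (simp add: L_def A one)
    fix l s assume l: "l \<in> L" and s: "s \<in> R \<union> L" and eq: "c s = c l"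
    obtain a where a: "a \<in> set A" "l = f a"
      using l by (auto simp: L_def)
    show "s = l"
    proof (cases "s \<in> L")
      case True
      then obtain b where b: "b \<in> set A" "s = f b"
        by (auto simp: L_def)
      have "w\<^sub>A b = w\<^sub>A a"
        using eq a b c_A by simp
      then have "b = a"
        using dist(1) a b by (auto simp: distinct_map dest: inj_onD)
      then show ?thesis using a b by simp
    next
      case False
      then obtain b where b: "b \<in> set B" "s = f b"
        using s by (auto simp: R_def)
      then have "w\<^sub>B b = w\<^sub>A a"
        using eq a c_A c_B by simp
      then have "w\<^sub>A a \<in> set (map w\<^sub>A A) \<inter> set (map w\<^sub>B B)"
        using a(1) b(1) by (metis IntI image_eqI list.set_map)
      then show ?thesis
        using dist(2) by blast
    qed
  qed
  then show ?thesis
    using admits_POSR_iff[OF fin] two_part_cayley_axioms by blast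
qed

context group begin

lemma int_pow_mod_exponent:
  assumes "x \<in> carrier G" "x [^] (n::int) = \<one>"
  shows "x [^] (i mod n) = x [^] i"
proof -
  have "x [^] i = x [^] (n * (i div n) + i mod n)"
    by simp
  also have "\<dots> = (x [^] n) [^] (i div n) \<otimes> x [^] (i mod n)"
    using assms(1) by (simp only: int_pow_mult int_pow_pow)
  finally show ?thesis
    using assms by simp
qed

lemma dvd_if_prime_power_mem_subgroup:
  assumes H: "subgroup H G" and y: "y \<in> carrier G" "y \<notin> H" and p: "prime (p::int)" "y [^] p = \<one>"
    and mem: "y [^] (j::int) \<in> H"
  shows "p dvd j"
proof (rule ccontr)
  assume "\<not> p dvd j"
  then have "coprime p j"
    using prime_imp_coprime[OF p(1)] by blast
  then obtain u v where uv: "u * p + v * j = 1"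
    using bezout_int[of p j] by auto
  have "y = y [^] (p * u + j * v)"
    using uv y by (simp add: mult.commute)
  also have "\<dots> = (y [^] p) [^] u \<otimes> (y [^] j) [^] v"
    using y(1) by (simp only: int_pow_mult int_pow_pow)
  also have "\<dots> = (y [^] j) [^] v"
    using p y by simp
  also have "\<dots> \<in> H"
    using H mem by (rule subgroup_int_pow_closed)
  finally show False
    using y by simp
qed

lemma powers_subgroup: "x \<in> carrier G \<Longrightarrow> subgroup (powers x) G"
proof (rule subgroupI)
  assume x: "x \<in> carrier G"
  show "inv a \<in> powers x" if "a \<in> powers x" for a
    using that x by (auto simp: int_pow_neg[symmetric])
  show "a \<otimes> b \<in> powers x"
    if "a \<in> powers x" "b \<in> powers x" for a b
    using that x by (auto simp: int_pow_mult[symmetric])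
qed auto

lemma int_pow_eq_one_iff_prime:
  assumes "x \<in> carrier G" "x \<noteq> \<one>" "prime (p::int)" "x [^] p = \<one>"
  shows "x [^] (i::int) = \<one> \<longleftrightarrow> p dvd i"
proof
  assume "x [^] i = \<one>"
  then show "p dvd i"
    using dvd_if_prime_power_mem_subgroup[OF triv_subgroup, of x p i] assms by simp
next
  assume "p dvd i"
  then show "x [^] i = \<one>"
    using int_pow_mod_exponent[OF assms(1,4), of i] by (simp add: dvd_eq_mod_eq_0)
qed

end

lemma eq_if_dvd_diff_small: "p dvd i - j \<Longrightarrow> i \<in> {0..<p} \<Longrightarrow> j \<in> {0..<p} \<Longrightarrow> i = (j::int)"
  by (metis atLeastLessThan_iff mod_eq_dvd_iff mod_pos_pos_trivial)

section \<open>Small groups\<close>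

text \<open>
  In the next three products an index stands for \<open>x\<^sup>a y\<^sup>s\<close>, \<open>x\<^sup>i y\<^sup>j\<close> and
  \<open>x\<^sup>i b\<^sup>j y\<^sup>k\<close>, where \<open>b\<close> is the conjugate $yxy^{-1}$.
\<close>

definition dihedral_mult :: "int \<Rightarrow> int \<times> bool \<Rightarrow> int \<times> bool \<Rightarrow> int \<times> bool" where
  "dihedral_mult n = (\<lambda>(a, s) (b, t). ((if s then a - b else a + b) mod n, s \<noteq> t))"

definition dihedral_inv :: "int \<Rightarrow> int \<times> bool \<Rightarrow> int \<times> bool" where
  "dihedral_inv n = (\<lambda>(a, s). (if s then a else (- a) mod n, s))"

definition abelian_mult :: "int \<times> int \<Rightarrow> int \<times> int \<Rightarrow> int \<times> int" where
  "abelian_mult = (\<lambda>(i, j) (i', j'). ((i + i') mod 3, (j + j') mod 3))"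

definition abelian_inv :: "int \<times> int \<Rightarrow> int \<times> int" where
  "abelian_inv = (\<lambda>(i, j). ((- i) mod 3, (- j) mod 3))"

text \<open>
  The \<open>k\<close>-th power of the automorphism of $\mathbb{Z}_n^2$ that maps the basis \<open>a, b\<close> to
  \<open>b, -a-b\<close>.
\<close>

definition cyclic_shift :: "int \<Rightarrow> int \<times> int \<Rightarrow> int \<times> int" where
  "cyclic_shift k = (\<lambda>(i, j). if k = 0 then (i, j) else if k = 1 then (- j, i - j) else (j - i, - i))"

text \<open>
  The product of $\mathbb{Z}_n^2 \rtimes \mathbb{Z}_3$ with respect to this action: for \<open>n = 2\<close> this is
  $A_4$, and for \<open>n = 3\<close> it is the Heisenberg group of order 27.
\<close>

definition semidirect_mult :: "int \<Rightarrow> int \<times> int \<times> int \<Rightarrow> int \<times> int \<times> int \<Rightarrow> int \<times> int \<times> int" where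
  "semidirect_mult n = (\<lambda>(i, j, k) (i', j', k').
     ((i + fst (cyclic_shift k (i', j'))) mod n, (j + snd (cyclic_shift k (i', j'))) mod n, (k + k') mod 3))"

definition semidirect_inv :: "int \<Rightarrow> int \<times> int \<times> int \<Rightarrow> int \<times> int \<times> int" where
  "semidirect_inv n = (\<lambda>(i, j, k).
     (fst (cyclic_shift ((- k) mod 3) (- i, - j)) mod n, snd (cyclic_shift ((- k) mod 3) (- i, - j)) mod n, (- k) mod 3))"

context group begin

lemma dihedral_parametrisation:
  fixes n :: int
  assumes xy: "x \<in> carrier G" "y \<in> carrier G" and n: "x [^] n = \<one>" and y2: "y \<otimes> y = \<one>"
    and rel: "y \<otimes> x = inv x \<otimes> y"
  defines "f \<equiv> \<lambda>(a::int, s). x [^] a \<otimes> (if s then y else \<one>)"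
  shows "f (dihedral_mult n p q) = f p \<otimes> f q"
proof -
  obtain a s b t where pq: "p = (a, s)" "q = (b, t)"
    by (cases p, cases q) auto
  have "y \<otimes> x \<otimes> y = inv x"
    using xy rel y2 by (simp add: m_assoc)
  moreover have "inv y = y"
    using inv_equality[OF y2 xy(2,2)] .
  ultimately have "y \<otimes> x [^] b \<otimes> y = (inv x) [^] b"
    using conj_int_pow[OF xy(2,1), of b] by simp
  then have "y \<otimes> x [^] b \<otimes> y \<otimes> y = x [^] (- b) \<otimes> y"
    using xy by (simp add: int_pow_inv int_pow_neg)
  then have move: "y \<otimes> x [^] b = x [^] (- b) \<otimes> y"
    using xy y2 by (simp add: m_assoc)
  have flip: "x [^] a \<otimes> y \<otimes> (x [^] b \<otimes> h) = x [^] (a - b) \<otimes> (y \<otimes> h)" if h: "h \<in> carrier G" for h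
  proof -
    have "x [^] a \<otimes> y \<otimes> (x [^] b \<otimes> h) = x [^] a \<otimes> ((y \<otimes> x [^] b) \<otimes> h)"
      using xy h by (simp add: m_assoc)
    also have "\<dots> = (x [^] a \<otimes> x [^] (- b)) \<otimes> (y \<otimes> h)"
      unfolding move using xy h by (simp add: m_assoc)
    finally show ?thesis
      using xy by (simp add: int_pow_mult[symmetric])
  qed
  have keep: "x [^] a \<otimes> (x [^] b \<otimes> h) = x [^] (a + b) \<otimes> h" if "h \<in> carrier G" for h
    using xy that by (simp add: int_pow_mult m_assoc)
  show ?thesis
    unfolding pq f_def dihedral_mult_def
    using flip[OF xy(2)] flip[OF one_closed] keep[OF xy(2)] keep[OF one_closed] xy y2
    by (cases s; cases t) (simp_all add: int_pow_mod_exponent[OF xy(1) n])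
qed

lemma inj_on_dihedral_parametrisation:
  fixes n :: int
  assumes xy: "x \<in> carrier G" "y \<in> carrier G" and x1: "x \<noteq> \<one>" and n: "prime n" "x [^] n = \<one>"
    and y: "y \<notin> powers x"
  shows "inj_on (\<lambda>(a::int, s). x [^] a \<otimes> (if s then y else \<one>)) ({0..<n} \<times> UNIV)"
proof (rule inj_onI, clarify)
  fix a s b t
  assume I: "a \<in> {0..<n}" "b \<in> {0..<n}"
    and eq: "x [^] a \<otimes> (if s then y else \<one>) = x [^] b \<otimes> (if t then y else \<one>)"
  have off: "x [^] i \<otimes> y \<noteq> x [^] j" for i j :: int
  proof
    assume "x [^] i \<otimes> y = x [^] j"
    then have "y = inv (x [^] i) \<otimes> x [^] j"
      using inv_mult_cancel[of "x [^] i" y] xy by simp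
    then have "y = x [^] (- i + j)"
      using xy by (simp only: int_pow_mult int_pow_neg)
    then show False using y by blast
  qed
  have st: "s = t"
    using eq off[of a b] off[of b a] xy by (cases s; cases t) auto
  then have "x [^] a = x [^] b"
    using eq xy by (cases s) simp_all
  then have "x [^] (a - b) = \<one>"
    using xy by (simp add: int_pow_diff)
  then have "n dvd a - b"
    using int_pow_eq_one_iff_prime[OF xy(1) x1 n] by simp
  then show "a = b \<and> s = t"
    using I st eq_if_dvd_diff_small[of n a b] by simp
qed

lemma admits_POSR_dihedral_10:
  assumes fin: "finite (carrier G)" and xy: "x \<in> carrier G" "y \<in> carrier G"
    and gen: "generate G {x, y} = carrier G"
    and x5: "x [^] (5::int) = \<one>" "x \<noteq> \<one>" and y2: "y \<otimes> y = \<one>"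
    and rel: "y \<otimes> x = inv x \<otimes> y" and y: "y \<notin> powers x"
  shows "admits_POSR G 2 3"
proof -
  define f where "f = (\<lambda>(a::int, s). x [^] a \<otimes> (if s then y else \<one>))"
  let ?I = "{0..<5::int} \<times> (UNIV :: bool set)"
  let ?A = "[(0, False), (1, False), (0, True)] :: (int \<times> bool) list"
  let ?B = "[(3, False), (1, True), (3, True)] :: (int \<times> bool) list"
  show ?thesis
  proof (rule admits_POSR_by_counting[where f = f and I = ?I and mul = "dihedral_mult 5" and iv = "dihedral_inv 5"
        and A = ?A and B = ?B, OF fin])
    show "f ` ?I \<subseteq> carrier G"
      using xy by (auto simp: f_def)
    show "inj_on f ?I"
      unfolding f_def using inj_on_dihedral_parametrisation[OF xy x5(2) _ x5(1) y] by simp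
    show "\<And>p q. dihedral_mult 5 p q \<in> ?I \<and> f (dihedral_mult 5 p q) = f p \<otimes> f q"
      using dihedral_parametrisation[OF xy x5(1) y2 rel] by (auto simp: f_def dihedral_mult_def split_beta)
    show "\<And>p. p \<in> ?I \<Longrightarrow> dihedral_inv 5 p \<in> ?I \<and> dihedral_mult 5 p (dihedral_inv 5 p) = (0, False)"
      by (auto simp: dihedral_mult_def dihedral_inv_def mod_simps)
    show "f (0, False) = \<one>" "generate G {f (1, False), f (0, True)} = carrier G"
      using xy gen by (simp_all add: f_def)
    show "?A = [(0, False), (1, False), (0, True)]" "length ?B = 3" "distinct (?A @ ?B)" "set (?A @ ?B) \<subseteq> ?I"
      by auto
  qed (rule refl | code_simp)+
qed

end

context group begin

lemma commute_int_pow: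
  assumes ab: "a \<in> carrier G" "b \<in> carrier G" "a \<otimes> b = b \<otimes> a"
  shows "a [^] (i::int) \<otimes> b [^] (j::int) = b [^] j \<otimes> a [^] i"
proof -
  have one_step: "c [^] i \<otimes> d = d \<otimes> c [^] i"
    if "c \<in> carrier G" "d \<in> carrier G" "c \<otimes> d = d \<otimes> c" for c d and i :: int
  proof -
    have "inv d \<otimes> c \<otimes> d = c"
      using that inv_mult_cancel[of d c] by (simp add: m_assoc)
    then have "inv d \<otimes> (c [^] i \<otimes> d) = c [^] i"
      using conj_int_pow[OF that(2,1), of i] that by (simp add: m_assoc)
    then have "d \<otimes> (inv d \<otimes> (c [^] i \<otimes> d)) = d \<otimes> c [^] i"
      by simp
    then show ?thesis
      using that mult_inv_cancel[of d "c [^] i \<otimes> d"] by simp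
  qed
  have "b [^] j \<otimes> a = a \<otimes> b [^] j"
    using one_step[of b a j] ab by simp
  then show ?thesis
    using one_step[of a "b [^] j" i] ab by simp
qed

lemma admits_POSR_elementary_abelian_9:
  assumes fin: "finite (carrier G)" and xy: "x \<in> carrier G" "y \<in> carrier G"
    and gen: "generate G {x, y} = carrier G" and comm: "x \<otimes> y = y \<otimes> x"
    and x3: "x [^] (3::int) = \<one>" "x \<noteq> \<one>" and y3: "y [^] (3::int) = \<one>"
    and y: "y \<notin> powers x"
  shows "admits_POSR G 2 3"
proof -
  define f where "f = (\<lambda>(i::int, j::int). x [^] i \<otimes> y [^] j)"
  let ?I = "{0..<3::int} \<times> {0..<3::int}"
  let ?A = "[(0, 0), (1, 0), (0, 1)] :: (int \<times> int) list"
  let ?B = "[(0, 2), (1, 1), (2, 1)] :: (int \<times> int) list"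
  show ?thesis
  proof (rule admits_POSR_by_counting[where f = f and I = ?I and mul = abelian_mult and iv = abelian_inv
        and A = ?A and B = ?B, OF fin])
    show "f ` ?I \<subseteq> carrier G"
      using xy by (auto simp: f_def)
    show "inj_on f ?I"
    proof (rule inj_onI)
      fix p q assume pq: "p \<in> ?I" "q \<in> ?I" "f p = f q"
      obtain i j i' j' where *: "p = (i, j)" "q = (i', j')"
        by (cases p, cases q) auto
      have eq: "x [^] i \<otimes> y [^] j = x [^] i' \<otimes> y [^] j'"
        using pq(3) by (simp add: f_def *)
      have "y [^] (j - j') = x [^] (- i + i')"
      proof -
        have "y [^] j = inv (x [^] i) \<otimes> (x [^] i' \<otimes> y [^] j')"
          unfolding eq[symmetric] using xy by (simp add: inv_mult_cancel)
        then have "y [^] (j - j') = x [^] (- i) \<otimes> x [^] i'"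
          using xy by (simp add: int_pow_diff int_pow_neg m_assoc)
        then show ?thesis
          using xy by (simp only: int_pow_mult)
      qed
      then have "3 dvd j - j'"
        using dvd_if_prime_power_mem_subgroup[OF powers_subgroup[OF xy(1)] xy(2) y _ y3, of "j - j'"] by auto
      then have j: "j = j'"
        using pq(1,2) eq_if_dvd_diff_small[of 3 j j'] by (simp add: *)
      then have "x [^] i = x [^] i'"
        using eq xy by simp
      then have "x [^] (i - i') = \<one>"
        using xy by (simp add: int_pow_diff)
      then have "3 dvd i - i'"
        using int_pow_eq_one_iff_prime[OF xy(1) x3(2) _ x3(1)] by simp
      then show "p = q"
        using pq(1,2) j eq_if_dvd_diff_small[of 3 i i'] by (simp add: *)
    qed
    show "\<And>p q. abelian_mult p q \<in> ?I \<and> f (abelian_mult p q) = f p \<otimes> f q"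
    proof (clarsimp simp: abelian_mult_def f_def int_pow_mod_exponent[OF xy(1) x3(1)] int_pow_mod_exponent[OF xy(2) y3])
      fix i j i' j' :: int
      have "x [^] i \<otimes> y [^] j \<otimes> (x [^] i' \<otimes> y [^] j') = x [^] i \<otimes> ((y [^] j \<otimes> x [^] i') \<otimes> y [^] j')"
        using xy by (simp add: m_assoc)
      also have "y [^] j \<otimes> x [^] i' = x [^] i' \<otimes> y [^] j"
        using commute_int_pow[OF xy comm] by simp
      finally show "x [^] (i + i') \<otimes> y [^] (j + j') = x [^] i \<otimes> y [^] j \<otimes> (x [^] i' \<otimes> y [^] j')"
        using xy by (simp add: int_pow_mult m_assoc)
    qed
    show "\<And>p. p \<in> ?I \<Longrightarrow> abelian_inv p \<in> ?I \<and> abelian_mult p (abelian_inv p) = (0, 0)"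
      by (auto simp: abelian_mult_def abelian_inv_def mod_simps)
    show "f (0, 0) = \<one>" "generate G {f (1, 0), f (0, 1)} = carrier G"
      using xy gen by (simp_all add: f_def)
    show "?A = [(0, 0), (1, 0), (0, 1)]" "length ?B = 3" "distinct (?A @ ?B)" "set (?A @ ?B) \<subseteq> ?I"
      by auto
  qed (rule refl | code_simp)+
qed

text \<open>
  With \<open>b\<close> the conjugate of \<open>x\<close> by \<open>y\<close>, the hypotheses say that the conjugates of \<open>x\<close> under
  \<open>\<langle>y\<rangle>\<close> commute and have product 1.  Then \<open>x\<close> and \<open>b\<close> span a normal subgroup
  $\mathbb{Z}_n^2$, since \<open>b\<close> could be a power of \<open>x\<close> only if \<open>x = 1\<close> or \<open>b = x\<close>.
\<close>

lemma admits_POSR_semidirect: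
  fixes n :: int
  assumes fin: "finite (carrier G)" and xy: "x \<in> carrier G" "y \<in> carrier G"
    and gen: "generate G {x, y} = carrier G" and n: "n = 2 \<or> n = 3"
    and xn: "x [^] n = \<one>" and y3: "y [^] (3::int) = \<one>"
    and b: "b \<in> carrier G" "y \<otimes> x = b \<otimes> y"
    and ab: "x \<otimes> b = b \<otimes> x" "y \<otimes> b = inv (x \<otimes> b) \<otimes> y" and nc: "x \<otimes> y \<noteq> y \<otimes> x"
  shows "admits_POSR G 2 3"
proof -
  have np: "prime n" using n by auto
  define N where "N i j = x [^] i \<otimes> b [^] j" for i j :: int
  have NG [simp]: "N i j \<in> carrier G" for i j using xy b by (simp add: N_def)
  have N_mult: "N i j \<otimes> N i' j' = N (i + i') (j + j')" for i j i' j'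
  proof -
    have "N i j \<otimes> N i' j' = x [^] i \<otimes> ((b [^] j \<otimes> x [^] i') \<otimes> b [^] j')"
      using xy b by (simp add: N_def m_assoc)
    also have "b [^] j \<otimes> x [^] i' = x [^] i' \<otimes> b [^] j"
      using commute_int_pow[OF xy(1) b(1) ab(1)] by simp
    finally show ?thesis
      using xy b by (simp add: N_def int_pow_mult m_assoc)
  qed
  have N00: "N 0 0 = \<one>" by (simp add: N_def)
  have N_inv: "inv N i j = N (- i) (- j)" for i j
    using inv_equality[of "N (- i) (- j)" "N i j"] by (simp add: N_mult N00)
  have b_conj: "b = inv (inv y) \<otimes> x \<otimes> inv y"
    using b xy by (simp add: m_assoc)
  have bn: "b [^] n = \<one>"
    using conj_int_pow[of "inv y" x n] xy xn by (simp add: b_conj)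
  have N_mod: "N (i mod n) j = N i j" "N i (j mod n) = N i j" for i j
    using int_pow_mod_exponent[OF xy(1) xn] int_pow_mod_exponent[OF b(1) bn] by (simp_all add: N_def)
  have shift: "y \<otimes> N i j = N (- j) (i - j) \<otimes> y" for i j
  proof -
    have conj: "y \<otimes> c [^] k = d [^] k \<otimes> y" if "c \<in> carrier G" "d \<in> carrier G" "y \<otimes> c = d \<otimes> y" for c d and k :: int
    proof -
      have "d = inv (inv y) \<otimes> c \<otimes> inv y"
        using that xy by (simp add: m_assoc)
      then have "d [^] k = inv (inv y) \<otimes> c [^] k \<otimes> inv y"
        using conj_int_pow[of "inv y" c k] that xy by simp
      then show ?thesis
        using that xy by (simp add: m_assoc)
    qed
    have "y \<otimes> N i j = (y \<otimes> x [^] i) \<otimes> b [^] j"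
      using xy b by (simp add: N_def m_assoc)
    also have "y \<otimes> x [^] i = b [^] i \<otimes> y"
      using conj xy b by blast
    also have "b [^] i \<otimes> y \<otimes> b [^] j = b [^] i \<otimes> (y \<otimes> b [^] j)"
      using xy b by (simp add: m_assoc)
    also have "y \<otimes> b [^] j = N (- 1) (- 1) [^] j \<otimes> y"
    proof (rule conj[OF b(1) NG])
      show "y \<otimes> b = N (- 1) (- 1) \<otimes> y"
        using ab(2) N_inv[of 1 1] xy b by (simp add: N_def)
    qed
    also have "N (- 1) (- 1) [^] j = N (- j) (- j)"
    proof -
      have pow: "N 1 1 [^] k = N k k" for k :: int
        using int_pow_mult_distrib[OF ab(1) xy(1) b(1)] xy b by (simp add: N_def)
      have "N (- 1) (- 1) [^] j = (N 1 1 [^] (- 1 :: int)) [^] j"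
        unfolding pow ..
      also have "\<dots> = N 1 1 [^] (- 1 * j)"
        by (rule int_pow_pow[OF NG])
      finally show ?thesis
        unfolding pow by simp
    qed
    also have "b [^] i = N 0 i"
      using b by (simp add: N_def)
    finally show ?thesis
      using xy by (simp add: m_assoc[symmetric] N_mult)
  qed
  have shift_pow: "y [^] k \<otimes> N i j = N (fst (cyclic_shift k (i, j))) (snd (cyclic_shift k (i, j))) \<otimes> y [^] k"
    if "k \<in> {0..<3}" for i j k
  proof -
    have "k = 0 \<or> k = 1 \<or> k = 2" using that by auto
    moreover have "y [^] (2::int) = y \<otimes> y"
      using xy int_pow_mult[of y 1 1] by simp
    moreover have "y \<otimes> y \<otimes> N i j = N (j - i) (- i) \<otimes> (y \<otimes> y)"
    proof -
      have "y \<otimes> y \<otimes> N i j = y \<otimes> (y \<otimes> N i j)"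
        using xy by (simp add: m_assoc)
      also have "\<dots> = (y \<otimes> N (- j) (i - j)) \<otimes> y"
        unfolding shift[of i j] using xy by (simp add: m_assoc)
      also have "\<dots> = N (j - i) (- i) \<otimes> (y \<otimes> y)"
        unfolding shift[of "- j" "i - j"] using xy by (simp add: m_assoc)
      finally show ?thesis .
    qed
    ultimately show ?thesis
      using shift[of i j] xy by (auto simp: cyclic_shift_def)
  qed
  have subN: "subgroup ({N i j | i j. True}) G"
  proof (rule subgroupI)
    show "inv a \<in> {N i j | i j. True}" if "a \<in> {N i j | i j. True}" for a
      using that N_inv by blast
    show "a \<otimes> c \<in> {N i j | i j. True}" if "a \<in> {N i j | i j. True}" "c \<in> {N i j | i j. True}" for a c
      using that N_mult by blast
  qed auto
  have x_N: "x = N 1 0" using xy by (simp add: N_def)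
  have yN: "y \<notin> {N i j | i j. True}"
  proof
    assume "y \<in> {N i j | i j. True}"
    then obtain i j where "y = N i j" by auto
    then have "x \<otimes> y = y \<otimes> x"
      by (simp add: x_N N_mult add.commute)
    then show False using nc by simp
  qed
  have x1: "x \<noteq> \<one>" using nc xy by auto
  have b_off: "b \<notin> powers x"
  proof
    assume "b \<in> powers x"
    then obtain k where "b = x [^] (k::int)" by auto
    then have k: "b = x [^] (k mod n)"
      using int_pow_mod_exponent[OF xy(1) xn] by simp
    have "k mod n = 0 \<or> k mod n = 1 \<or> n = 3 \<and> k mod n = 2"
      using n by auto
    then show False
    proof (elim disjE conjE)
      assume "k mod n = 0"
      then have "b = \<one>" using k by simp
      then have "y \<otimes> x = y" using b xy by simp
      then show False using x1 xy by simp
    next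
      assume "k mod n = 1"
      then have "b = x" using k xy by simp
      then show False using nc b by simp
    next
      assume "n = 3" "k mod n = 2"
      then have "x \<otimes> b = x [^] (1 + 2 :: int)"
        using k xy by (simp add: int_pow_mult[of x 1 2, simplified])
      then have "x \<otimes> b = \<one>"
        using xn \<open>n = 3\<close> by simp
      then have "y \<otimes> b = y" using ab(2) xy by simp
      then have "b = \<one>" using xy b by simp
      then have "y \<otimes> x = y" using b xy by simp
      then show False using x1 xy by simp
    qed
  qed
  define f where "f = (\<lambda>(i::int, j::int, k::int). N i j \<otimes> y [^] k)"
  let ?I = "{0..<n} \<times> {0..<n} \<times> {0..<3::int}"
  let ?A = "[(0, 0, 0), (1, 0, 0), (0, 0, 1)] :: (int \<times> int \<times> int) list"
  let ?B = "[(0, 0, 2), (0, 1, 2), (1, 0, 2)] :: (int \<times> int \<times> int) list"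
  show ?thesis
  proof (rule admits_POSR_by_counting[where f = f and I = ?I and mul = "semidirect_mult n" and iv = "semidirect_inv n"
        and A = ?A and B = ?B, OF fin])
    show "f ` ?I \<subseteq> carrier G"
      using xy by (auto simp: f_def)
    show "inj_on f ?I"
    proof (rule inj_onI)
      fix p q assume pq: "p \<in> ?I" "q \<in> ?I" "f p = f q"
      obtain i j k i' j' k' where *: "p = (i, j, k)" "q = (i', j', k')"
        by (cases p, cases q) auto
      have eq: "N i j \<otimes> y [^] k = N i' j' \<otimes> y [^] k'"
        using pq(3) by (simp add: f_def *)
      have "y [^] (k - k') = inv N i j \<otimes> N i' j'"
      proof -
        have "y [^] k = inv N i j \<otimes> (N i' j' \<otimes> y [^] k')"
          unfolding eq[symmetric] using xy by (simp add: inv_mult_cancel)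
        then show ?thesis
          using xy by (simp add: int_pow_diff m_assoc)
      qed
      also have "\<dots> \<in> {N i j | i j. True}"
        unfolding N_inv N_mult by blast
      finally have "3 dvd k - k'"
        using dvd_if_prime_power_mem_subgroup[OF subN xy(2) yN _ y3, of "k - k'"] by simp
      then have k: "k = k'"
        using pq(1,2) eq_if_dvd_diff_small[of 3 k k'] by (simp add: *)
      then have "N i j = N i' j'"
        using eq xy by simp
      then have "N (- i) (- j') \<otimes> N i j = N (- i) (- j') \<otimes> N i' j'"
        by simp
      then have bx: "b [^] (j - j') = x [^] (i' - i)"
        using xy b by (simp add: N_mult) (simp add: N_def)
      then have "n dvd j - j'"
        using dvd_if_prime_power_mem_subgroup[OF powers_subgroup[OF xy(1)] b(1) b_off np bn, of "j - j'"] by auto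
      then have j: "j = j'"
        using pq(1,2) eq_if_dvd_diff_small[of n j j'] by (simp add: *)
      then have "n dvd i' - i"
        using bx int_pow_eq_one_iff_prime[OF xy(1) x1 np xn, of "i' - i"] by simp
      then show "p = q"
        using pq(1,2) k j eq_if_dvd_diff_small[of n i' i] by (simp add: *)
    qed
    show "semidirect_mult n p q \<in> ?I \<and> f (semidirect_mult n p q) = f p \<otimes> f q" if "p \<in> ?I" "q \<in> ?I" for p q
    proof -
      obtain i j k i' j' k' where *: "p = (i, j, k)" "q = (i', j', k')"
        by (cases p, cases q) auto
      have k: "k \<in> {0..<3}" using that * by simp
      define u where "u = fst (cyclic_shift k (i', j'))"
      define v where "v = snd (cyclic_shift k (i', j'))"
      have "f p \<otimes> f q = N i j \<otimes> ((y [^] k \<otimes> N i' j') \<otimes> y [^] k')"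
        using xy by (simp add: f_def * m_assoc)
      also have "\<dots> = (N i j \<otimes> N u v) \<otimes> (y [^] k \<otimes> y [^] k')"
        unfolding shift_pow[OF k] u_def v_def using xy by (simp add: m_assoc)
      also have "\<dots> = N (i + u) (j + v) \<otimes> y [^] ((k + k') mod 3)"
        unfolding N_mult int_pow_mod_exponent[OF xy(2) y3] using xy by (simp add: int_pow_mult)
      also have "\<dots> = f (semidirect_mult n p q)"
        by (simp add: f_def semidirect_mult_def * u_def v_def N_mod)
      finally show ?thesis
        using n by (auto simp: semidirect_mult_def *)
    qed
    show "semidirect_inv n p \<in> ?I \<and> semidirect_mult n p (semidirect_inv n p) = (0, 0, 0)" if "p \<in> ?I" for p
    proof -
      obtain i j k where *: "p = (i, j, k)"
        by (cases p) auto
      have "k = 0 \<or> k = 1 \<or> k = 2" using that * by auto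
      then show ?thesis
        using n by (elim disjE) (simp_all add: semidirect_mult_def semidirect_inv_def cyclic_shift_def * mod_simps, presburger+)
    qed
    show "f (0, 0, 0) = \<one>" "generate G {f (1, 0, 0), f (0, 0, 1)} = carrier G"
      using xy gen by (simp_all add: f_def N00 x_N[symmetric])
    show "?A = [(0, 0, 0), (1, 0, 0), (0, 0, 1)]" "length ?B = 3" "distinct (?A @ ?B)"
      by auto
    show "set (?A @ ?B) \<subseteq> ?I"
      using n by auto
    show "distinct (map (\<lambda>e. closing_count (semidirect_mult n) (semidirect_inv n) ?A ?B e +
        10 * final_count (semidirect_mult n) (semidirect_inv n) ?A ?B e) ?A)"
      using n by (elim disjE) (simp_all only:, code_simp+)
    show "set (map (\<lambda>e. closing_count (semidirect_mult n) (semidirect_inv n) ?A ?B e +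
        10 * final_count (semidirect_mult n) (semidirect_inv n) ?A ?B e) ?A) \<inter>
      set (map (\<lambda>e. closing_count (semidirect_mult n) (semidirect_inv n) ?B ?A e +
        10 * final_count (\<lambda>p q. semidirect_mult n q p) (semidirect_inv n) ?B ?A e) ?B) = {}"
      using n by (elim disjE) (simp_all only:, code_simp+)
  qed (rule refl)+
qed

end

section \<open>The exceptional groups\<close>

context group begin

lemma not_admits_POSR_small:
  assumes fin: "finite (carrier G)" and small: "card (carrier G) < 6"
  shows "\<not> admits_POSR G 2 3"
proof
  assume "admits_POSR G 2 3"
  then obtain R L where "two_part_cayley G R L"
    using admits_POSR_iff[OF fin] by blast
  then interpret two_part_cayley G R L .
  have "card (R \<union> L) = 6"
    using card_Un_disjoint[of R L] disjoint card_R card_L R_subset L_subset fin finite_subset by fastforce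
  moreover have "card (R \<union> L) \<le> card (carrier G)"
    using R_subset L_subset fin by (intro card_mono) auto
  ultimately show False
    using small by simp
qed

text \<open>
  If \<open>pRq = R\<close>, then the complement \<open>L\<close> of \<open>R\<close> is fixed as well, and
  $g_0 \mapsto (q^{-1}g)_0$, $g_1 \mapsto (pg)_1$ is an automorphism.  It is a right translation only if
  \<open>p\<close> is central.
\<close>

lemma not_admits_POSR_order_6_centreless:
  assumes fin: "finite (carrier G)" and six: "card (carrier G) = 6"
    and centreless: "\<And>a. a \<in> carrier G \<Longrightarrow> (\<And>g. g \<in> carrier G \<Longrightarrow> a \<otimes> g = g \<otimes> a) \<Longrightarrow> a = \<one>"
  shows "\<not> admits_POSR G 2 3"
proof
  assume "admits_POSR G 2 3"
  then obtain R L where tpc: "two_part_cayley G R L" and iso: "Aut_group (two_part_digraph G R L) \<cong> G"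
    using admits_POSR_iff[OF fin] by blast
  interpret two_part_cayley G R L by (rule tpc)
  have finRL: "finite R" "finite L"
    using R_subset L_subset fin by (auto intro: finite_subset)
  have RL: "R \<union> L = carrier G"
  proof (rule card_subset_eq[OF fin])
    show "R \<union> L \<subseteq> carrier G" using R_subset L_subset by blast
    show "card (R \<union> L) = card (carrier G)"
      using card_Un_disjoint[OF finRL disjoint] card_R card_L six by simp
  qed
  define F where "F = (\<lambda>(a, b). (\<lambda>r. a \<otimes> r \<otimes> b) ` R)"
  \<comment> \<open>36 pairs, but only 20 three-element subsets\<close>
  have "\<not> inj_on F (carrier G \<times> carrier G)"
  proof
    assume inj: "inj_on F (carrier G \<times> carrier G)"
    have "F ` (carrier G \<times> carrier G) \<subseteq> {A. A \<subseteq> carrier G \<and> card A = 3}"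
    proof
      fix A assume "A \<in> F ` (carrier G \<times> carrier G)"
      then obtain a b where ab: "a \<in> carrier G" "b \<in> carrier G" "A = (\<lambda>r. a \<otimes> r \<otimes> b) ` R"
        by (auto simp: F_def)
      have "inj_on (\<lambda>r. a \<otimes> r \<otimes> b) R"
        using ab R_subset by (auto simp: inj_on_def subset_iff)
      then show "A \<in> {A. A \<subseteq> carrier G \<and> card A = 3}"
        using ab R_subset by (auto simp: card_image card_R)
    qed
    then have "card (carrier G \<times> carrier G) \<le> card {A. A \<subseteq> carrier G \<and> card A = 3}"
      using inj fin by (intro card_inj_on_le) auto
    also have "\<dots> = 6 choose 3"
      using n_subsets[OF fin, of 3] six by simp
    also have "\<dots> = 20"
      by (simp add: eval_nat_numeral)
    finally show False
      using six by (simp add: card_cartesian_product)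
  qed
  then obtain a b a' b' where ab: "a \<in> carrier G" "b \<in> carrier G" "a' \<in> carrier G" "b' \<in> carrier G"
      "(a, b) \<noteq> (a', b')" "F (a, b) = F (a', b')"
    unfolding inj_on_def by blast
  define p where "p = inv a' \<otimes> a"
  define q where "q = b \<otimes> inv b'"
  have pq: "p \<in> carrier G" "q \<in> carrier G"
    using ab by (auto simp: p_def q_def)
  have "p \<otimes> r \<otimes> q \<in> R" if r: "r \<in> R" for r
  proof -
    have "a \<otimes> r \<otimes> b \<in> F (a', b')"
      using ab(6) r by (auto simp: F_def)
    then obtain r' where r': "r' \<in> R" "a \<otimes> r \<otimes> b = a' \<otimes> r' \<otimes> b'"
      by (auto simp: F_def)
    have G: "r \<in> carrier G" "r' \<in> carrier G"
      using r r' R_subset by auto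
    have "p \<otimes> r \<otimes> q = inv a' \<otimes> (a \<otimes> r \<otimes> b) \<otimes> inv b'"
      using ab G by (simp add: p_def q_def m_assoc)
    also have "\<dots> = (inv a' \<otimes> a') \<otimes> r' \<otimes> (b' \<otimes> inv b')"
      unfolding r'(2) using ab G by (simp only: m_assoc inv_closed m_closed)
    finally show ?thesis
      using ab G r' by simp
  qed
  then have image: "(\<lambda>r. p \<otimes> r \<otimes> q) ` R = R"
  proof (intro card_subset_eq[OF finRL(1)])
    have "inj_on (\<lambda>r. p \<otimes> r \<otimes> q) R"
      using pq R_subset by (auto simp: inj_on_def subset_iff)
    then show "card ((\<lambda>r. p \<otimes> r \<otimes> q) ` R) = card R"
      by (rule card_image)
  qed auto
  have R_iff: "p \<otimes> s \<otimes> q \<in> R \<longleftrightarrow> s \<in> R" if s: "s \<in> carrier G" for s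
  proof
    assume "p \<otimes> s \<otimes> q \<in> R"
    then obtain r where r: "r \<in> R" "p \<otimes> s \<otimes> q = p \<otimes> r \<otimes> q"
      using image by auto
    then have "s = r"
      using s pq R_subset by (auto simp: subset_iff)
    then show "s \<in> R" using r by simp
  qed (use image in blast)
  have L_iff: "p \<otimes> s \<otimes> q \<in> L \<longleftrightarrow> s \<in> L" if s: "s \<in> carrier G" for s
  proof -
    have "t \<in> L \<longleftrightarrow> t \<notin> R" if "t \<in> carrier G" for t
      using RL disjoint that by blast
    then show ?thesis
      using R_iff[OF s] s pq by simp
  qed
  define \<psi> where "\<psi> = (\<lambda>v \<in> pverts \<Gamma>. if snd v = 0 then (inv q \<otimes> fst v, 0) else (p \<otimes> fst v, 1 :: nat))"
  define \<phi> where "\<phi> = (\<lambda>v \<in> pverts \<Gamma>. if snd v = 0 then (q \<otimes> fst v, 0) else (inv p \<otimes> fst v, 1 :: nat))"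
  have \<psi>0: "\<psi> (g, 0) = (inv q \<otimes> g, 0)" and \<psi>1: "\<psi> (g, 1) = (p \<otimes> g, 1)" if "g \<in> carrier G" for g
    using that by (auto simp: \<psi>_def verts)
  have \<psi>_Aut: "\<psi> \<in> carrier (Aut_group \<Gamma>)"
    unfolding carrier_Aut_iff Bij_def
  proof (intro conjI IntI ballI CollectI)
    show "\<psi> \<in> extensional (pverts \<Gamma>)"
      by (simp add: \<psi>_def)
    show "bij_betw \<psi> (pverts \<Gamma>) (pverts \<Gamma>)"
    proof (rule bij_betw_byWitness[where f' = \<phi>])
      have cancel: "q \<otimes> (inv q \<otimes> g) = g" "inv q \<otimes> (q \<otimes> g) = g" "inv p \<otimes> (p \<otimes> g) = g" "p \<otimes> (inv p \<otimes> g) = g"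
        if "g \<in> carrier G" for g
        using pq that by (simp_all add: m_assoc[symmetric])
      show "\<forall>v\<in>pverts \<Gamma>. \<phi> (\<psi> v) = v" "\<forall>v\<in>pverts \<Gamma>. \<psi> (\<phi> v) = v"
        using pq cancel by (auto simp: \<psi>_def \<phi>_def verts)
      show "\<psi> ` pverts \<Gamma> \<subseteq> pverts \<Gamma>" "\<phi> ` pverts \<Gamma> \<subseteq> pverts \<Gamma>"
        using pq by (auto simp: \<psi>_def \<phi>_def verts)
    qed
    fix u v assume uv: "u \<in> pverts \<Gamma>" "v \<in> pverts \<Gamma>"
    have lab: "p \<otimes> h \<otimes> inv (inv q \<otimes> g) = p \<otimes> (h \<otimes> inv g) \<otimes> q"
      if "g \<in> carrier G" "h \<in> carrier G" for g h
      using pq that by (simp add: inv_mult_group m_assoc)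
    obtain g i h j where *: "u = (g, i)" "v = (h, j)" "g \<in> carrier G" "h \<in> carrier G" "i = 0 \<or> i = 1" "j = 0 \<or> j = 1"
      using uv by (auto simp: verts)
    have G: "h \<otimes> inv g \<in> carrier G" "g \<otimes> inv h \<in> carrier G"
      using * by auto
    show "(u, v) \<in> parcs \<Gamma> \<longleftrightarrow> (\<psi> u, \<psi> v) \<in> parcs \<Gamma>"
      using *(5,6) R_iff[OF G(1)] L_iff[OF G(2)] lab[OF *(3,4)] lab[OF *(4,3)] *(1-4) pq
        \<psi>0[OF *(3)] \<psi>0[OF *(4)] \<psi>1[OF *(3)] \<psi>1[OF *(4)]
      by (elim disjE) (simp_all add: arcs_iff label_def)
  qed
  have not_trans: "\<psi> \<notin> translation ` carrier G"
  proof
    assume "\<psi> \<in> translation ` carrier G"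
    then obtain c where c: "c \<in> carrier G" "\<psi> = translation c"
      by blast
    have q: "inv q = inv c"
      using \<psi>0[OF one_closed] c pq by simp
    have p: "p \<otimes> g = g \<otimes> inv c" if "g \<in> carrier G" for g
      using \<psi>1[OF that] c that by simp
    have pc: "p = inv c"
      using p[OF one_closed] pq c by simp
    then have "p = \<one>"
      using p pq by (intro centreless) auto
    then have "q = \<one>"
      using q pc pq by (metis inv_inv inv_one)
    have "a = a'"
      using \<open>p = \<one>\<close> ab unfolding p_def by (metis inv_closed inv_equality inv_inv inv_comm)
    moreover have "b = b'"
      using \<open>q = \<one>\<close> ab unfolding q_def by (metis inv_closed inv_equality inv_inv)
    ultimately show False
      using ab(5) by simp
  qed
  obtain h where "h \<in> Group.iso (Aut_group \<Gamma>) G"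
    using iso by (auto simp: is_iso_def)
  then have bij: "bij_betw h (carrier (Aut_group \<Gamma>)) (carrier G)"
    by (simp add: iso_def)
  have finA: "finite (carrier (Aut_group \<Gamma>))"
    using bij fin bij_betw_finite by blast
  have "insert \<psi> (translation ` carrier G) \<subseteq> carrier (Aut_group \<Gamma>)"
    using \<psi>_Aut translation_Aut by blast
  then have "card (insert \<psi> (translation ` carrier G)) \<le> card (carrier (Aut_group \<Gamma>))"
    by (rule card_mono[OF finA])
  also have "\<dots> = 6"
    using bij_betw_same_card[OF bij] six by simp
  finally show False
    using not_trans fin six inj_translation by (simp add: card_image)
qed

end

section \<open>Generating pairs and small element orders\<close>

context group begin

lemma generating_pairI:
  assumes "a \<in> carrier G" "b \<in> carrier G" "generating_pair G x y"
    "x \<in> generate G {a, b}" "y \<in> generate G {a, b}"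
  shows "generating_pair G a b"
proof -
  have sub: "subgroup (generate G {a, b}) G"
    using assms(1,2) by (intro generate_is_subgroup) auto
  have "generate G {x, y} \<subseteq> generate G {a, b}"
    using assms(4,5) by (intro generate_subgroup_incl[OF _ sub]) auto
  then have "generate G {a, b} = carrier G"
    using assms(3) subgroup.subset[OF sub] by (auto simp: generating_pair_def)
  then show ?thesis
    using assms(1,2) by (simp add: generating_pair_def)
qed

lemma generating_pair_commute: "generating_pair G x y \<Longrightarrow> generating_pair G y x"
  by (simp add: generating_pair_def insert_commute)

lemma generating_pair_mult:
  assumes gp: "generating_pair G x y"
  shows "generating_pair G (x \<otimes> y) y" "generating_pair G (x \<otimes> inv y) y"
proof -
  have xy: "x \<in> carrier G" "y \<in> carrier G"
    using gp by (auto simp: generating_pair_def)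
  have "x \<otimes> y \<otimes> inv y \<in> generate G {x \<otimes> y, y}"
    by (intro generate.eng[OF generate.incl generate.inv]) auto
  then show "generating_pair G (x \<otimes> y) y"
    using xy gp by (intro generating_pairI[OF _ _ gp]) (auto simp: m_assoc intro: generate.incl)
  have "x \<otimes> inv y \<otimes> y \<in> generate G {x \<otimes> inv y, y}"
    by (intro generate.eng[OF generate.incl generate.incl]) auto
  then show "generating_pair G (x \<otimes> inv y) y"
    using xy gp by (intro generating_pairI[OF _ _ gp]) (auto simp: m_assoc intro: generate.incl)
qed

lemma generating_pair_powers:
  assumes gp: "generating_pair G x y" and nc: "\<not> cyclic_group G"
  shows "y \<notin> powers x"
proof
  assume y: "y \<in> powers x"
  have xG: "x \<in> carrier G" using gp by (simp add: generating_pair_def)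
  have "x \<in> powers x"
    using xG int_pow_1[of x] by (metis rangeI)
  then have "generate G {x, y} \<subseteq> powers x"
    using y by (intro generate_subgroup_incl[OF _ powers_subgroup[OF xG]]) auto
  then have "carrier G = powers x"
    using gp xG by (auto simp: generating_pair_def)
  then show False
    using nc cyclic_group xG by blast
qed

lemma not_cyclic_if_both_powers:
  assumes gp: "generating_pair G x y" and nc: "\<not> cyclic_group G" and z: "z \<in> carrier G"
    and mem: "x \<in> powers z" "y \<in> powers z"
  shows False
proof -
  have "generate G {x, y} \<subseteq> powers z"
    using mem by (intro generate_subgroup_incl[OF _ powers_subgroup[OF z]]) auto
  then have "carrier G = powers z"
    using gp z by (auto simp: generating_pair_def)
  then show False
    using nc cyclic_group z by blast
qed

text \<open>
  If $y^m = 1$, then \<open>xy\<close> generates \<open>G\<close>; otherwise $y^m$ generates \<open>\<langle>x\<rangle>\<close>, and \<open>y\<close>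
  generates.
\<close>

lemma cyclic_if_commuting_order_5:
  assumes gp: "generating_pair G x y" and ord: "ord x = 5" and comm: "x \<otimes> y = y \<otimes> x"
    and m: "m = 2 \<or> m = (3::int)" and mem: "y [^] m \<in> powers x"
  shows "cyclic_group G"
proof (rule ccontr)
  assume nc: "\<not> cyclic_group G"
  have xy: "x \<in> carrier G" "y \<in> carrier G"
    using gp by (auto simp: generating_pair_def)
  obtain j where j: "y [^] m = x [^] (j::int)" using mem by auto
  show False
  proof (cases "5 dvd j")
    case True
    then have "y [^] m = \<one>"
      using j int_pow_eq_id[OF xy(1), of j] ord by simp
    then have zm: "(x \<otimes> y) [^] m = x [^] m"
      using int_pow_mult_distrib[OF comm xy] xy by simp
    have "\<not> 5 dvd m" using m by auto
    then obtain s :: int where "((x \<otimes> y) [^] m) [^] s = x"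
      using power_inverse_mod_5[OF xy(1) ord] zm by metis
    then have x: "x = (x \<otimes> y) [^] (m * s)"
      using xy by (simp add: int_pow_pow)
    have "y = inv x \<otimes> (x \<otimes> y)"
      using xy by (simp add: inv_mult_cancel)
    also have "\<dots> = (x \<otimes> y) [^] (- (m * s)) \<otimes> (x \<otimes> y) [^] (1::int)"
      using x xy by (simp add: int_pow_neg)
    also have "\<dots> = (x \<otimes> y) [^] (- (m * s) + 1)"
      by (rule int_pow_mult[symmetric]) (use xy in simp)
    finally show False
      using not_cyclic_if_both_powers[OF gp nc, of "x \<otimes> y"] x xy by blast
  next
    case False
    then obtain s :: int where "(x [^] j) [^] s = x"
      using power_inverse_mod_5[OF xy(1) ord] by blast
    then have "x = y [^] (m * s)"
      using j xy by (simp add: int_pow_pow[symmetric])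
    then show False
      using generating_pair_powers[OF generating_pair_commute[OF gp] nc] by blast
  qed
qed

text \<open>
  If \<open>y\<close> normalises \<open>\<langle>x\<rangle>\<close> and acts on it as the \<open>u\<close>-th power, then $y^m \in \langle x\rangle$
  implies $u^m = 1$ modulo 5.  For \<open>m = 3\<close> this forces \<open>u = 1\<close>, and for \<open>m = 2\<close> it allows
  \<open>u = -1\<close>, the dihedral group.
\<close>

lemma admits_POSR_if_generator_of_order_5:
  assumes fin: "finite (carrier G)" and nc: "\<not> cyclic_group G"
    and gp: "generating_pair G x y" and ord: "ord x = 5"
  shows "admits_POSR G 2 3"
proof (cases "inv y \<otimes> x \<otimes> y \<in> powers x")
  have xy: "x \<in> carrier G" "y \<in> carrier G" and gen: "generate G {x, y} = carrier G"
    using gp by (auto simp: generating_pair_def)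
  case False
  then show ?thesis
    using admits_POSR_order_5_not_normalised[OF fin xy gen ord] by blast
next
  have xy: "x \<in> carrier G" "y \<in> carrier G" and gen: "generate G {x, y} = carrier G"
    using gp by (auto simp: generating_pair_def)
  case True
  then obtain u where u: "inv y \<otimes> x \<otimes> y = x [^] (u::int)"
    by auto
  have y1: "y \<notin> powers x"
    by (rule generating_pair_powers[OF gp nc])
  have pow_eq: "x [^] i = x [^] j \<longleftrightarrow> 5 dvd i - j" for i j :: int
    using int_pow_eq[OF xy(1), of i j] ord by (simp add: dvd_diff_commute)
  have conj: "inv y \<otimes> x [^] k \<otimes> y = x [^] (u * k)" for k :: int
    using conj_int_pow[OF xy(2,1), of k] xy by (simp add: u int_pow_pow)
  have commuting: "x \<otimes> y = y \<otimes> x" if "5 dvd u - 1"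
  proof -
    have "inv y \<otimes> x \<otimes> y = x"
      using that pow_eq[of u 1] u xy by simp
    then have "y \<otimes> (inv y \<otimes> (x \<otimes> y)) = y \<otimes> x"
      using xy by (simp add: m_assoc)
    then show ?thesis
      using xy by (simp add: mult_inv_cancel)
  qed
  have y2: "y [^] (2::int) = y \<otimes> y" and y3: "y [^] (3::int) = y \<otimes> y \<otimes> y"
    using xy int_pow_mult[of y 1 1] int_pow_mult[of y 2 1] by simp_all
  consider (none) "y \<otimes> y \<notin> powers x" "y \<otimes> y \<otimes> y \<notin> powers x"
    | (square) "y \<otimes> y \<in> powers x" | (cube) "y \<otimes> y \<otimes> y \<in> powers x"
    by blast
  then show ?thesis
  proof cases
    case none
    then show ?thesis
      using admits_POSR_order_5_normalised[OF fin xy gen ord True y1] by blast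
  next
    case square
    then obtain j where j: "y \<otimes> y = x [^] (j::int)" by auto
    have "x [^] (u * u) = inv y \<otimes> (inv y \<otimes> x \<otimes> y) \<otimes> y"
      unfolding u by (simp add: conj)
    also have "\<dots> = inv (y \<otimes> y) \<otimes> x \<otimes> (y \<otimes> y)"
      using xy by (simp add: inv_mult_group m_assoc)
    also have "\<dots> = x [^] (- j + 1 + j)"
      unfolding j using xy by (simp only: int_pow_mult int_pow_neg int_pow_1 int_pow_closed)
    finally have "5 dvd u * u - 1"
      using pow_eq[of "u * u" 1] by simp
    then have "5 dvd (u - 1) * (u + 1)"
      by (simp add: algebra_simps)
    then have "5 dvd u - 1 \<or> 5 dvd u + 1"
      using prime_dvd_mult_iff[of "5::int"] by simp
    then show ?thesis
    proof
      assume "5 dvd u - 1"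
      then show ?thesis
        using cyclic_if_commuting_order_5[OF gp ord commuting, of 2] square nc by (simp add: y2)
    next
      assume u1: "5 dvd u + 1"
      then have "inv y \<otimes> x \<otimes> y = x [^] (- 1 :: int)"
        using pow_eq[of u "- 1"] u by simp
      then have inv: "inv y \<otimes> x \<otimes> y = inv x"
        using xy by (simp add: int_pow_neg)
      have "x [^] j = inv y \<otimes> (y \<otimes> y) \<otimes> y"
        unfolding j[symmetric] using xy by (simp add: m_assoc inv_mult_cancel)
      then have "x [^] j = x [^] (u * j)"
        unfolding j conj .
      then have "5 dvd (1 - u) * j"
        using pow_eq by (simp add: algebra_simps)
      moreover have "\<not> 5 dvd 1 - u"
        using u1 by presburger
      ultimately have "5 dvd j"
        using prime_dvd_mult_iff[of "5::int" "1 - u" j] by simp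
      then have yy: "y \<otimes> y = \<one>"
        using j pow_eq[of j 0] by simp
      have "x \<otimes> y = y \<otimes> inv x"
      proof -
        have "y \<otimes> (inv y \<otimes> (x \<otimes> y)) = y \<otimes> inv x"
          using inv xy by (simp add: m_assoc)
        then show ?thesis using xy by (simp add: mult_inv_cancel)
      qed
      then have "inv x \<otimes> (x \<otimes> y) \<otimes> x = inv x \<otimes> (y \<otimes> inv x) \<otimes> x"
        by simp
      then have rel: "y \<otimes> x = inv x \<otimes> y"
        using xy by (simp add: inv_mult_cancel m_assoc)
      have "x [^] (5::int) = \<one>" "x \<noteq> \<one>"
        using pow_eq[of 5 0] pow_eq[of 1 0] xy by simp_all
      then show ?thesis
        using admits_POSR_dihedral_10[OF fin xy gen _ _ yy rel y1] by blast
    qed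
  next
    case cube
    then obtain j where j: "y \<otimes> y \<otimes> y = x [^] (j::int)" by auto
    have "x [^] (u * (u * u)) = inv y \<otimes> (inv y \<otimes> (inv y \<otimes> x \<otimes> y) \<otimes> y) \<otimes> y"
      unfolding u by (simp add: conj)
    also have "\<dots> = inv (y \<otimes> y \<otimes> y) \<otimes> x \<otimes> (y \<otimes> y \<otimes> y)"
      using xy by (simp add: inv_mult_group m_assoc)
    also have "\<dots> = x [^] (- j + 1 + j)"
      unfolding j using xy by (simp only: int_pow_mult int_pow_neg int_pow_1 int_pow_closed)
    finally have "5 dvd u ^ 3 - 1"
      using pow_eq[of "u * (u * u)" 1] by (simp add: power3_eq_cube mult.assoc)
    then have "(u mod 5) ^ 3 mod 5 = 1"
      using mod_eq_dvd_iff[of "u ^ 3" 5 1] by (simp add: power_mod)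
    moreover have "u mod 5 = 0 \<or> u mod 5 = 1 \<or> u mod 5 = 2 \<or> u mod 5 = 3 \<or> u mod 5 = 4"
      by presburger
    ultimately have "u mod 5 = 1"
      by (elim disjE) simp_all
    then have "5 dvd u - 1"
      using mod_eq_dvd_iff[of u 5 1] by simp
    then show ?thesis
      using cyclic_if_commuting_order_5[OF gp ord commuting, of 3] cube nc by (simp add: y3)
  qed
qed

lemma iso_if_generators_in_image:
  assumes H: "group H" and hom: "f \<in> hom H G" and inj: "inj_on f (carrier H)"
    and gp: "generating_pair G x y" and im: "x \<in> f ` carrier H" "y \<in> f ` carrier H"
  shows "G \<cong> H"
proof -
  have "subgroup (f ` carrier H) G"
    by (rule group_hom.img_is_subgroup)
      (use H hom in \<open>simp add: group_hom_def group_hom_axioms_def is_group\<close>)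
  then have "generate G {x, y} \<subseteq> f ` carrier H"
    using im generate_subgroup_incl[of "{x, y}" "f ` carrier H"] by blast
  then have "f ` carrier H = carrier G"
    using gp hom by (auto simp: generating_pair_def hom_def)
  then have "H \<cong> G"
    using hom inj by (auto simp: is_iso_def iso_def bij_betw_def)
  then show ?thesis
    by (rule group.iso_sym[OF H])
qed

lemma iso_Z2_times_Z2:
  assumes gp: "generating_pair G x y" and nc: "\<not> cyclic_group G"
    and x2: "x \<otimes> x = \<one>" and y2: "y \<otimes> y = \<one>" and comm: "x \<otimes> y = y \<otimes> x"
  shows "G \<cong> integer_mod_group 2 \<times>\<times> integer_mod_group 2"
proof (rule iso_if_generators_in_image[OF _ _ _ gp])
  let ?H = "integer_mod_group 2 \<times>\<times> integer_mod_group 2"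
  define f where "f = (\<lambda>(i::int, j::int). x [^] i \<otimes> y [^] j)"
  have xy: "x \<in> carrier G" "y \<in> carrier G"
    using gp by (auto simp: generating_pair_def)
  have carrier: "carrier ?H = {(0, 0), (0, 1), (1, 0), (1, 1)}"
    by (auto simp: integer_mod_group_def DirProd_def)
  have f: "f (0, 0) = \<one>" "f (0, 1) = y" "f (1, 0) = x" "f (1, 1) = x \<otimes> y"
    using xy by (simp_all add: f_def)
  have x1: "x \<noteq> \<one>"
    using generating_pair_powers[OF generating_pair_commute[OF gp] nc] int_pow_0 by (metis rangeI)
  have y1: "y \<noteq> \<one>"
    using generating_pair_powers[OF gp nc] int_pow_0 by (metis rangeI)
  have "x \<noteq> y"
    using generating_pair_powers[OF gp nc] int_pow_1[OF xy(1)] by (metis rangeI)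
  moreover have "x \<otimes> y \<noteq> \<one>"
  proof
    assume "x \<otimes> y = \<one>"
    then have "x \<otimes> (x \<otimes> y) = x" using xy by simp
    then show False
      using xy x2 \<open>x \<noteq> y\<close> by (simp add: m_assoc[symmetric])
  qed
  ultimately show "inj_on f (carrier ?H)"
    unfolding carrier using x1 y1 xy by (auto simp: inj_on_def f)
  show "group ?H"
    by (intro DirProd_group group_integer_mod_group)
  show "x \<in> f ` carrier ?H" "y \<in> f ` carrier ?H"
    unfolding carrier by (auto simp: f)
  have assoc: "x \<otimes> (x \<otimes> g) = g" "y \<otimes> (y \<otimes> g) = g" "y \<otimes> (x \<otimes> g) = x \<otimes> (y \<otimes> g)" if "g \<in> carrier G" for g
    using that xy x2 y2 comm by (simp_all add: m_assoc[symmetric])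
  show "f \<in> hom ?H G"
  proof (rule homI)
    show "f p \<in> carrier G" if "p \<in> carrier ?H" for p
      using xy by (auto simp: f_def split_beta)
    show "f (p \<otimes>\<^bsub>?H\<^esub> q) = f p \<otimes> f q" if "p \<in> carrier ?H" "q \<in> carrier ?H" for p q
      using that unfolding carrier
      by (elim insertE emptyE) (simp_all add: integer_mod_group_def DirProd_def f xy x2 y2 comm[symmetric] m_assoc assoc)
  qed
qed

lemma iso_dihedral_6:
  assumes gp: "generating_pair G r y" and nc: "\<not> cyclic_group G"
    and r3: "r [^] (3::int) = \<one>" and y2: "y \<otimes> y = \<one>" and rel: "y \<otimes> r = inv r \<otimes> y"
  shows "G \<cong> dihedral_group 6"
proof (rule iso_if_generators_in_image[OF _ _ _ gp])
  define f where "f = (\<lambda>(a::int, s). r [^] a \<otimes> (if s then y else \<one>))"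
  have ry: "r \<in> carrier G" "y \<in> carrier G"
    using gp by (auto simp: generating_pair_def)
  have r1: "r \<noteq> \<one>"
    using generating_pair_powers[OF generating_pair_commute[OF gp] nc] int_pow_0 by (metis rangeI)
  have y: "y \<notin> powers r"
    by (rule generating_pair_powers[OF gp nc])
  have carrier: "carrier (dihedral_group 6) = {0..<3} \<times> UNIV"
    by (simp add: dihedral_group_def)
  have mult: "p \<otimes>\<^bsub>dihedral_group 6\<^esub> q = dihedral_mult 3 p q" for p q
    by (simp add: dihedral_group_def dihedral_mult_def)
  show "group (dihedral_group 6)"
    by (rule group_dihedral_group) auto
  show "f \<in> hom (dihedral_group 6) G"
  proof (rule homI)
    show "f p \<in> carrier G" for p
      using ry by (auto simp: f_def split_beta)
    show "f (p \<otimes>\<^bsub>dihedral_group 6\<^esub> q) = f p \<otimes> f q" for p q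
      unfolding mult f_def by (rule dihedral_parametrisation[OF ry r3 y2 rel])
  qed
  show "inj_on f (carrier (dihedral_group 6))"
    unfolding f_def carrier using inj_on_dihedral_parametrisation[OF ry r1 _ r3 y] by simp
  have "f (1, False) = r" "f (0, True) = y"
    using ry by (simp_all add: f_def)
  moreover have "(1, False) \<in> carrier (dihedral_group 6)" "(0, True) \<in> carrier (dihedral_group 6)"
    by (simp_all add: carrier)
  ultimately show "r \<in> f ` carrier (dihedral_group 6)" "y \<in> f ` carrier (dihedral_group 6)"
    by (metis image_eqI)+
qed

text \<open>
  As \<open>b\<close> has order 3, this product is $(ab)^3$.
\<close>

lemma product_of_conjugates:
  assumes G: "a \<in> carrier G" "b \<in> carrier G" and b3: "ord b = 3" and ab3: "ord (a \<otimes> b) = 3"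
  shows "(a \<otimes> (b \<otimes> a \<otimes> inv b)) \<otimes> (b \<otimes> (b \<otimes> a \<otimes> inv b) \<otimes> inv b) = \<one>"
proof -
  have cube: "g \<otimes> (g \<otimes> g) = \<one>" if "g \<in> carrier G" "ord g = 3" for g
    using pow_ord_eq_1[OF that(1)] that by (simp add: eval_nat_numeral m_assoc)
  have "inv b = b \<otimes> b"
    using inv_equality[of "b \<otimes> b" b] cube[OF G(2) b3] G by (simp add: m_assoc)
  moreover have "b \<otimes> (b \<otimes> (b \<otimes> g)) = g" if "g \<in> carrier G" for g
    using cube[OF G(2) b3] that G by (metis m_assoc m_closed l_one)
  ultimately show ?thesis
    using cube[of "a \<otimes> b"] ab3 G by (simp add: m_assoc)
qed

text \<open>
  Two involutions generate a dihedral group, whose rotation \<open>ab\<close> has order 2 or 3.  If \<open>a\<close> and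
  \<open>ab\<close> are involutions, they are generators of this kind.  In the other cases \<open>b\<close> has order 3;
  let \<open>a, c, d\<close> be the conjugates of \<open>a\<close> under \<open>\<langle>b\<rangle>\<close>.  Then
  $(ab)^3 = 1$ says \<open>acd = 1\<close>.  If \<open>a\<close> is an involution, so are the conjugates, and \<open>ac = d\<close> gives that
  they commute.  If \<open>a\<close> has order 3, the same conclusion follows from $(ab^{-1})^3 = 1$, which says
  \<open>adc = 1\<close>.
\<close>

lemma small_orders_classification:
  assumes fin: "finite (carrier G)" and nc: "\<not> cyclic_group G"
    and gp: "generating_pair G x y"
    and orders: "\<And>a b. generating_pair G a b \<Longrightarrow> ord a \<in> {2, 3}"
  shows "admits_POSR G 2 3 \<or> G \<cong> integer_mod_group 2 \<times>\<times> integer_mod_group 2 \<or> G \<cong> dihedral_group 6"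
proof -
  have sq: "a \<otimes> a = \<one>" if "a \<in> carrier G" "ord a = 2" for a
    using pow_ord_eq_1[OF that(1)] that by (simp add: eval_nat_numeral)
  have cu: "a \<otimes> (a \<otimes> a) = \<one>" "a [^] (3::int) = \<one>" if "a \<in> carrier G" "ord a = 3" for a
    using pow_ord_eq_1[OF that(1)] that int_pow_int[of G a 3] by (simp_all add: eval_nat_numeral m_assoc)
  have gpG: "a \<in> carrier G" "b \<in> carrier G" if "generating_pair G a b" for a b
    using that by (auto simp: generating_pair_def)
  have two_two: ?thesis if gp: "generating_pair G a b" and ords: "ord a = 2" "ord b = 2" for a b
  proof -
    note G = gpG[OF gp]
    note a2 = sq[OF G(1) ords(1)] and b2 = sq[OF G(2) ords(2)]
    have inv: "inv a = a" "inv b = b"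
      using inv_equality[OF a2 G(1,1)] inv_equality[OF b2 G(2,2)] by auto
    have gp': "generating_pair G (a \<otimes> b) b"
      by (rule generating_pair_mult[OF gp])
    consider "ord (a \<otimes> b) = 2" | "ord (a \<otimes> b) = 3"
      using orders[OF gp'] by blast
    then show ?thesis
    proof cases
      case 1
      then have "inv (a \<otimes> b) = a \<otimes> b"
        using sq[of "a \<otimes> b"] inv_equality[of "a \<otimes> b" "a \<otimes> b"] G by simp
      then have "a \<otimes> b = b \<otimes> a"
        using G inv by (simp add: inv_mult_group)
      then show ?thesis
        using iso_Z2_times_Z2[OF gp nc a2 b2] by blast
    next
      case 2
      have "b \<otimes> (a \<otimes> b) = inv (a \<otimes> b) \<otimes> b"
        using G inv by (simp add: inv_mult_group m_assoc)
      then show ?thesis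
        using iso_dihedral_6[OF gp' nc _ b2] cu(2)[of "a \<otimes> b"] 2 G by blast
    qed
  qed
  have semidirect: "admits_POSR G 2 3"
    if gp: "generating_pair G a b" and n: "n = 2 \<or> n = (3::int)" and an: "a [^] n = \<one>" and b3: "ord b = 3"
      and ab3: "ord (a \<otimes> b) = 3" and comm: "a \<otimes> (b \<otimes> a \<otimes> inv b) = (b \<otimes> a \<otimes> inv b) \<otimes> a"
      and ne: "a \<otimes> b \<noteq> b \<otimes> a" for a b n
  proof -
    note G = gpG[OF gp]
    have gen: "generate G {a, b} = carrier G"
      using gp by (simp add: generating_pair_def)
    define c where "c = b \<otimes> a \<otimes> inv b"
    have cG: "c \<in> carrier G" using G by (simp add: c_def)
    have "b \<otimes> a = c \<otimes> b"
      using G by (simp add: c_def m_assoc)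
    moreover have "b \<otimes> c = inv (a \<otimes> c) \<otimes> b"
    proof -
      have "(a \<otimes> c) \<otimes> (b \<otimes> c \<otimes> inv b) = \<one>"
        unfolding c_def by (rule product_of_conjugates[OF G b3 ab3])
      then have "inv (a \<otimes> c) \<otimes> ((a \<otimes> c) \<otimes> (b \<otimes> c \<otimes> inv b)) \<otimes> b = inv (a \<otimes> c) \<otimes> b"
        using G cG by simp
      moreover have "b \<otimes> c \<otimes> inv b \<otimes> b = b \<otimes> c"
        using G cG by (simp add: m_assoc)
      ultimately show ?thesis
        using G cG inv_mult_cancel[of "a \<otimes> c" "b \<otimes> c \<otimes> inv b"] by simp
    qed
    ultimately show ?thesis
      using admits_POSR_semidirect[OF fin G gen n an cu(2)[OF G(2) b3] cG _ _ _ ne] comm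
      unfolding c_def[symmetric] by blast
  qed
  have two_three: ?thesis if gp: "generating_pair G a b" and ords: "ord a = 2" "ord b = 3" for a b
  proof -
    note G = gpG[OF gp]
    note a2 = sq[OF G(1) ords(1)]
    have ia: "inv a = a"
      using inv_equality[OF a2 G(1,1)] .
    have gp': "generating_pair G (a \<otimes> b) b"
      by (rule generating_pair_mult[OF gp])
    consider (2) "ord (a \<otimes> b) = 2" | (3) "ord (a \<otimes> b) = 3"
      using orders[OF gp'] by blast
    then show ?thesis
    proof cases
      case 2
      have "generating_pair G a (a \<otimes> b)"
      proof (rule generating_pairI[OF _ _ gp])
        have "a \<otimes> (a \<otimes> b) \<in> generate G {a, a \<otimes> b}"
          by (intro generate.eng generate.incl) auto
        then show "b \<in> generate G {a, a \<otimes> b}"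
          using G a2 by (simp add: m_assoc[symmetric])
      qed (use G in \<open>auto intro: generate.incl\<close>)
      then show ?thesis
        using two_two ords 2 by blast
    next
      case 3
      have ne: "a \<otimes> b \<noteq> b \<otimes> a"
      proof
        assume comm: "a \<otimes> b = b \<otimes> a"
        have "(a \<otimes> b) [^] (3::int) = a [^] (3::int) \<otimes> b [^] (3::int)"
          using int_pow_mult_distrib[OF comm G] by blast
        then have "a [^] (3::int) = \<one>"
          using cu(2)[of "a \<otimes> b"] cu(2)[OF G(2) ords(2)] 3 G by simp
        then have "ord a dvd 3"
          using int_pow_eq_id[OF G(1), of 3] by presburger
        then show False using ords by simp
      qed
      define c where "c = b \<otimes> a \<otimes> inv b"
      have cG: "c \<in> carrier G" using G by (simp add: c_def)
      have cc: "c \<otimes> c = \<one>"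
      proof -
        have "c \<otimes> c = b \<otimes> (a \<otimes> (inv b \<otimes> (b \<otimes> (a \<otimes> inv b))))"
          using G by (simp add: c_def m_assoc)
        also have "\<dots> = b \<otimes> ((a \<otimes> a) \<otimes> inv b)"
          using G by (simp add: inv_mult_cancel m_assoc)
        finally show ?thesis using a2 G by simp
      qed
      define d where "d = b \<otimes> c \<otimes> inv b"
      have dG: "d \<in> carrier G" using G cG by (simp add: d_def)
      have dd: "d \<otimes> d = \<one>"
      proof -
        have "d \<otimes> d = b \<otimes> (c \<otimes> (inv b \<otimes> (b \<otimes> (c \<otimes> inv b))))"
          using G cG by (simp add: d_def m_assoc)
        also have "\<dots> = b \<otimes> ((c \<otimes> c) \<otimes> inv b)"
          using G cG by (simp add: inv_mult_cancel m_assoc)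
        finally show ?thesis using cc G by simp
      qed
      have "(a \<otimes> c) \<otimes> d = \<one>"
        unfolding d_def c_def by (rule product_of_conjugates[OF G ords(2) 3])
      then have "a \<otimes> c = inv d"
        using inv_equality[of "a \<otimes> c" d] G cG dG by simp
      also have "\<dots> = d"
        using inv_equality[OF dd dG dG] .
      finally have "a \<otimes> c = d" .
      then have "inv (a \<otimes> c) = a \<otimes> c"
        using inv_equality[OF dd dG dG] by simp
      then have "a \<otimes> c = c \<otimes> a"
        using G cG ia inv_equality[OF cc cG cG] by (simp add: inv_mult_group)
      moreover have "a [^] (2::int) = \<one>"
        using a2 G int_pow_mult[of a 1 1] by simp
      ultimately show ?thesis
        using semidirect[OF gp, of 2] ords(2) 3 ne unfolding c_def by blast
    qed
  qed
  show ?thesis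
  proof (cases "\<exists>a b. generating_pair G a b \<and> ord a = 2")
    case True
    then obtain a b where "generating_pair G a b" "ord a = 2" by blast
    moreover have "ord b = 2 \<or> ord b = 3"
      using orders[OF generating_pair_commute[OF \<open>generating_pair G a b\<close>]] by blast
    ultimately show ?thesis
      using two_two two_three by blast
  next
    case False
    then have three: "ord a = 3" if "generating_pair G a b" for a b
      using orders[OF that] that by blast
    note G = gpG[OF gp]
    have gen: "generate G {x, y} = carrier G"
      using gp by (simp add: generating_pair_def)
    have ordx: "ord x = 3" and ordy: "ord y = 3" and ordxy: "ord (x \<otimes> y) = 3" and ordxy': "ord (x \<otimes> inv y) = 3"
      using three gp generating_pair_commute[OF gp] generating_pair_mult[OF gp] by blast+
    show ?thesis
    proof (cases "x \<otimes> y = y \<otimes> x")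
      case True
      have "x \<noteq> \<one>" using ordx by auto
      then show ?thesis
        using admits_POSR_elementary_abelian_9[OF fin G gen True cu(2)[OF G(1) ordx] _ cu(2)[OF G(2) ordy]
            generating_pair_powers[OF gp nc]] by blast
    next
      case False
      have iy: "inv y = y \<otimes> y"
        using inv_equality[of "y \<otimes> y" y] cu(1)[OF G(2) ordy] G by (simp add: m_assoc)
      have yyyg: "y \<otimes> (y \<otimes> (y \<otimes> g)) = g" if "g \<in> carrier G" for g
        using cu(1)[OF G(2) ordy] that G by (metis m_assoc m_closed l_one)
      define c where "c = y \<otimes> x \<otimes> inv y"
      define d where "d = y \<otimes> c \<otimes> inv y"
      have cG: "c \<in> carrier G" and dG: "d \<in> carrier G" using G by (simp_all add: c_def d_def)
      have "(x \<otimes> c) \<otimes> d = \<one>"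
        unfolding d_def c_def by (rule product_of_conjugates[OF G ordy ordxy])
      then have "inv d = x \<otimes> c"
        using inv_equality[of "x \<otimes> c" d] G cG dG by simp
      moreover have "x \<otimes> (d \<otimes> c) = \<one>"
        unfolding d_def c_def iy using cu(1)[of "x \<otimes> inv y"] ordxy' G unfolding iy by (simp add: m_assoc yyyg)
      then have "inv (d \<otimes> c) = x"
        using inv_equality[of x "d \<otimes> c"] G cG dG by simp
      then have "inv c \<otimes> inv d = x"
        using cG dG by (simp add: inv_mult_group)
      then have "c \<otimes> (inv c \<otimes> inv d) = c \<otimes> x"
        by simp
      then have "inv d = c \<otimes> x"
        using cG dG by (simp add: mult_inv_cancel)
      ultimately have "x \<otimes> c = c \<otimes> x"
        by simp
      then show ?thesis
        using semidirect[OF gp, of 3] cu(2)[OF G(1) ordx] ordy ordxy False unfolding c_def by blast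
    qed
  qed
qed

end

lemma dihedral_6_centreless:
  assumes "a \<in> carrier (dihedral_group 6)"
    and "\<And>g. g \<in> carrier (dihedral_group 6) \<Longrightarrow> a \<otimes>\<^bsub>dihedral_group 6\<^esub> g = g \<otimes>\<^bsub>dihedral_group 6\<^esub> a"
  shows "a = \<one>\<^bsub>dihedral_group 6\<^esub>"
proof -
  obtain k s where ks: "a = (k, s)"
    by (cases a)
  then have "0 \<le> k" "k < 3"
    using assms(1) by (auto simp: dihedral_group_def)
  then have "k = 0 \<or> k = 1 \<or> k = 2"
    by linarith
  note a = ks this
  have "(1, False) \<in> carrier (dihedral_group 6)" "(0, True) \<in> carrier (dihedral_group 6)"
    by (simp_all add: dihedral_group_def)
  from assms(2)[OF this(1)] assms(2)[OF this(2)] show ?thesis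
    using a(2) unfolding a(1) by (cases s) (auto simp: dihedral_group_def)
qed

context group begin

lemma not_admits_POSR_if_iso_Z2_times_Z2:
  assumes fin: "finite (carrier G)" and iso: "G \<cong> integer_mod_group 2 \<times>\<times> integer_mod_group 2"
  shows "\<not> admits_POSR G 2 3"
proof -
    have "card (carrier (integer_mod_group 2 \<times>\<times> integer_mod_group 2)) = 4"
      by (simp add: integer_mod_group_def DirProd_def card_cartesian_product)
    then have "card (carrier G) = 4"
      using iso_same_card[OF iso] by simp
    then show ?thesis
      using not_admits_POSR_small[OF fin] by simp
qed

lemma not_admits_POSR_if_iso_dihedral_6:
  assumes fin: "finite (carrier G)" and iso: "G \<cong> dihedral_group 6"
  shows "\<not> admits_POSR G 2 3"
  proof (rule not_admits_POSR_order_6_centreless[OF fin])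
    obtain h where h: "h \<in> Group.iso G (dihedral_group 6)"
      using iso by (auto simp: is_iso_def)
    have hom: "h (a \<otimes> b) = h a \<otimes>\<^bsub>dihedral_group 6\<^esub> h b" if "a \<in> carrier G" "b \<in> carrier G" for a b
      using h that by (auto simp: iso_def hom_def)
    have bij: "bij_betw h (carrier G) (carrier (dihedral_group 6))"
      using h by (simp add: iso_def)
    show "card (carrier G) = 6"
      using iso_same_card[OF iso] order_dihedral_group[of 6] by (simp add: order_def)
    fix a assume a: "a \<in> carrier G" and central: "\<And>g. g \<in> carrier G \<Longrightarrow> a \<otimes> g = g \<otimes> a"
    have "h a = \<one>\<^bsub>dihedral_group 6\<^esub>"
    proof (rule dihedral_6_centreless)
      show "h a \<in> carrier (dihedral_group 6)"
        using bij a by (auto simp: bij_betw_def)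
      fix k assume "k \<in> carrier (dihedral_group 6)"
      then obtain g where "g \<in> carrier G" "k = h g"
        using bij by (auto simp: bij_betw_def)
      then show "h a \<otimes>\<^bsub>dihedral_group 6\<^esub> k = k \<otimes>\<^bsub>dihedral_group 6\<^esub> h a"
        using hom a central by metis
    qed
    moreover have "h \<one> = \<one>\<^bsub>dihedral_group 6\<^esub>"
      using h hom_one[OF _ is_group group_dihedral_group[of 6]] by (auto simp: iso_def)
    ultimately have "h a = h \<one>"
      by simp
    then show "a = \<one>"
      using bij a by (auto simp: bij_betw_def dest: inj_onD)
  qed

theorem admits_POSR_or_exceptional:
  assumes fin: "finite (carrier G)" and nc: "\<not> cyclic_group G"
    and gp: "generating_pair G x y" and not_Phi: "\<not> in_Phi G"
  shows "admits_POSR G 2 3 \<or> G \<cong> integer_mod_group 2 \<times>\<times> integer_mod_group 2 \<or> G \<cong> dihedral_group 6"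
  proof (cases "\<exists>a b. generating_pair G a b \<and> ord a \<ge> 5")
    case True
    then obtain a b where gp_ab: "generating_pair G a b" and ord: "ord a \<ge> 5"
      by blast
    then have ab: "a \<in> carrier G" "b \<in> carrier G" "generate G {a, b} = carrier G"
      by (auto simp: generating_pair_def)
    consider "ord a \<ge> 6" | "ord a = 5"
      using ord by linarith
    then show ?thesis
    proof cases
      case 1
      then show ?thesis
        using admits_POSR_if_order_ge_6[OF fin ab generating_pair_powers[OF gp_ab nc]] by blast
    next
      case 2
      then show ?thesis
        using admits_POSR_if_generator_of_order_5[OF fin nc gp_ab] by blast
    qed
  next
    case False
    have range: "ord a \<in> {1..4}" if "generating_pair G a b" for a b
    proof -
      have "a \<in> carrier G" using that by (simp add: generating_pair_def)
      then have "ord a \<ge> 1"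
        using ord_ge_1[OF fin] by simp
      then show ?thesis
        using False that by force
    qed
    have "ord a \<in> {2, 3}" if ab: "generating_pair G a b" for a b
    proof -
      have aG: "a \<in> carrier G" using ab by (simp add: generating_pair_def)
      have "ord a \<noteq> 1"
      proof
        assume "ord a = 1"
        then have "a = b [^] (0::int)"
          using ord_eq_1[OF aG] by simp
        then show False
          using generating_pair_powers[OF generating_pair_commute[OF ab] nc] by blast
      qed
      moreover have "ord a \<noteq> 4"
      proof
        assume "ord a = 4"
        then have "in_Phi G"
          unfolding in_Phi_def using is_group ab range generating_pair_commute by blast
        then show False using not_Phi by blast
      qed
      ultimately show ?thesis
        using range[OF ab] by force
    qed
    then show ?thesis
      by (rule small_orders_classification[OF fin nc gp])
  qed

end

theorem theorem1p3:
  fixes G :: "('a, 'b) monoid_scheme"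
  assumes "group G"
    and "finite (carrier G)"
    and "\<not> cyclic_group G"
    and "\<exists>x y. generating_pair G x y"
    and "\<not> in_Phi G"
  shows "admits_POSR G 2 3 \<longleftrightarrow>
    \<not> G \<cong> integer_mod_group 2 \<times>\<times> integer_mod_group 2 \<and> \<not> G \<cong> dihedral_group 6"
proof -
  interpret group G by fact
  obtain x y where "generating_pair G x y"
    using assms(4) by blast
  then show ?thesis
    using admits_POSR_or_exceptional[OF assms(2,3) _ assms(5)]
      not_admits_POSR_if_iso_Z2_times_Z2[OF assms(2)] not_admits_POSR_if_iso_dihedral_6[OF assms(2)]
    by blast
qed

end
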